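(* Let $n\ge2$ be an integer. Then the following assertions hold. (i) If $n$ is odd, there exists a one-parameter family $\mathscr G_n=\{\Sigma_\lambda\,;\,\lambda>0\}$ of hyperbolic $n$-translators in $\mathbb H^n\times\mathbb R$ (called hyperbolic $n$-grim reapers) which has the following properties: - For each $\lambda>0$, $\Sigma_\lambda$ is a vertical graph over the open region of $\mathbb H^n$ bounded by two parallel equidistant hypersurfaces $\mathcal E_\pm$. In particular, $\Sigma_\lambda$ is homeomorphic to $\mathbb R^n$. - The height of $\Sigma_\lambda$ is bounded from below and unbounded from above, and $\Sigma_\lambda$ is vertically asymptotic to both cylinders $\mathcal E_\pm\times\mathbb R$. - $\Sigma_\lambda$ is $C^2$-singular along its equidistant hypersurface of minimal height. (ii) If $n$ is even, there exists a one-parameter family $\mathscr G_n=\{\Sigma_\lambda\,;\,\lambda>0\}$ of hyperbolic $n$-translators in $\mathbb H^n\times\mathbb R$ (called hyperbolic $n$-grim reapers) which has the following properties: - For each $\lambda>0$, $\Sigma_\lambda$ is a vertical graph over the open region of $\mathbb H^n$ bounded by two parallel equidistant hypersurfaces $\mathcal E_\pm$. - The height of $\Sigma_\lambda$ is bounded from below and unbounded from above. - $\Sigma_\lambda$ is tangent to $\mathbb H^n\times\{0\}$, where it reaches its minimal height, and it is vertically asymptotic to $\mathcal E_+\times\mathbb R$.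
   Context: $\mathbb H^n\times\mathbb R$ carries the product metric, $\partial_t$ is the unit vertical field (gradient of the projection onto $\mathbb R$). The height function of a hypersurface is the restriction of the projection onto $\mathbb R$. For an oriented hypersurface $\Sigma$ with unit normal $N$, the shape operator is $AX=-\overline\nabla_XN$ ($\overline\nabla$ the ambient Levi-Civita connection), with principal curvatures $k_1,\dots,k_n$; $H_n=k_1\cdots k_n$ is the Gaussian curvature and $\Theta=\langle N,\partial_t\rangle$ is the angle function. Hypersurfaces are of class at least $C^2$ except possibly on a set $\Lambda$ of null measure, where they are only of class $C^1$; then $\Sigma$ is called $C^2$-singular on $\Lambda$. $\Sigma$ is an $n$-translator (translator to the Gaussian curvature flow) if $H_n=\Theta$ on $\Sigma$ (on $\Sigma-\Lambda$ if there is a $C^2$-singular set $\Lambda$). A hypersurface of $\mathbb H^n\times\mathbb R$ is hyperbolic if it is invariant under the hyperbolic translations of $\mathbb H^n$ fixing the family of hypersurfaces equidistant from a fixed totally geodesic hyperplane $\mathcal E_0\subset\mathbb H^n$, extended to $\mathbb H^n\times\mathbb R$ by fixing the $\mathbb R$ factor; such a hypersurface is foliated by vertical translates of these equidistant hypersurfaces. The "parallel equidistant hypersurfaces" are members of this family. *)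

theory Defs
  imports "HOL-Analysis.Analysis"
begin

section \<open>Hyperbolic space and its product with the real line\<close>

text \<open>
  Hyperbolic space of dimension \<open>n = DIM('a)\<close> is the upper sheet of the hyperboloid in the
  Lorentz space \<open>'a \<times> real\<close>; its product with the real line sits in \<open>('a \<times> real) \<times> real\<close>.
\<close>

definition mink :: "'a::euclidean_space \<times> real \<Rightarrow> 'a \<times> real \<Rightarrow> real" where
  "mink x y = fst x \<bullet> fst y - snd x * snd y"

definition hyp_space :: "('a::euclidean_space \<times> real) set" where
  "hyp_space = {x. mink x x = -1 \<and> 0 < snd x}"

definition hdist :: "'a::euclidean_space \<times> real \<Rightarrow> 'a \<times> real \<Rightarrow> real" where
  "hdist x y = arcosh (- mink x y)"

definition hdist_set :: "'a::euclidean_space \<times> real \<Rightarrow> ('a \<times> real) set \<Rightarrow> real" where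
  "hdist_set x A = (INF y\<in>A. hdist x y)"

definition hyp_prod :: "(('a::euclidean_space \<times> real) \<times> real) set" where
  "hyp_prod = hyp_space \<times> UNIV"

text \<open>
  The product metric is the restriction of \<open>pmetric\<close> to the tangent spaces \<open>tangent_prod p\<close>.
\<close>

definition pmetric ::
  "('a::euclidean_space \<times> real) \<times> real \<Rightarrow> ('a \<times> real) \<times> real \<Rightarrow> real" where
  "pmetric v w = mink (fst v) (fst w) + snd v * snd w"

definition tangent_prod ::
  "('a::euclidean_space \<times> real) \<times> real \<Rightarrow> (('a \<times> real) \<times> real) set" where
  "tangent_prod p = {v. mink (fst p) (fst v) = 0}"

definition vertical_field :: "('a::euclidean_space \<times> real) \<times> real" where
  "vertical_field = (0, 1)"

text \<open>
  The \<open>pmetric\<close>-orthogonal projection onto \<open>tangent_prod p\<close>, for \<open>p\<close> in \<open>hyp_prod\<close>; the sign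
  is due to \<open>mink (fst p) (fst p) = -1\<close>.
\<close>

definition tangent_proj ::
  "('a::euclidean_space \<times> real) \<times> real \<Rightarrow> ('a \<times> real) \<times> real \<Rightarrow> ('a \<times> real) \<times> real" where
  "tangent_proj p w = (fst w + mink (fst w) (fst p) *\<^sub>R fst p, snd w)"


section \<open>Equidistant hypersurfaces and hyperbolic translations\<close>

text \<open>
  Totally geodesic hyperplanes are the sections of the hyperboloid by the Lorentz-orthogonal
  complements of unit spacelike vectors \<open>e\<close>. The vector \<open>e\<close> restricts to a unit normal of the
  hyperplane, hence fixes the sign of the distance to it.
\<close>

definition geodesic_hyperplane :: "'a::euclidean_space \<times> real \<Rightarrow> ('a \<times> real) set" where
  "geodesic_hyperplane e = {x \<in> hyp_space. mink x e = 0}"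

definition equidistant :: "'a::euclidean_space \<times> real \<Rightarrow> real \<Rightarrow> ('a \<times> real) set" where
  "equidistant e s =
     {x \<in> hyp_space. hdist_set x (geodesic_hyperplane e) = \<bar>s\<bar> \<and> sgn (mink x e) = sgn s}"

lemma mink_commute: "mink x y = mink y x"
  by (simp add: mink_def inner_commute mult.commute)

lemma mink_diff_left: "mink (x - y) z = mink x z - mink y z"
  by (simp add: mink_def inner_diff_left algebra_simps)

lemma mink_scaleR_left: "mink (c *\<^sub>R x) y = c * mink x y"
  by (simp add: mink_def algebra_simps)

lemma mink_diff_right: "mink z (x - y) = mink z x - mink z y"
  by (simp add: mink_def inner_diff_right algebra_simps)

lemma mink_scaleR_right: "mink y (c *\<^sub>R x) = c * mink y x"
  by (simp add: mink_def algebra_simps)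

lemma hyp_space_norm:
  assumes "x \<in> hyp_space"
  shows "(snd x)\<^sup>2 = 1 + (norm (fst x))\<^sup>2" "0 < snd x"
  using assms by (auto simp: hyp_space_def mink_def power2_eq_square dot_square_norm)

lemma mink_hyp_space_le:
  assumes x: "x \<in> hyp_space" and y: "y \<in> hyp_space"
  shows "mink x y \<le> -1"
proof -
  let ?a = "norm (fst x)" and ?b = "norm (fst y)"
  have "(1 + ?a * ?b)\<^sup>2 \<le> (snd x * snd y)\<^sup>2"
  proof -
    have "(snd x * snd y)\<^sup>2 = (1 + ?a\<^sup>2) * (1 + ?b\<^sup>2)"
      by (simp add: power_mult_distrib hyp_space_norm(1)[OF x] hyp_space_norm(1)[OF y])
    also have "\<dots> = (1 + ?a * ?b)\<^sup>2 + (?a - ?b)\<^sup>2"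
      by (simp add: power2_eq_square algebra_simps)
    finally show ?thesis by simp
  qed
  then have "1 + ?a * ?b \<le> snd x * snd y"
    using hyp_space_norm(2)[OF x] hyp_space_norm(2)[OF y] by (meson mult_pos_pos less_imp_le power2_le_imp_le)
  moreover have "fst x \<bullet> fst y \<le> ?a * ?b"
    by (rule norm_cauchy_schwarz)
  ultimately show ?thesis by (simp add: mink_def)
qed

lemma hdist_set_geodesic_hyperplane:
  assumes e: "mink e e = 1" and x: "x \<in> hyp_space"
  shows "hdist_set x (geodesic_hyperplane e) = \<bar>arsinh (mink x e)\<bar>"
proof -
  define a s where "a = mink x e" and "s = arsinh (mink x e)"
  have as: "a = sinh s" by (simp add: a_def s_def)
  have c: "0 < cosh s" "1 + a\<^sup>2 = (cosh s)\<^sup>2" by (simp_all add: as cosh_square_eq cosh_real_pos)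
  define z where "z = x - a *\<^sub>R e"
  define y0 where "y0 = (1 / cosh s) *\<^sub>R z"
  have xx: "mink x x = -1" using x by (simp add: hyp_space_def)
  have ze: "mink z e = 0" by (simp add: z_def mink_diff_left mink_scaleR_left e a_def)
  have zx: "mink z x = - (cosh s)\<^sup>2"
    using c(2) by (simp add: z_def mink_diff_left mink_scaleR_left xx mink_commute[of e x]
        a_def[symmetric] power2_eq_square)
  have "mink z z = mink z x - a * mink z e"
    by (subst (2) z_def) (simp only: mink_diff_right mink_scaleR_right)
  then have zz: "mink z z = - (cosh s)\<^sup>2"
    using zx ze by simp
  have sz: "0 < snd z"
  proof (rule ccontr)
    assume n: "\<not> 0 < snd z"
    have "(norm (fst z))\<^sup>2 - (snd z)\<^sup>2 = - (cosh s)\<^sup>2"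
      using zz unfolding mink_def by (simp only: dot_square_norm power2_eq_square[of "snd z"])
    then have "(norm (fst z))\<^sup>2 \<le> (- snd z)\<^sup>2"
      unfolding power2_minus using zero_le_power2[of "cosh s"] by linarith
    then have nz: "norm (fst z) \<le> - snd z"
      by (rule power2_le_imp_le) (use n in simp)
    have "(norm (fst x))\<^sup>2 \<le> (snd x)\<^sup>2" using hyp_space_norm(1)[OF x] by simp
    then have nx: "norm (fst x) \<le> snd x"
      by (rule power2_le_imp_le) (use hyp_space_norm(2)[OF x] in simp)
    have "\<bar>fst z \<bullet> fst x\<bar> \<le> norm (fst z) * norm (fst x)" by (rule Cauchy_Schwarz_ineq2)
    also have "\<dots> \<le> - snd z * snd x" using nz nx n by (intro mult_mono) auto
    finally have "0 \<le> mink z x" by (simp add: mink_def)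
    with zx c(1) show False by simp
  qed
  have y0: "y0 \<in> geodesic_hyperplane e"
    using c(1) sz zz ze
    by (simp add: geodesic_hyperplane_def hyp_space_def y0_def mink_scaleR_left
        mink_scaleR_right power2_eq_square)
  have d0: "hdist x y0 = \<bar>s\<bar>"
  proof -
    have "- mink x y0 = cosh \<bar>s\<bar>"
      using c(1) zx by (simp add: y0_def mink_scaleR_right mink_commute[of x z] power2_eq_square)
    then show ?thesis unfolding hdist_def by (simp only: arcosh_cosh_real[OF abs_ge_zero])
  qed
  have lb: "\<bar>s\<bar> \<le> hdist x y" if y: "y \<in> geodesic_hyperplane e" for y
  proof -
    have yH: "y \<in> hyp_space" and ye: "mink y e = 0"
      using y by (auto simp: geodesic_hyperplane_def)
    have "mink y0 y \<le> -1"
      using y0 yH by (intro mink_hyp_space_le) (auto simp: geodesic_hyperplane_def)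
    moreover have "mink x y = cosh s * mink y0 y"
      using c(1) ye by (simp add: y0_def mink_scaleR_left z_def mink_diff_left
          mink_commute[of e y])
    ultimately have "cosh \<bar>s\<bar> \<le> - mink x y"
      using c(1) mult_left_mono[of "mink y0 y" "-1" "cosh s"] by simp
    moreover have "1 \<le> cosh \<bar>s\<bar>" by (rule cosh_real_ge_1)
    ultimately have "arcosh (cosh \<bar>s\<bar>) \<le> arcosh (- mink x y)"
      by (metis arcosh_real_strict_mono less_eq_real_def)
    then show ?thesis by (simp only: hdist_def arcosh_cosh_real[OF abs_ge_zero])
  qed
  have "hdist_set x (geodesic_hyperplane e) = \<bar>s\<bar>"
    unfolding hdist_set_def
  proof (rule antisym)
    show "(INF y\<in>geodesic_hyperplane e. hdist x y) \<le> \<bar>s\<bar>"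
    proof -
      have "bdd_below (hdist x ` geodesic_hyperplane e)" using lb by (rule bdd_belowI2)
      from cINF_lower[OF this y0] show ?thesis by (simp only: d0)
    qed
    show "\<bar>s\<bar> \<le> (INF y\<in>geodesic_hyperplane e. hdist x y)"
      using y0 lb by (intro cINF_greatest) auto
  qed
  then show ?thesis by (simp add: s_def)
qed

lemma equidistant_eq:
  assumes "mink e e = 1"
  shows "equidistant e s = {x \<in> hyp_space. mink x e = sinh s}"
proof -
  have *: "\<bar>arsinh a\<bar> = \<bar>s\<bar> \<and> sgn a = sgn s \<longleftrightarrow> a = sinh s" for a :: real
  proof -
    define b where "b = arsinh a"
    have ab: "a = sinh b" by (simp add: b_def)
    have "sgn (sinh b) = sgn b"
      by (cases "b = 0") (auto simp: sgn_if)
    then show ?thesis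
      unfolding ab by (auto simp: arsinh_sinh_real abs_if sgn_if split: if_splits)
  qed
  show ?thesis
    unfolding equidistant_def
    by (rule Collect_cong) (simp add: * hdist_set_geodesic_hyperplane[OF assms] cong: conj_cong)
qed

definition region_between ::
  "'a::euclidean_space \<times> real \<Rightarrow> real \<Rightarrow> real \<Rightarrow> ('a \<times> real) set" where
  "region_between e s1 s2 = (\<Union>s\<in>{s1<..<s2}. equidistant e s)"

text \<open>
  A hyperbolic translation by \<open>r\<close> along the geodesic through \<open>p\<close> with unit velocity \<open>v\<close>, as a
  Lorentz boost of the ambient space.
\<close>

definition hyperbolic_translation ::
  "('a::euclidean_space \<times> real \<Rightarrow> 'a \<times> real) \<Rightarrow> bool" where
  "hyperbolic_translation \<tau> \<longleftrightarrow> linear \<tau> \<and>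
     (\<exists>p\<in>hyp_space. \<exists>v r. mink v v = 1 \<and> mink p v = 0 \<and>
        \<tau> p = cosh r *\<^sub>R p + sinh r *\<^sub>R v \<and>
        \<tau> v = sinh r *\<^sub>R p + cosh r *\<^sub>R v \<and>
        (\<forall>w. mink w p = 0 \<and> mink w v = 0 \<longrightarrow> \<tau> w = w))"

definition hyperbolic_hypersurface ::
  "'a::euclidean_space \<times> real \<Rightarrow> (('a \<times> real) \<times> real) set \<Rightarrow> bool" where
  "hyperbolic_hypersurface e S \<longleftrightarrow>
     (\<forall>\<tau>. hyperbolic_translation \<tau> \<and> (\<forall>s. \<tau> ` equidistant e s = equidistant e s) \<longrightarrow>
        map_prod \<tau> id ` S = S)"


section \<open>Hypersurfaces and their regularity\<close>

definition C1_on :: "('p::real_normed_vector \<Rightarrow> 'q::real_normed_vector) \<Rightarrow> 'p set \<Rightarrow> bool" where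
  "C1_on f U \<longleftrightarrow>
     (\<exists>f'. (\<forall>x\<in>U. (f has_derivative blinfun_apply (f' x)) (at x)) \<and> continuous_on U f')"

definition C2_on :: "('p::real_normed_vector \<Rightarrow> 'q::real_normed_vector) \<Rightarrow> 'p set \<Rightarrow> bool" where
  "C2_on f U \<longleftrightarrow>
     (\<exists>f'. (\<forall>x\<in>U. (f has_derivative blinfun_apply (f' x)) (at x)) \<and> C1_on f' U)"

text \<open>
  Near \<open>p\<close>, the set \<open>S\<close> is a regular level set in \<open>hyp_prod\<close> of a function whose regularity is
  prescribed by \<open>R\<close>.
\<close>

definition hypersurface_at ::
  "((('a::euclidean_space \<times> real) \<times> real \<Rightarrow> real) \<Rightarrow> (('a \<times> real) \<times> real) set \<Rightarrow> bool) \<Rightarrow>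
   (('a \<times> real) \<times> real) set \<Rightarrow> ('a \<times> real) \<times> real \<Rightarrow> bool" where
  "hypersurface_at R S p \<longleftrightarrow>
     (\<exists>U F. open U \<and> p \<in> U \<and> R F U \<and> S \<inter> U = {q \<in> hyp_prod \<inter> U. F q = 0} \<and>
        (\<exists>v\<in>tangent_prod p. frechet_derivative F (at p) v \<noteq> 0))"

definition C2_singular_set ::
  "(('a::euclidean_space \<times> real) \<times> real) set \<Rightarrow> (('a \<times> real) \<times> real) set" where
  "C2_singular_set S = {p \<in> S. \<not> hypersurface_at C2_on S p}"

text \<open>Charts of \<open>S\<close> are \<open>C\<^sup>1\<close> parametrizations of relatively open parts of \<open>S\<close>.\<close>

definition null_in ::
  "(('a::euclidean_space \<times> real) \<times> real) set \<Rightarrow> (('a \<times> real) \<times> real) set \<Rightarrow> bool" where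
  "null_in S L \<longleftrightarrow>
     (\<forall>p\<in>S. \<exists>(U :: 'a set) \<psi> \<phi>. open U \<and> C1_on \<psi> U \<and>
        (\<forall>u\<in>U. inj (frechet_derivative \<psi> (at u))) \<and>
        homeomorphism U (\<psi> ` U) \<psi> \<phi> \<and> openin (top_of_set S) (\<psi> ` U) \<and> p \<in> \<psi> ` U \<and>
        negligible {u \<in> U. \<psi> u \<in> L})"

definition hypersurface :: "(('a::euclidean_space \<times> real) \<times> real) set \<Rightarrow> bool" where
  "hypersurface S \<longleftrightarrow> S \<noteq> {} \<and> S \<subseteq> hyp_prod \<and>
     (\<forall>p\<in>S. hypersurface_at C1_on S p) \<and> null_in S (C2_singular_set S)"


section \<open>Extrinsic geometry\<close>

definition tangent_space ::
  "(('a::euclidean_space \<times> real) \<times> real) set \<Rightarrow> ('a \<times> real) \<times> real \<Rightarrow> (('a \<times> real) \<times> real) set"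
  where
  "tangent_space S p =
     {v. \<exists>\<gamma> \<epsilon>. 0 < \<epsilon> \<and> \<gamma> ` {-\<epsilon><..<\<epsilon>} \<subseteq> S \<and> \<gamma> 0 = p \<and> (\<gamma> has_vector_derivative v) (at (0::real))}"

definition unit_normal ::
  "(('a::euclidean_space \<times> real) \<times> real) set \<Rightarrow> (('a \<times> real) \<times> real \<Rightarrow> ('a \<times> real) \<times> real) \<Rightarrow> bool"
  where
  "unit_normal S N \<longleftrightarrow> continuous_on S N \<and>
     (\<forall>p\<in>S. N p \<in> tangent_prod p \<and> pmetric (N p) (N p) = 1 \<and>
        (\<forall>X\<in>tangent_space S p. pmetric (N p) X = 0))"

definition angle_function ::
  "(('a::euclidean_space \<times> real) \<times> real \<Rightarrow> ('a \<times> real) \<times> real) \<Rightarrow> ('a \<times> real) \<times> real \<Rightarrow> real" where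
  "angle_function N p = pmetric (N p) vertical_field"

text \<open>
  The Levi-Civita connection of \<open>hyp_prod\<close> is the tangential part of the flat connection of the
  ambient space. Derivatives within \<open>S\<close> are determined only in directions tangent to \<open>S\<close>.
\<close>

definition cov_deriv ::
  "(('a::euclidean_space \<times> real) \<times> real) set \<Rightarrow> (('a \<times> real) \<times> real \<Rightarrow> ('a \<times> real) \<times> real) \<Rightarrow>
   ('a \<times> real) \<times> real \<Rightarrow> ('a \<times> real) \<times> real \<Rightarrow> ('a \<times> real) \<times> real" where
  "cov_deriv S N p X = tangent_proj p (frechet_derivative N (at p within S) X)"

definition shape_operator ::
  "(('a::euclidean_space \<times> real) \<times> real) set \<Rightarrow> (('a \<times> real) \<times> real \<Rightarrow> ('a \<times> real) \<times> real) \<Rightarrow>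
   ('a \<times> real) \<times> real \<Rightarrow> ('a \<times> real) \<times> real \<Rightarrow> ('a \<times> real) \<times> real" where
  "shape_operator S N p X = - cov_deriv S N p X"

text \<open>
  The principal curvatures, with multiplicity, are the eigenvalues belonging to an orthonormal
  eigenbasis. The tangent spaces have dimension \<open>DIM('a)\<close>, so the \<open>DIM('a)\<close> orthonormal vectors
  \<open>E i\<close> form a basis.
\<close>

definition principal_curvatures ::
  "(('a::euclidean_space \<times> real) \<times> real) set \<Rightarrow> (('a \<times> real) \<times> real \<Rightarrow> ('a \<times> real) \<times> real) \<Rightarrow>
   ('a \<times> real) \<times> real \<Rightarrow> (nat \<Rightarrow> real) \<Rightarrow> bool" where
  "principal_curvatures S N p k \<longleftrightarrow> N differentiable (at p within S) \<and>
     (\<exists>E. (\<forall>i<DIM('a). E i \<in> tangent_space S p) \<and>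
          (\<forall>i<DIM('a). \<forall>j<DIM('a). pmetric (E i) (E j) = (if i = j then 1 else 0)) \<and>
          (\<forall>i<DIM('a). shape_operator S N p (E i) = k i *\<^sub>R E i))"

definition has_gauss_curvature ::
  "(('a::euclidean_space \<times> real) \<times> real) set \<Rightarrow> (('a \<times> real) \<times> real \<Rightarrow> ('a \<times> real) \<times> real) \<Rightarrow>
   ('a \<times> real) \<times> real \<Rightarrow> real \<Rightarrow> bool" where
  "has_gauss_curvature S N p h \<longleftrightarrow>
     (\<exists>k. principal_curvatures S N p k \<and> h = (\<Prod>i<DIM('a). k i))"

definition n_translator :: "(('a::euclidean_space \<times> real) \<times> real) set \<Rightarrow> bool" where
  "n_translator S \<longleftrightarrow> hypersurface S \<and>
     (\<exists>N. unit_normal S N \<and>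
        (\<forall>p \<in> S - C2_singular_set S. has_gauss_curvature S N p (angle_function N p)))"


section \<open>Graphs and asymptotics\<close>

definition vertical_graph ::
  "('a::euclidean_space \<times> real) set \<Rightarrow> (('a \<times> real) \<times> real) set \<Rightarrow> bool" where
  "vertical_graph \<Omega> S \<longleftrightarrow> (\<exists>u. S = (\<lambda>x. (x, u x)) ` \<Omega>)"

definition lowest_points :: "('b \<times> real) set \<Rightarrow> ('b \<times> real) set" where
  "lowest_points S = {p \<in> S. \<forall>q\<in>S. snd p \<le> snd q}"

text \<open>
  \<open>S\<close> is vertically asymptotic to the cylinder over \<open>F\<close>: the horizontal slices of \<open>S\<close> converge
  to \<open>F\<close> in the Hausdorff sense as the height grows, and \<open>S\<close> comes close to the cylinder at
  large heights only.
\<close>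

definition vertically_asymptotic ::
  "(('a::euclidean_space \<times> real) \<times> real) set \<Rightarrow> ('a \<times> real) set \<Rightarrow> bool" where
  "vertically_asymptotic S F \<longleftrightarrow>
     (\<forall>\<epsilon>>0. \<exists>K. \<forall>(x, t)\<in>S. K < t \<longrightarrow> hdist_set x F < \<epsilon>) \<and>
     (\<forall>\<epsilon>>0. \<exists>K. \<forall>t>K. \<forall>y\<in>F. \<exists>x. (x, t) \<in> S \<and> hdist x y < \<epsilon>) \<and>
     (\<forall>K. \<exists>\<delta>>0. \<forall>(x, t)\<in>S. hdist_set x F < \<delta> \<longrightarrow> K < t)"

text \<open>
  Tangency to the horizontal slice of height \<open>h\<close> along \<open>B \<times> {h}\<close>, which may lie in the boundary
  of \<open>S\<close>: there the unit normal of \<open>S\<close> tends to the unit normal of the slice.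
\<close>

definition tangent_to_slice_along ::
  "(('a::euclidean_space \<times> real) \<times> real) set \<Rightarrow> ('a \<times> real) set \<Rightarrow> real \<Rightarrow> bool" where
  "tangent_to_slice_along S B h \<longleftrightarrow> B \<times> {h} \<subseteq> closure S \<and>
     (\<exists>N. unit_normal S N \<and> (\<forall>q \<in> B \<times> {h}. (N \<longlongrightarrow> vertical_field) (at q within S)))"

text \<open>
  The members of a one-parameter family are pairwise distinct, even up to vertical translation.
\<close>

definition one_parameter_family :: "(real \<Rightarrow> ('b \<times> real) set) \<Rightarrow> bool" where
  "one_parameter_family S \<longleftrightarrow>
     (\<forall>l>0. \<forall>m>0. l \<noteq> m \<longrightarrow> (\<forall>h. S m \<noteq> map_prod id (\<lambda>t. t + h) ` S l))"

end

theory Submission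
  imports Defs
begin

text \<open>
  The grim reapers are graphs \<open>t = \<phi> s\<close>, where \<open>s\<close> is the signed distance to the totally geodesic
  hyperplane defined by \<open>e\<close>; their invariance under hyperbolic translations is then automatic. Write
  \<open>\<phi>' = tan \<theta>\<close>, so that the upward unit normal is \<open>- sin \<theta>\<close> times the gradient of \<open>s\<close> plus \<open>cos \<theta>\<close>
  times the vertical field. With \<open>m = n - 1\<close>, the principal curvatures are \<open>sin \<theta> * tanh s\<close>, \<open>m\<close> times,
  and \<open>cos \<theta> * d\<theta>/ds\<close> (\<open>gauss_curvature_reaper\<close>), and the angle function is \<open>cos \<theta>\<close>. The graph is
  therefore a translator if and only if \<open>(sin \<theta> * tanh s) ^ m * (d\<theta>/ds) = 1\<close>.

  This equation is separable, and it is best read as an equation for \<open>s\<close> as a function of \<open>\<theta>\<close>, with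
  \<open>s = l\<close> at \<open>\<theta> = 0\<close>: its solution is defined and positive for all angles (\<open>angle_parametrization\<close>). If
  \<open>m\<close> is even, \<open>s\<close> increases with \<open>\<theta>\<close> on \<open>[- pi / 2, pi / 2]\<close>; if \<open>m\<close> is odd, it does so on
  \<open>[0, pi / 2]\<close>. Inverting it there gives \<open>\<theta>\<close> on an interval of distances that is bounded because the
  interval of angles is (\<open>grim_reaper_angle\<close>). At the ends with \<open>\<theta> = \<plusminus> pi / 2\<close> the height diverges like
  \<open>- ln (cos \<theta>)\<close>, which makes the graph asymptotic to a vertical cylinder. At the end \<open>\<theta> = 0\<close> for odd \<open>m\<close>
  the graph is tangent to a horizontal slice.

  For even \<open>m\<close> the minimum of the height is at the interior point \<open>s = l\<close>. There \<open>ds/d\<theta> = 0\<close>, so \<open>\<theta>\<close> is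
  not differentiable and the surface is not a regular level set of a \<open>C\<^sup>2\<close> function
  (\<open>not_C2_at_singular\<close>). Elsewhere it is. A Lorentz reflection which makes \<open>e\<close> horizontal turns the equidistant hypersurfaces
  into parallel affine hyperplanes of a global chart (\<open>global_chart\<close>); this gives both the null measure of
  the singular set and the topology of the surface.
\<close>

section \<open>The profile equation\<close>

text \<open>
  Let \<open>G\<close> be the primitive of \<open>coth ^ m\<close> on the positive half line with \<open>G c = 0\<close>. It is increasing,
  and it takes every real value: since \<open>coth ^ m \<ge> coth\<close> and \<open>coth\<close> has the primitive \<open>ln (sinh s)\<close>,
  it lies below \<open>ln (sinh s) - ln (sinh c)\<close> to the left of \<open>c\<close> and above it to the right. So \<open>G\<close> has
  a global inverse, which is \<open>g\<close>.
\<close>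

lemma coth_power_antiderivative_inverse:
  fixes c :: real
  assumes m: "0 < (m::nat)" and c: "0 < c"
  obtains g :: "real \<Rightarrow> real" where "g 0 = c" "\<And>y. 0 < g y"
    "\<And>y. (g has_real_derivative tanh (g y) ^ m) (at y)"
proof -
  define f where "f x = (1 / tanh x) ^ m" for x :: real
  have "\<exists>G. \<forall>x::real. 0 < ereal x \<longrightarrow> ereal x < \<infinity> \<longrightarrow> (G has_vector_derivative f x) (at x)"
  proof (rule einterval_antiderivative)
    show "isCont f x" if "0 < ereal x" for x
      using that unfolding f_def by (intro continuous_intros) (auto simp: cosh_real_pos order_less_imp_not_eq2)
  qed simp
  then obtain G0 where G0: "\<And>x::real. 0 < x \<Longrightarrow> (G0 has_vector_derivative f x) (at x)"
    by auto
  define G where "G x = G0 x - G0 c" for x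
  have G: "(G has_real_derivative f x) (at x)" if "0 < x" for x
    using G0[OF that] unfolding G_def has_real_derivative_iff_has_vector_derivative
    by (auto intro!: derivative_eq_intros)
  have fpos: "0 < f x" if "0 < x" for x using that by (simp add: f_def)
  have Gcont: "continuous_on {a..b} G" if "0 < a" for a b
    using that by (intro DERIV_continuous_on) (auto intro!: has_field_derivative_at_within[OF G])
  have mono: "G x < G y" if "0 < x" "x < y" for x y
  proof (rule DERIV_pos_imp_increasing[OF that(2)])
    fix z assume "x \<le> z" "z \<le> y"
    then show "\<exists>D. DERIV G z :> D \<and> 0 < D" using that G fpos by (intro exI[of _ "f z"]) auto
  qed
  have cmp: "G x - ln (sinh x) \<le> G y - ln (sinh y)" if "0 < x" "x \<le> y" for x y
  proof (rule DERIV_nonneg_imp_nondecreasing[OF that(2)])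
    fix z assume z: "x \<le> z" "z \<le> y"
    then have zp: "0 < z" using that by simp
    have "((\<lambda>x. G x - ln (sinh x)) has_real_derivative f z - cosh z / sinh z) (at z)"
      using zp by (auto intro!: derivative_eq_intros G)
    moreover have "cosh z / sinh z \<le> f z"
    proof -
      have "1 / tanh z \<ge> 1" using zp tanh_real_lt_1[of z] by simp
      then have "(1 / tanh z) ^ 1 \<le> (1 / tanh z) ^ m" using m by (intro power_increasing) auto
      then show ?thesis by (simp add: f_def tanh_def)
    qed
    ultimately show "\<exists>D. DERIV (\<lambda>x. G x - ln (sinh x)) z :> D \<and> 0 \<le> D"
      by (intro exI[of _ "f z - cosh z / sinh z"]) auto
  qed
  have "\<exists>x>0. G x = y" for y
  proof -
    \<comment> \<open>the points where \<open>ln (sinh s) - ln (sinh c)\<close> equals \<open>- \<bar>y\<bar>\<close> and \<open>\<bar>y\<bar>\<close>\<close>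
    define l u where "l = arsinh (sinh c * exp (- \<bar>y\<bar>))" and "u = arsinh (sinh c * exp \<bar>y\<bar>)"
    have l0: "0 < l" using c by (simp add: l_def)
    have lc: "l \<le> c"
    proof -
      have "sinh l \<le> sinh c" using c by (simp add: l_def mult_left_le)
      then show ?thesis by simp
    qed
    have cu: "c \<le> u"
    proof -
      have "sinh c * 1 \<le> sinh c * exp \<bar>y\<bar>" using c by (intro mult_left_mono) auto
      then have "sinh c \<le> sinh u" by (simp add: u_def)
      then show ?thesis by simp
    qed
    have "ln (sinh l) = ln (sinh c) - \<bar>y\<bar>" "ln (sinh u) = ln (sinh c) + \<bar>y\<bar>"
      using c by (simp_all add: l_def u_def ln_mult)
    moreover have "G c = 0" by (simp add: G_def)
    ultimately have "G l \<le> y" "y \<le> G u"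
      using cmp[OF l0 lc] cmp[OF c cu] by linarith+
    then show ?thesis
      using IVT'[of G l y u] Gcont[OF l0] lc cu l0 by (metis order.trans order_less_le_trans)
  qed
  then obtain g where g0: "\<And>y. 0 < g y" and gG: "\<And>y. G (g y) = y" by metis
  have gmono: "g x < g y" if "x < y" for x y
    using mono[OF g0, of y "g x"] gG that by (metis not_less_iff_gr_or_eq order.asym)
  have Gg: "g (G x) = x" if "0 < x" for x
    using mono g0 gG that by (metis not_less_iff_gr_or_eq)
  have gcont: "isCont g y" for y
  proof -
    let ?a = "g (y - 1)" and ?b = "g (y + 1)"
    have ab: "?a < ?b" and "?a < g y" "g y < ?b" by (auto intro: gmono)
    define a b where "a = ?a" and "b = ?b"
    define d where "d = min (g y - a) (b - g y)"
    have d0: "0 < d" using \<open>?a < g y\<close> \<open>g y < ?b\<close> by (simp add: d_def a_def b_def)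
    have pos: "0 < z" if z: "\<bar>z - g y\<bar> \<le> d / 2" for z
    proof -
      have "a < z" using z d0 by (auto simp: d_def abs_if split: if_splits)
      then show "0 < z" using g0[of "y - 1"] by (simp add: a_def)
    qed
    have "isCont g (G (g y))"
    proof (rule isCont_inverse_function[where f = G and x = "g y"])
      show "0 < d / 2" using d0 by simp
      show "g (G z) = z" if "\<bar>z - g y\<bar> \<le> d / 2" for z by (rule Gg[OF pos[OF that]])
      show "isCont G z" if "\<bar>z - g y\<bar> \<le> d / 2" for z by (rule DERIV_isCont[OF G[OF pos[OF that]]])
    qed
    then show ?thesis by (simp add: gG)
  qed
  have gder: "(g has_real_derivative tanh (g y) ^ m) (at y)" for y
  proof -
    have "(g has_real_derivative inverse (f (g y))) (at y)"
      by (rule DERIV_inverse_function[where f = G and a = "y - 1" and b = "y + 1"])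
        (use G g0 fpos gG gcont in \<open>auto simp: order_less_imp_not_eq2\<close>)
    then show ?thesis by (simp add: f_def power_one_over)
  qed
  show thesis
  proof (rule that[OF _ g0 gder])
    have "g (G c) = c" using c by (rule Gg)
    then show "g 0 = c" by (simp add: G_def)
  qed
qed

text \<open>
  The profile equation \<open>(sin \<theta> * tanh s) ^ m * (d\<theta>/ds) = 1\<close> is separable. It is solved here for the
  distance as a function of the angle: \<open>d\<theta>/ds\<close> is infinite where \<open>\<theta> = 0\<close>, but its reciprocal is a smooth
  function of \<open>\<theta>\<close> and \<open>s\<close>, and the solution exists for all angles.
\<close>

lemma angle_parametrization:
  fixes c :: real
  assumes m: "0 < (m::nat)" and c: "0 < c"
  obtains s :: "real \<Rightarrow> real" where "s 0 = c" "\<And>t. 0 < s t"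
    "\<And>t. (s has_real_derivative (sin t * tanh (s t)) ^ m) (at t)"
proof -
  obtain g where g: "g 0 = c" "\<And>y. 0 < g y" "\<And>y. (g has_real_derivative tanh (g y) ^ m) (at y)"
    using coth_power_antiderivative_inverse[OF m c] by metis
  have "\<exists>P. \<forall>x::real. -\<infinity> < ereal x \<longrightarrow> ereal x < \<infinity> \<longrightarrow> (P has_vector_derivative sin x ^ m) (at x)"
    by (rule einterval_antiderivative) auto
  then obtain P where P: "\<And>x::real. (P has_real_derivative sin x ^ m) (at x)"
    by (auto simp: has_real_derivative_iff_has_vector_derivative)
  show thesis
  proof (rule that[of "\<lambda>t. g (P t - P 0)"])
    show "g (P 0 - P 0) = c" using g by simp
    show "0 < g (P t - P 0)" for t by (rule g)
    show "((\<lambda>t. g (P t - P 0)) has_real_derivative (sin t * tanh (g (P t - P 0))) ^ m) (at t)" for t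
    proof -
      have "((\<lambda>t. P t - P 0) has_real_derivative sin t ^ m) (at t)"
        by (auto intro!: derivative_eq_intros P)
      from DERIV_chain2[OF g(3) this] show ?thesis
        by (simp add: power_mult_distrib mult.commute)
    qed
  qed
qed

text \<open>
  The comparison function is \<open>- c * ln (cos t)\<close>, the primitive of \<open>c * tan t\<close>.
\<close>

lemma filterlim_at_top_of_derivative_ge_tan:
  fixes h h' :: "real \<Rightarrow> real"
  assumes c: "0 < c" and a: "0 \<le> a" "a < pi / 2"
    and h: "\<And>t. a \<le> t \<Longrightarrow> t < pi / 2 \<Longrightarrow> (h has_real_derivative h' t) (at t)"
    and ge: "\<And>t. a \<le> t \<Longrightarrow> t < pi / 2 \<Longrightarrow> c * tan t \<le> h' t"
  shows "filterlim h at_top (at_left (pi / 2))"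
proof (rule filterlim_at_top_mono)
  have cospos: "0 < cos t" if "a \<le> t" "t < pi / 2" for t
    using that a by (intro cos_gt_zero_pi) auto
  show "eventually (\<lambda>t. h a + c * ln (cos a) - c * ln (cos t) \<le> h t) (at_left (pi / 2))"
    unfolding eventually_at_left_field
  proof (intro exI[of _ a] conjI allI impI a)
    fix t assume t: "a < t" "t < pi / 2"
    have "h a + c * ln (cos a) \<le> h t + c * ln (cos t)"
    proof (rule DERIV_nonneg_imp_nondecreasing[where f = "\<lambda>t. h t + c * ln (cos t)"])
      fix z assume z: "a \<le> z" "z \<le> t"
      then have z': "z < pi / 2" using t by simp
      have "((\<lambda>t. h t + c * ln (cos t)) has_real_derivative h' z - c * tan z) (at z)"
        using cospos[OF z(1) z'] by (auto intro!: derivative_eq_intros h z z' simp: tan_def)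
      then show "\<exists>y. ((\<lambda>t. h t + c * ln (cos t)) has_real_derivative y) (at z) \<and> 0 \<le> y"
        using ge[OF z(1) z'] by (intro exI[of _ "h' z - c * tan z"]) auto
    qed (use t in simp)
    then show "h a + c * ln (cos a) - c * ln (cos t) \<le> h t" by simp
  qed
  have "filterlim (cos :: real \<Rightarrow> real) (at_right 0) (at_left (pi / 2))"
    unfolding filterlim_at
  proof
    show "eventually (\<lambda>t. cos t \<in> {0<..} \<and> cos t \<noteq> 0) (at_left (pi / 2 :: real))"
      unfolding eventually_at_left_field
      by (intro exI[of _ 0]) (use cos_gt_zero in \<open>force simp: less_imp_neq\<close>)
    have "(cos \<longlongrightarrow> cos (pi / 2 :: real)) (at_left (pi / 2 :: real))" by (intro tendsto_intros)
    then show "(cos \<longlongrightarrow> (0::real)) (at_left (pi / 2 :: real))" by simp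
  qed
  then have "filterlim (\<lambda>t::real. ln (cos t)) at_bot (at_left (pi / 2))"
    by (rule filterlim_compose[OF ln_at_0])
  then have "filterlim (\<lambda>t::real. - ln (cos t)) at_top (at_left (pi / 2))"
    by (simp add: filterlim_uminus_at_top)
  then have "filterlim (\<lambda>t::real. (h a + c * ln (cos a)) + c * (- ln (cos t))) at_top (at_left (pi / 2))"
    using c by (intro filterlim_tendsto_add_at_top[OF tendsto_const]
        filterlim_tendsto_pos_mult_at_top[OF tendsto_const]) auto
  then show "filterlim (\<lambda>t::real. h a + c * ln (cos a) - c * ln (cos t)) at_top (at_left (pi / 2))"
    by simp
qed

text \<open>
  The profile of a grim reaper: \<open>\<theta>\<close> inverts the solution of \<open>angle_parametrization\<close> on the angles between
  \<open>a\<close> and \<open>pi / 2\<close>, where it increases: the case \<open>a = - (pi / 2)\<close> needs \<open>m\<close> even, as otherwise the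
  distance decreases for negative angles. Since the distance is stationary at the angle \<open>0\<close>, the inverse
  is not differentiable at \<open>l\<close> when \<open>l\<close> is an interior point.

  A height \<open>\<phi>\<close> with \<open>\<phi>' = tan \<theta>\<close> satisfies \<open>d\<phi>/d\<theta> = tan \<theta> * (sin \<theta> * tanh s) ^ m\<close>. The second factor
  stays away from \<open>0\<close> for angles near \<open>\<plusminus> pi / 2\<close>, so \<open>\<phi>\<close> diverges like \<open>- ln (cos \<theta>)\<close> at those ends.
\<close>

lemma grim_reaper_angle:
  fixes l a :: real
  assumes m: "0 < (m::nat)" and l: "0 < l" and a: "a = 0 \<or> even m \<and> a = - (pi / 2)"
  obtains s1 s2 and \<theta> :: "real \<Rightarrow> real" where
    "0 < s1" "s1 \<le> l" "l < s2" "a = 0 \<Longrightarrow> s1 = l" "a \<noteq> 0 \<Longrightarrow> s1 < l"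
    "continuous_on {s1..s2} \<theta>" "\<theta> s1 = a" "\<theta> s2 = pi / 2" "\<theta> l = 0"
    "\<And>x y. s1 \<le> x \<Longrightarrow> x < y \<Longrightarrow> y \<le> s2 \<Longrightarrow> \<theta> x < \<theta> y"
    "\<And>s. s1 < s \<Longrightarrow> s < s2 \<Longrightarrow> s \<noteq> l \<Longrightarrow>
       (\<theta> has_real_derivative 1 / (sin (\<theta> s) * tanh s) ^ m) (at s)"
    "s1 < l \<Longrightarrow> \<not> \<theta> differentiable (at l)"
    "\<And>\<phi>. (\<And>s. s1 < s \<Longrightarrow> s < s2 \<Longrightarrow> (\<phi> has_real_derivative tan (\<theta> s)) (at s)) \<Longrightarrow>
       filterlim \<phi> at_top (at_left s2)"
    "\<And>\<phi>. a \<noteq> 0 \<Longrightarrow>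
       (\<And>s. s1 < s \<Longrightarrow> s < s2 \<Longrightarrow> (\<phi> has_real_derivative tan (\<theta> s)) (at s)) \<Longrightarrow>
       filterlim \<phi> at_top (at_right s1)"
proof -
  obtain \<sigma> where \<sigma>: "\<sigma> 0 = l" "\<And>t. 0 < \<sigma> t"
    "\<And>t. (\<sigma> has_real_derivative (sin t * tanh (\<sigma> t)) ^ m) (at t)"
    using angle_parametrization[OF m l] by metis
  have \<sigma>cont: "continuous_on A \<sigma>" for A
    using DERIV_isCont[OF \<sigma>(3)] by (simp add: continuous_at_imp_continuous_on)
  have a0: "a \<le> 0" "- (pi / 2) \<le> a" using a by auto
  have pos: "0 < (sin t * tanh (\<sigma> t)) ^ m" if "a \<le> t" "t \<le> pi / 2" "t \<noteq> 0" for t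
  proof (cases "0 < t")
    case True
    then have "0 < sin t" using that by (intro sin_gt_zero) auto
    then show ?thesis using \<sigma>(2) by simp
  next
    case False
    then have t: "t < 0" and "even m" "a = - (pi / 2)" using that a by auto
    then have "sin t < 0" using that sin_gt_zero[of "- t"] by auto
    then have "sin t * tanh (\<sigma> t) \<noteq> 0" using \<sigma>(2)[of t] by simp
    then show ?thesis using \<open>even m\<close> by (simp add: zero_less_power_eq)
  qed
  have mono0: "\<sigma> x < \<sigma> y" if "a \<le> x" "x < y" "y \<le> pi / 2" "0 \<le> x \<or> y \<le> 0" for x y
  proof (rule DERIV_pos_imp_increasing_open[OF that(2) _ \<sigma>cont])
    fix z assume "x < z" "z < y"
    then show "\<exists>D. DERIV \<sigma> z :> D \<and> 0 < D"
      using that pos[of z] \<sigma>(3)[of z] by (intro exI[of _ "(sin z * tanh (\<sigma> z)) ^ m"]) auto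
  qed
  have mono: "\<sigma> x < \<sigma> y" if "a \<le> x" "x < y" "y \<le> pi / 2" for x y
    using mono0[OF that] mono0[of x 0] mono0[of 0 y] that a0 by (cases "0 \<le> x \<or> y \<le> 0") force+
  define s1 s2 where "s1 = \<sigma> a" and "s2 = \<sigma> (pi / 2)"
  have "\<exists>t. a \<le> t \<and> t \<le> pi / 2 \<and> \<sigma> t = s" if "s1 \<le> s" "s \<le> s2" for s
    using IVT'[of \<sigma> a s "pi / 2"] that \<sigma>cont a0 unfolding s1_def s2_def
    by (meson order.trans pi_half_ge_zero)
  then obtain \<theta> where \<theta>: "\<And>s. s1 \<le> s \<Longrightarrow> s \<le> s2 \<Longrightarrow> a \<le> \<theta> s \<and> \<theta> s \<le> pi / 2 \<and> \<sigma> (\<theta> s) = s"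
    by metis
  have inj: "x = y" if "a \<le> x" "x \<le> pi / 2" "a \<le> y" "y \<le> pi / 2" "\<sigma> x = \<sigma> y" for x y
    using mono[of x y] mono[of y x] that by (metis less_irrefl linorder_neqE_linordered_idom)
  have lt12: "s1 < s2" unfolding s1_def s2_def using a0 pi_gt_zero by (intro mono) linarith+
  have s12: "s1 \<le> \<sigma> t" "\<sigma> t \<le> s2" if "a \<le> t" "t \<le> pi / 2" for t
    using that mono[of a t] mono[of t "pi / 2"] unfolding s1_def s2_def
    by (metis order.refl order_less_imp_le order_le_imp_less_or_eq)+
  have s12': "s1 < \<sigma> t" "\<sigma> t < s2" if "a < t" "t < pi / 2" for t
    using that mono unfolding s1_def s2_def by auto
  have \<theta>\<sigma>: "\<theta> (\<sigma> t) = t" if "a \<le> t" "t \<le> pi / 2" for t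
  proof (rule inj)
    show "\<sigma> (\<theta> (\<sigma> t)) = \<sigma> t" "a \<le> \<theta> (\<sigma> t)" "\<theta> (\<sigma> t) \<le> pi / 2"
      using \<theta>[OF s12[OF that]] by auto
  qed (fact that)+
  have th1: "\<theta> s1 = a" and th2: "\<theta> s2 = pi / 2" and thl: "\<theta> l = 0"
    using \<theta>\<sigma>[of a] \<theta>\<sigma>[of "pi / 2"] \<theta>\<sigma>[of 0] a0 pi_gt_zero \<sigma>(1) unfolding s1_def s2_def by auto
  have \<theta>mono: "\<theta> x < \<theta> y" if "s1 \<le> x" "x < y" "y \<le> s2" for x y
  proof (rule ccontr)
    assume "\<not> \<theta> x < \<theta> y"
    then have "\<sigma> (\<theta> y) \<le> \<sigma> (\<theta> x)"
      using mono[of "\<theta> y" "\<theta> x"] \<theta>[of x] \<theta>[of y] that by (cases "\<theta> x = \<theta> y") auto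
    then show False using \<theta>[of x] \<theta>[of y] that by auto
  qed
  have \<theta>cont: "continuous_on {s1..s2} \<theta>"
  proof -
    have "continuous_on (\<sigma> ` {a..pi / 2}) \<theta>"
      by (rule continuous_on_inv[OF \<sigma>cont]) (auto intro: \<theta>\<sigma>)
    moreover have "{s1..s2} \<subseteq> \<sigma> ` {a..pi / 2}"
    proof
      fix s assume "s \<in> {s1..s2}"
      then show "s \<in> \<sigma> ` {a..pi / 2}" using \<theta>[of s] by (intro image_eqI[of _ _ "\<theta> s"]) auto
    qed
    ultimately show ?thesis by (rule continuous_on_subset)
  qed
  have isCont\<theta>: "isCont \<theta> s" if "s1 < s" "s < s2" for s
    using continuous_on_interior[OF \<theta>cont] that by simp
  show thesis
  proof (rule that[of s1 s2 \<theta>])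
    show "0 < s1" using \<sigma>(2) by (simp add: s1_def)
    show "s1 \<le> l" "l < s2" using s12[of 0] mono[of 0 "pi / 2"] a0 \<sigma>(1) by (auto simp: s2_def)
    show "s1 = l" if "a = 0" using that \<sigma>(1) by (simp add: s1_def)
    show "s1 < l" if "a \<noteq> 0" using that mono[of a 0] a0 \<sigma>(1) by (simp add: s1_def)
    show "continuous_on {s1..s2} \<theta>" "\<theta> s1 = a" "\<theta> s2 = pi / 2" "\<theta> l = 0"
      by (fact \<theta>cont th1 th2 thl)+
    show "\<theta> x < \<theta> y" if "s1 \<le> x" "x < y" "y \<le> s2" for x y using \<theta>mono that .
  next
    fix s assume s: "s1 < s" "s < s2" "s \<noteq> l"
    then have t: "a \<le> \<theta> s" "\<theta> s \<le> pi / 2" "\<sigma> (\<theta> s) = s" using \<theta>[of s] by auto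
    have "\<theta> s \<noteq> 0" using t s \<sigma>(1) by auto
    then have p: "0 < (sin (\<theta> s) * tanh s) ^ m" using pos[OF t(1,2)] t(3) by simp
    have "(\<theta> has_real_derivative inverse ((sin (\<theta> s) * tanh s) ^ m)) (at s)"
    proof (rule DERIV_inverse_function[where f = \<sigma> and a = s1 and b = s2])
      show "DERIV \<sigma> (\<theta> s) :> (sin (\<theta> s) * tanh s) ^ m" using \<sigma>(3)[of "\<theta> s"] t(3) by simp
      show "(sin (\<theta> s) * tanh s) ^ m \<noteq> 0" using p by (rule less_imp_neq[symmetric])
      show "\<sigma> (\<theta> y) = y" if "s1 < y" "y < s2" for y using \<theta>[of y] that by simp
    qed (use s isCont\<theta> in auto)
    then show "(\<theta> has_real_derivative 1 / (sin (\<theta> s) * tanh s) ^ m) (at s)"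
      by (simp add: inverse_eq_divide)
  next
    assume s1l: "s1 < l"
    have ls2: "l < s2" using mono[of 0 "pi / 2"] a0 \<sigma>(1) by (auto simp: s2_def)
    show "\<not> \<theta> differentiable (at l)"
    proof
      assume "\<theta> differentiable (at l)"
      then obtain D where D: "(\<theta> has_real_derivative D) (at l)"
        by (auto simp: real_differentiable_def)
      \<comment> \<open>differentiating \<open>\<sigma> (\<theta> s) = s\<close> at \<open>l\<close> would give \<open>0 * D = 1\<close>\<close>
      have "(\<sigma> has_real_derivative 0) (at (\<theta> l))" using \<sigma>(3)[of 0] m thl by (simp add: zero_power)
      from DERIV_chain2[OF this D] have "((\<lambda>s. \<sigma> (\<theta> s)) has_real_derivative 0) (at l)" by simp
      then have "((\<lambda>s. s) has_real_derivative 0) (at l)"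
        by (rule has_field_derivative_transform_within_open[where S = "{s1<..<s2}"])
          (use \<theta> s1l ls2 in auto)
      from DERIV_unique[OF this DERIV_ident] show False by simp
    qed
  next
    fix \<phi> assume \<phi>: "\<And>s. s1 < s \<Longrightarrow> s < s2 \<Longrightarrow> (\<phi> has_real_derivative tan (\<theta> s)) (at s)"
    have \<phi>\<sigma>: "((\<lambda>t. \<phi> (\<sigma> t)) has_real_derivative tan t * (sin t * tanh (\<sigma> t)) ^ m) (at t)"
      if "a < t" "t < pi / 2" for t
      using DERIV_chain2[OF \<phi>[OF s12'[OF that]] \<sigma>(3)] \<theta>\<sigma>[of t] that by simp
    have "filterlim (\<lambda>t. \<phi> (\<sigma> t)) at_top (at_left (pi / 2))"
    proof (rule filterlim_at_top_of_derivative_ge_tan[where a = "pi / 4" and c = "(sin (pi / 4) * tanh l) ^ m"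
          and h' = "\<lambda>t. tan t * (sin t * tanh (\<sigma> t)) ^ m"])
      fix t assume t: "pi / 4 \<le> t" "t < pi / 2"
      then have t': "0 < t" "t \<le> pi" using pi_gt_zero by linarith+
      show "((\<lambda>t. \<phi> (\<sigma> t)) has_real_derivative tan t * (sin t * tanh (\<sigma> t)) ^ m) (at t)"
        using a0 t t' by (intro \<phi>\<sigma>) linarith+
      have "sin (pi / 4) \<le> sin t" using t by (intro sin_monotone_2pi_le) auto
      moreover have "l \<le> \<sigma> t" using mono[of 0 t] t t' a0 \<sigma>(1) by auto
      ultimately have "(sin (pi / 4) * tanh l) ^ m \<le> (sin t * tanh (\<sigma> t)) ^ m"
        using l t' by (intro power_mono mult_mono mult_nonneg_nonneg sin_ge_zero) auto
      moreover have "0 \<le> tan t" using t t' by (intro less_imp_le tan_gt_zero) auto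
      ultimately show "(sin (pi / 4) * tanh l) ^ m * tan t \<le> tan t * (sin t * tanh (\<sigma> t)) ^ m"
        by (simp add: mult.commute mult_left_mono)
    qed (use l pi_gt_zero in \<open>auto simp: sin_45\<close>)
    moreover have "filterlim \<theta> (at_left (pi / 2)) (at_left s2)"
      unfolding filterlim_at
    proof
      have "(\<theta> \<longlongrightarrow> \<theta> s2) (at s2 within {s1..s2})"
        using \<theta>cont lt12 by (simp add: continuous_on_def)
      then show "(\<theta> \<longlongrightarrow> pi / 2) (at_left s2)"
        using lt12 by (simp add: th2 at_within_Icc_at_left)
      show "\<forall>\<^sub>F x in at_left s2. \<theta> x \<in> {..<pi / 2} \<and> \<theta> x \<noteq> pi / 2"
        unfolding eventually_at_left_field
      proof (intro exI[of _ s1] conjI allI impI)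
        fix y assume "s1 < y" "y < s2"
        then have "\<theta> y < pi / 2" using \<theta>mono[of y s2] th2 by simp
        then show "\<theta> y \<in> {..<pi / 2}" "\<theta> y \<noteq> pi / 2" by simp_all
      qed (fact lt12)
    qed
    ultimately have "filterlim (\<lambda>s. \<phi> (\<sigma> (\<theta> s))) at_top (at_left s2)"
      by (rule filterlim_compose)
    moreover have "\<forall>\<^sub>F s in at_left s2. \<phi> (\<sigma> (\<theta> s)) = \<phi> s"
      unfolding eventually_at_left_field using lt12 \<theta> by (intro exI[of _ s1]) auto
    ultimately show "filterlim \<phi> at_top (at_left s2)"
      using filterlim_cong[OF refl refl, of "\<lambda>s. \<phi> (\<sigma> (\<theta> s))" \<phi>] by blast
  next
    fix \<phi> assume an0: "a \<noteq> 0"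
      and \<phi>: "\<And>s. s1 < s \<Longrightarrow> s < s2 \<Longrightarrow> (\<phi> has_real_derivative tan (\<theta> s)) (at s)"
    have em: "even m" and a': "a = - (pi / 2)" using a an0 by auto
    have \<phi>\<sigma>: "((\<lambda>t. \<phi> (\<sigma> (- t))) has_real_derivative tan t * (sin t * tanh (\<sigma> (- t))) ^ m) (at t)"
      if "- (pi / 2) < t" "t < pi / 2" for t
    proof -
      have t: "a < - t" "- t < pi / 2" using that a' by auto
      have 1: "(uminus has_real_derivative - 1) (at t)" by (auto intro!: derivative_eq_intros)
      show ?thesis
        using DERIV_chain2[OF \<phi>[OF s12'[OF t]] DERIV_chain2[OF \<sigma>(3) 1]] \<theta>\<sigma>[of "- t"] t em by simp
    qed
    have "filterlim (\<lambda>t. \<phi> (\<sigma> (- t))) at_top (at_left (pi / 2))"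
    proof (rule filterlim_at_top_of_derivative_ge_tan[where a = "pi / 4" and c = "(sin (pi / 4) * tanh s1) ^ m"
          and h' = "\<lambda>t. tan t * (sin t * tanh (\<sigma> (- t))) ^ m"])
      fix t assume t: "pi / 4 \<le> t" "t < pi / 2"
      then have t': "0 < t" "t \<le> pi" using pi_gt_zero by linarith+
      show "((\<lambda>t. \<phi> (\<sigma> (- t))) has_real_derivative tan t * (sin t * tanh (\<sigma> (- t))) ^ m) (at t)"
        using t t' by (intro \<phi>\<sigma>) linarith+
      have "sin (pi / 4) \<le> sin t" using t by (intro sin_monotone_2pi_le) auto
      moreover have "s1 \<le> \<sigma> (- t)" using s12[of "- t"] t t' a' by auto
      ultimately have "(sin (pi / 4) * tanh s1) ^ m \<le> (sin t * tanh (\<sigma> (- t))) ^ m"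
        using \<sigma>(2)[of a] t' by (intro power_mono mult_mono mult_nonneg_nonneg sin_ge_zero) (auto simp: s1_def)
      moreover have "0 \<le> tan t" using t t' by (intro less_imp_le tan_gt_zero) auto
      ultimately show "(sin (pi / 4) * tanh s1) ^ m * tan t \<le> tan t * (sin t * tanh (\<sigma> (- t))) ^ m"
        by (simp add: mult.commute mult_left_mono)
    qed (use \<sigma>(2)[of a] pi_gt_zero in \<open>auto simp: sin_45 s1_def\<close>)
    moreover have "filterlim (\<lambda>s. - \<theta> s) (at_left (pi / 2)) (at_right s1)"
      unfolding filterlim_at
    proof
      have "(\<theta> \<longlongrightarrow> \<theta> s1) (at s1 within {s1..s2})"
        using \<theta>cont lt12 by (simp add: continuous_on_def)
      then have "(\<theta> \<longlongrightarrow> - (pi / 2)) (at_right s1)"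
        using lt12 a' by (simp add: th1 at_within_Icc_at_right)
      from tendsto_minus[OF this] show "((\<lambda>s. - \<theta> s) \<longlongrightarrow> pi / 2) (at_right s1)" by simp
      show "\<forall>\<^sub>F x in at_right s1. - \<theta> x \<in> {..<pi / 2} \<and> - \<theta> x \<noteq> pi / 2"
        unfolding eventually_at_right_field
      proof (intro exI[of _ s2] conjI allI impI)
        fix y assume "s1 < y" "y < s2"
        then have "- \<theta> y < pi / 2" using \<theta>mono[of s1 y] th1 a' by simp
        then show "- \<theta> y \<in> {..<pi / 2}" "- \<theta> y \<noteq> pi / 2" by simp_all
      qed (fact lt12)
    qed
    ultimately have "filterlim (\<lambda>s. \<phi> (\<sigma> (- (- \<theta> s)))) at_top (at_right s1)"
      by (rule filterlim_compose[where g = "\<lambda>t. \<phi> (\<sigma> (- t))"])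
    moreover have "\<forall>\<^sub>F s in at_right s1. \<phi> (\<sigma> (- (- \<theta> s))) = \<phi> s"
      unfolding eventually_at_right_field using lt12 \<theta> by (intro exI[of _ s2]) auto
    ultimately show "filterlim \<phi> at_top (at_right s1)"
      using filterlim_cong[OF refl refl, of "\<lambda>s. \<phi> (\<sigma> (- (- \<theta> s)))" \<phi>] by blast
  qed
qed


section \<open>Functions with a vertical asymptote\<close>

lemma filterlim_at_top_at_left_bound:
  fixes f :: "real \<Rightarrow> real"
  assumes "filterlim f at_top (at_left b)"
  obtains d where "0 < d" "\<And>s. b - d < s \<Longrightarrow> s < b \<Longrightarrow> K < f s"
proof -
  have "\<forall>\<^sub>F s in at_left b. K < f s" using assms by (simp add: filterlim_at_top_dense)
  then obtain c where "c < b" "\<And>s. c < s \<Longrightarrow> s < b \<Longrightarrow> K < f s"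
    unfolding eventually_at_left_field by auto
  then show thesis by (intro that[of "b - c"]) auto
qed

lemma filterlim_at_top_at_right_reflect:
  fixes f :: "real \<Rightarrow> real"
  assumes "filterlim f at_top (at_right a)"
  shows "filterlim (\<lambda>s. f (- s)) at_top (at_left (- a))"
  using assms by (simp add: at_right_minus filterlim_filtermap)

lemma filterlim_at_top_at_right_bound:
  fixes f :: "real \<Rightarrow> real"
  assumes "filterlim f at_top (at_right a)"
  obtains d where "0 < d" "\<And>s. a < s \<Longrightarrow> s < a + d \<Longrightarrow> K < f s"
proof -
  obtain d where d: "0 < d" "\<And>s. - a - d < s \<Longrightarrow> s < - a \<Longrightarrow> K < f (- s)"
    using filterlim_at_top_at_left_bound[OF filterlim_at_top_at_right_reflect[OF assms]] by metis
  show thesis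
  proof (rule that[OF d(1)])
    show "K < f s" if "a < s" "s < a + d" for s using d(2)[of "- s"] that by simp
  qed
qed

lemma level_near_left_blowup:
  fixes f :: "real \<Rightarrow> real"
  assumes ab: "a < b" and cont: "continuous_on {a<..<b} f" and lim: "filterlim f at_top (at_left b)"
    and r: "0 < r"
  obtains K where "\<And>t. K < t \<Longrightarrow> \<exists>s\<in>{a<..<b}. f s = t \<and> \<bar>s - b\<bar> < r"
proof -
  define c where "c = max ((a + b) / 2) (b - r / 2)"
  have c: "a < c" "c < b" "b - r < c" using ab r by (auto simp: c_def max_def)
  show thesis
  proof (rule that[of "f c"])
    fix t assume t: "f c < t"
    obtain d where d: "0 < d" "\<And>s. b - d < s \<Longrightarrow> s < b \<Longrightarrow> t < f s"
      using filterlim_at_top_at_left_bound[OF lim] by metis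
    define u where "u = max c (b - d / 2)"
    have u: "c \<le> u" "u < b" using c d by (auto simp: u_def)
    have "t < f u" using d u by (intro d(2)) (auto simp: u_def)
    moreover have "continuous_on {c..u} f" using cont by (rule continuous_on_subset) (use c u in auto)
    ultimately obtain s where "c \<le> s" "s \<le> u" "f s = t"
      using IVT'[of f c t u] t u by auto
    then show "\<exists>s\<in>{a<..<b}. f s = t \<and> \<bar>s - b\<bar> < r"
      using c u by (intro bexI[of _ s]) auto
  qed
qed

lemma level_near_right_blowup:
  fixes f :: "real \<Rightarrow> real"
  assumes ab: "a < b" and cont: "continuous_on {a<..<b} f" and lim: "filterlim f at_top (at_right a)"
    and r: "0 < r"
  obtains K where "\<And>t. K < t \<Longrightarrow> \<exists>s\<in>{a<..<b}. f s = t \<and> \<bar>s - a\<bar> < r"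
proof -
  have "continuous_on {- b<..<- a} (\<lambda>s. f (- s))"
    by (rule continuous_on_compose2[OF cont]) (auto intro!: continuous_intros)
  from level_near_left_blowup[OF _ this filterlim_at_top_at_right_reflect[OF lim] r] ab
  obtain K where K: "\<And>t. K < t \<Longrightarrow> \<exists>s\<in>{- b<..<- a}. f (- s) = t \<and> \<bar>s - - a\<bar> < r" by auto
  show thesis
  proof (rule that[of K])
    fix t assume "K < t"
    from K[OF this] obtain s where "s \<in> {- b<..<- a}" "f (- s) = t" "\<bar>s - - a\<bar> < r" by blast
    then show "\<exists>s\<in>{a<..<b}. f s = t \<and> \<bar>s - a\<bar> < r" by (intro bexI[of _ "- s"]) auto
  qed
qed


section \<open>The hyperboloid in Lorentz space\<close>

lemma mink_add_left: "mink (x + y) z = mink x z + mink y z"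
  by (simp add: mink_def inner_add_left algebra_simps)

lemma mink_add_right: "mink z (x + y) = mink z x + mink z y"
  by (simp add: mink_def inner_add_right algebra_simps)

lemma mink_minus_left: "mink (- x) y = - mink x y"
  by (simp add: mink_def)

lemma mink_minus_right: "mink x (- y) = - mink x y"
  by (simp add: mink_def)

lemma mink_zero [simp]: "mink 0 x = 0" "mink x 0 = 0"
  by (simp_all add: mink_def)

lemmas mink_simps = mink_add_left mink_add_right mink_diff_left mink_diff_right
  mink_scaleR_left mink_scaleR_right mink_minus_left mink_minus_right

lemma hyp_space_self: "x \<in> hyp_space \<Longrightarrow> mink x x = -1"
  by (simp add: hyp_space_def)

lemma bounded_linear_mink: "bounded_linear (\<lambda>x. mink x y)"
  unfolding mink_def
  by (intro bounded_linear_sub bounded_linear_intros bounded_linear_mult_left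
      bounded_linear_compose[OF bounded_linear_inner_left bounded_linear_fst]
      bounded_linear_compose[OF bounded_linear_mult_left bounded_linear_snd])

lemma continuous_on_mink [continuous_intros]:
  "continuous_on A f \<Longrightarrow> continuous_on A g \<Longrightarrow> continuous_on A (\<lambda>x. mink (f x) (g x))"
  unfolding mink_def by (intro continuous_intros)

lemma has_derivative_mink [derivative_intros]:
  "(f has_derivative f') F \<Longrightarrow> ((\<lambda>x. mink (f x) y) has_derivative (\<lambda>h. mink (f' h) y)) F"
  by (rule bounded_linear.has_derivative[OF bounded_linear_mink])

lemma has_vector_derivative_mink_self:
  assumes "(f has_vector_derivative f') (at t)"
  shows "((\<lambda>x. mink (f x) (f x)) has_real_derivative 2 * mink (f t) f') (at t)"
proof -
  have "((\<lambda>x. mink (f x) (f x)) has_derivative (\<lambda>h. 2 * mink (f t) f' * h)) (at t)"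
    unfolding mink_def
    by (rule derivative_eq_intros assms[unfolded has_vector_derivative_def] refl)+
      (auto simp: algebra_simps inner_commute)
  then show ?thesis by (simp add: has_field_derivative_def)
qed

lemma closed_hyp_space: "closed (hyp_space :: ('a::euclidean_space \<times> real) set)"
proof -
  have "hyp_space = {x :: 'a \<times> real. mink x x = -1} \<inter> {x. 0 \<le> snd x}"
  proof (intro set_eqI iffI)
    fix x :: "'a \<times> real" assume x: "x \<in> {x. mink x x = -1} \<inter> {x. 0 \<le> snd x}"
    moreover have "snd x \<noteq> 0"
    proof
      assume "snd x = 0"
      then have "mink x x = fst x \<bullet> fst x" by (simp add: mink_def)
      then show False using x inner_ge_zero[of "fst x"] by simp
    qed
    ultimately show "x \<in> hyp_space" by (simp add: hyp_space_def)
  qed (auto simp: hyp_space_def)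
  moreover have "closed \<dots>"
    by (intro closed_Int closed_Collect_eq closed_Collect_le continuous_intros)
  ultimately show ?thesis by simp
qed

lemma hyp_space_lift: "(y, sqrt (1 + (norm y)\<^sup>2)) \<in> hyp_space"
proof -
  have "0 < 1 + (norm y)\<^sup>2" by (simp add: add_pos_nonneg)
  then show ?thesis by (simp add: hyp_space_def mink_def dot_square_norm)
qed

lemma hyp_space_eq_lift: "x \<in> hyp_space \<Longrightarrow> x = (fst x, sqrt (1 + (norm (fst x))\<^sup>2))"
  using hyp_space_norm[of x] by (metis less_imp_le prod.collapse real_sqrt_unique)

text \<open>
  Cauchy-Schwarz in the horizontal factor turns \<open>mink x v = 0\<close> into a bound on the time component; it
  keeps the geodesic with velocity \<open>v\<close> on the upper sheet of the hyperboloid.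
\<close>

lemma unit_tangent_snd_less:
  assumes x: "x \<in> hyp_space" and v: "mink v v = 1" and xv: "mink x v = 0"
  shows "\<bar>snd v\<bar> < snd x"
proof -
  have "(snd x * snd v)\<^sup>2 = (fst x \<bullet> fst v)\<^sup>2" using xv by (simp add: mink_def)
  also have "\<dots> \<le> (norm (fst x) * norm (fst v))\<^sup>2"
    using Cauchy_Schwarz_ineq2[of "fst x" "fst v"] by (simp add: abs_le_square_iff[symmetric])
  also have "\<dots> = ((snd x)\<^sup>2 - 1) * (1 + (snd v)\<^sup>2)"
  proof -
    have "(norm (fst v))\<^sup>2 = 1 + (snd v)\<^sup>2"
      using v by (simp add: mink_def dot_square_norm power2_eq_square algebra_simps)
    then show ?thesis using hyp_space_norm(1)[OF x] by (simp add: power_mult_distrib)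
  qed
  finally have "(snd v)\<^sup>2 < (snd x)\<^sup>2" by (simp add: power_mult_distrib algebra_simps)
  then show ?thesis using hyp_space_norm(2)[OF x] by (metis abs_of_pos abs_le_square_iff not_less)
qed

lemma geodesic_in_hyp_space:
  assumes x: "x \<in> hyp_space" and v: "mink v v = 1" and xv: "mink x v = 0"
  shows "cosh r *\<^sub>R x + sinh r *\<^sub>R v \<in> hyp_space"
proof -
  have "mink (cosh r *\<^sub>R x + sinh r *\<^sub>R v) (cosh r *\<^sub>R x + sinh r *\<^sub>R v) = (sinh r)\<^sup>2 - (cosh r)\<^sup>2"
    using v xv hyp_space_self[OF x] mink_commute[of v x] by (simp add: mink_simps power2_eq_square)
  also have "\<dots> = -1" by (simp add: cosh_square_eq)
  finally have 1: "mink (cosh r *\<^sub>R x + sinh r *\<^sub>R v) (cosh r *\<^sub>R x + sinh r *\<^sub>R v) = -1" .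
  have "\<bar>sinh r * snd v\<bar> \<le> cosh r * \<bar>snd v\<bar>"
    unfolding abs_mult using sinh_le_cosh_real[of r] sinh_le_cosh_real[of "- r"]
    by (intro mult_right_mono) (auto simp: abs_if)
  also have "\<dots> < cosh r * snd x" using unit_tangent_snd_less[OF assms] by (simp add: cosh_real_pos)
  finally show ?thesis using 1 by (simp add: hyp_space_def abs_if split: if_splits)
qed


section \<open>Signed distance to a totally geodesic hyperplane\<close>

definition signed_dist :: "'a::euclidean_space \<times> real \<Rightarrow> 'a \<times> real \<Rightarrow> real" where
  "signed_dist e x = arsinh (mink x e)"

text \<open>
  The gradient in hyperbolic space of the signed distance.
\<close>

definition level_normal :: "'a::euclidean_space \<times> real \<Rightarrow> 'a \<times> real \<Rightarrow> 'a \<times> real" where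
  "level_normal e x = (1 / cosh (signed_dist e x)) *\<^sub>R (e + mink x e *\<^sub>R x)"

lemma sinh_signed_dist [simp]: "sinh (signed_dist e x) = mink x e"
  by (simp add: signed_dist_def)

lemma cosh_signed_dist_sq: "(cosh (signed_dist e x))\<^sup>2 = 1 + (mink x e)\<^sup>2"
  by (simp add: cosh_square_eq)

lemma equidistant_signed_dist:
  assumes "mink e e = 1"
  shows "x \<in> equidistant e s \<longleftrightarrow> x \<in> hyp_space \<and> signed_dist e x = s"
  by (auto simp: equidistant_eq[OF assms] signed_dist_def arsinh_sinh_real)

lemma region_between_signed_dist:
  assumes "mink e e = 1"
  shows "region_between e s1 s2 = {x \<in> hyp_space. signed_dist e x \<in> {s1<..<s2}}"
  by (auto simp: region_between_def equidistant_signed_dist[OF assms])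

lemma signed_dist_derivative:
  assumes "(f has_derivative f') (at z)"
  shows "((\<lambda>z. signed_dist e (f z)) has_derivative
     (\<lambda>h. mink (f' h) e / cosh (signed_dist e (f z)))) (at z)"
proof -
  have "(arsinh has_derivative (\<lambda>h. 1 / cosh (signed_dist e (f z)) * h)) (at (mink (f z) e))"
    by (rule has_derivative_eq_rhs[OF arsinh_real_has_field_derivative[unfolded has_field_derivative_def]])
      (simp add: fun_eq_iff signed_dist_def cosh_arsinh_real)
  from has_derivative_compose[OF has_derivative_mink[OF assms] this]
  show ?thesis by (simp add: signed_dist_def)
qed

lemma continuous_on_signed_dist [continuous_intros]:
  "continuous_on A f \<Longrightarrow> continuous_on A (\<lambda>x. signed_dist e (f x))"
  unfolding signed_dist_def
  by (rule continuous_on_compose2[OF continuous_on_arsinh[of UNIV]]) (auto intro!: continuous_intros)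

context
  fixes e :: "'a::euclidean_space \<times> real"
  assumes e: "mink e e = 1"
begin

lemma level_normal_unit:
  assumes x: "x \<in> hyp_space"
  shows "mink (level_normal e x) (level_normal e x) = 1" "mink x (level_normal e x) = 0"
    "mink (level_normal e x) e = cosh (signed_dist e x)"
proof -
  have c: "cosh (signed_dist e x) \<noteq> 0" "cosh (signed_dist e x) * cosh (signed_dist e x) = 1 + mink x e * mink x e"
    using cosh_signed_dist_sq[of e x] by (simp_all add: power2_eq_square order_less_imp_not_eq2)
  then have c1: "1 + mink x e * mink x e \<noteq> 0" by (metis mult_eq_0_iff)
  show "mink (level_normal e x) (level_normal e x) = 1" "mink x (level_normal e x) = 0"
    "mink (level_normal e x) e = cosh (signed_dist e x)"
    using c(1) c1 hyp_space_self[OF x] e mink_commute[of e x]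
    by (simp_all add: level_normal_def mink_simps divide_simps c(2))
qed

text \<open>
  The point at signed distance \<open>s\<close> on the geodesic through \<open>x\<close> that meets the equidistant hypersurfaces
  orthogonally.
\<close>

definition normal_flow :: "'a \<times> real \<Rightarrow> real \<Rightarrow> 'a \<times> real" where
  "normal_flow x s = cosh (s - signed_dist e x) *\<^sub>R x + sinh (s - signed_dist e x) *\<^sub>R level_normal e x"

lemma normal_flow:
  assumes x: "x \<in> hyp_space"
  shows "normal_flow x s \<in> hyp_space" "signed_dist e (normal_flow x s) = s"
    "hdist x (normal_flow x s) = \<bar>s - signed_dist e x\<bar>"
    "hdist (normal_flow x s) x = \<bar>s - signed_dist e x\<bar>"
    "normal_flow x (signed_dist e x) = x"
proof -
  show "normal_flow x s \<in> hyp_space"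
    unfolding normal_flow_def using level_normal_unit[OF x] by (intro geodesic_in_hyp_space[OF x])
  have "mink (normal_flow x s) e = sinh (s - signed_dist e x + signed_dist e x)"
    using level_normal_unit[OF x] unfolding normal_flow_def sinh_add by (simp add: mink_simps)
  then show "signed_dist e (normal_flow x s) = s" by (simp add: signed_dist_def arsinh_sinh_real)
  have "- mink x (normal_flow x s) = cosh \<bar>s - signed_dist e x\<bar>"
    using level_normal_unit[OF x] hyp_space_self[OF x] by (simp add: normal_flow_def mink_simps)
  then show "hdist x (normal_flow x s) = \<bar>s - signed_dist e x\<bar>"
    "hdist (normal_flow x s) x = \<bar>s - signed_dist e x\<bar>"
    unfolding hdist_def mink_commute[of "normal_flow x s" x] by (simp_all only: arcosh_cosh_real[OF abs_ge_zero])
  show "normal_flow x (signed_dist e x) = x" by (simp add: normal_flow_def)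
qed

text \<open>
  In terms of the feet \<open>p\<close> and \<open>q\<close> of \<open>x\<close> and \<open>y\<close> on the hyperplane, and of their signed distances \<open>s\<close>
  and \<open>r\<close>, one has \<open>- mink x y = cosh s * cosh r * (- mink p q) - sinh s * sinh r\<close>, which is at least
  \<open>cosh (s - r)\<close> because \<open>- mink p q \<ge> 1\<close>.
\<close>

lemma signed_dist_diff_le_hdist:
  assumes x: "x \<in> hyp_space" and y: "y \<in> hyp_space"
  shows "\<bar>signed_dist e x - signed_dist e y\<bar> \<le> hdist x y"
proof -
  define cx cy where "cx = cosh (signed_dist e x)" and "cy = cosh (signed_dist e y)"
  have c: "0 < cx" "0 < cy" "cx * cx = 1 + mink x e * mink x e" "cy * cy = 1 + mink y e * mink y e"
    using cosh_signed_dist_sq[of e x] cosh_signed_dist_sq[of e y]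
    by (auto simp: cx_def cy_def power2_eq_square)
  have foot: "cosh (signed_dist e x) *\<^sub>R normal_flow x 0 = x - mink x e *\<^sub>R e" if "x \<in> hyp_space" for x
  proof -
    have "cosh (signed_dist e x) *\<^sub>R normal_flow x 0 = ((cosh (signed_dist e x))\<^sup>2 - (mink x e)\<^sup>2) *\<^sub>R x - mink x e *\<^sub>R e"
      by (simp add: normal_flow_def level_normal_def power2_eq_square algebra_simps order_less_imp_not_eq2)
    then show ?thesis by (simp add: cosh_signed_dist_sq)
  qed
  have "cx * cy * mink (normal_flow x 0) (normal_flow y 0) = mink (x - mink x e *\<^sub>R e) (y - mink y e *\<^sub>R e)"
    unfolding foot[OF x, symmetric] foot[OF y, symmetric] by (simp add: mink_simps cx_def cy_def)
  also have "\<dots> = mink x y - mink x e * mink y e"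
    using e mink_commute[of e y] by (simp add: mink_simps)
  finally have "mink x y - mink x e * mink y e = cx * cy * mink (normal_flow x 0) (normal_flow y 0)" by simp
  also have "\<dots> \<le> cx * cy * (- 1)"
    using c mink_hyp_space_le[OF normal_flow(1)[OF x] normal_flow(1)[OF y]] by (intro mult_left_mono) auto
  finally have "cosh \<bar>signed_dist e x - signed_dist e y\<bar> \<le> - mink x y"
    by (simp add: cosh_diff cx_def cy_def)
  moreover have "1 \<le> cosh \<bar>signed_dist e x - signed_dist e y\<bar>" by (rule cosh_real_ge_1)
  ultimately have "arcosh (cosh \<bar>signed_dist e x - signed_dist e y\<bar>) \<le> hdist x y"
    unfolding hdist_def by (metis arcosh_real_strict_mono less_eq_real_def)
  then show ?thesis by (simp only: arcosh_cosh_real[OF abs_ge_zero])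
qed

lemma equidistant_nonempty: "equidistant e s \<noteq> {}"
proof -
  have "(0, 1) \<in> (hyp_space :: ('a \<times> real) set)" by (simp add: hyp_space_def mink_def)
  then show ?thesis using normal_flow(1,2) equidistant_signed_dist[OF e] by blast
qed

end



text \<open>
  The distance to an equidistant hypersurface is attained along the normal geodesic.
\<close>

lemma hdist_set_equidistant:
  assumes e: "mink e e = 1" and x: "x \<in> hyp_space"
  shows "hdist_set x (equidistant e c) = \<bar>signed_dist e x - c\<bar>" "bdd_below (hdist x ` equidistant e c)"
proof -
  have lb: "\<bar>signed_dist e x - c\<bar> \<le> hdist x y" if "y \<in> equidistant e c" for y
    using signed_dist_diff_le_hdist[OF e x, of y] that by (auto simp: equidistant_signed_dist[OF e])
  then show bdd: "bdd_below (hdist x ` equidistant e c)" by (rule bdd_belowI2)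
  have nf: "normal_flow e x c \<in> equidistant e c"
    using normal_flow(1,2)[OF e x] by (simp add: equidistant_signed_dist[OF e])
  show "hdist_set x (equidistant e c) = \<bar>signed_dist e x - c\<bar>"
    unfolding hdist_set_def
  proof (rule antisym)
    show "(INF y\<in>equidistant e c. hdist x y) \<le> \<bar>signed_dist e x - c\<bar>"
      using cINF_lower[OF bdd nf] normal_flow(3)[OF e x, of c] by (simp add: abs_minus_commute)
    show "\<bar>signed_dist e x - c\<bar> \<le> (INF y\<in>equidistant e c. hdist x y)"
      using lb nf by (intro cINF_greatest) auto
  qed
qed

lemma hdist_set_equidistant_Un:
  assumes e: "mink e e = 1" and x: "x \<in> hyp_space"
  shows "hdist_set x (equidistant e b \<union> equidistant e c) = min \<bar>signed_dist e x - b\<bar> \<bar>signed_dist e x - c\<bar>"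
  using cInf_union_distrib[of "hdist x ` equidistant e b" "hdist x ` equidistant e c"]
    hdist_set_equidistant[OF e x] equidistant_nonempty[OF e]
  by (simp add: hdist_set_def image_Un inf_real_def)


section \<open>Orthonormal frames and a Lorentz reflection\<close>

text \<open>
  Parallel transport, along the geodesic from the vertex \<open>(0, 1)\<close> of the hyperboloid to \<open>x\<close>, of the
  tangent vector \<open>(b, 0)\<close>.
\<close>

definition hyp_frame :: "'a::euclidean_space \<times> real \<Rightarrow> 'a \<Rightarrow> 'a \<times> real" where
  "hyp_frame x b = (b + ((b \<bullet> fst x) / (1 + snd x)) *\<^sub>R fst x, b \<bullet> fst x)"

lemma hyp_frame:
  assumes x: "x \<in> hyp_space"
  shows "mink (hyp_frame x b) (hyp_frame x c) = b \<bullet> c" "mink x (hyp_frame x b) = 0"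
    "mink x v = 0 \<Longrightarrow> hyp_frame x (fst v - (snd v / (1 + snd x)) *\<^sub>R fst x) = v"
proof -
  define y h k where "y = fst x" and "h = snd x" and "k = 1 / (1 + snd x)"
  have h: "0 < h" and yy: "y \<bullet> y = (h - 1) * (h + 1)"
    using hyp_space_norm[OF x] by (simp_all add: y_def h_def dot_square_norm power2_eq_square algebra_simps)
  then have kh: "k * (h + 1) = 1" by (simp add: k_def h_def)
  have fr: "hyp_frame x b = (b + ((b \<bullet> y) * k) *\<^sub>R y, b \<bullet> y)" for b
    by (simp add: hyp_frame_def y_def k_def)
  have sw: "y \<bullet> b = b \<bullet> y" "y \<bullet> c = c \<bullet> y" by (simp_all add: inner_commute)
  have "mink (hyp_frame x b) (hyp_frame x c) =
      b \<bullet> c + (b \<bullet> y) * (c \<bullet> y) * (2 * k + k * (h - 1) * (k * (h + 1)) - 1)"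
    unfolding fr by (simp add: mink_def inner_add_left inner_add_right sw yy algebra_simps)
  also have "2 * k + k * (h - 1) * (k * (h + 1)) - 1 = 0"
    unfolding kh using kh by (simp add: algebra_simps)
  finally show "mink (hyp_frame x b) (hyp_frame x c) = b \<bullet> c" by simp
  have "mink x (hyp_frame x b) = (b \<bullet> y) * (1 + (h - 1) * (k * (h + 1)) - h)"
    unfolding fr by (simp add: mink_def inner_add_right sw yy algebra_simps flip: y_def h_def)
  then show "mink x (hyp_frame x b) = 0" unfolding kh by simp
  assume "mink x v = 0"
  then have vy: "fst v \<bullet> y = snd v * h" by (simp add: mink_def y_def h_def inner_commute)
  have "(fst v - (snd v * k) *\<^sub>R y) \<bullet> y = snd v * (h - (h - 1) * (k * (h + 1)))"
    by (simp add: inner_diff_left vy yy algebra_simps)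
  then have "(fst v - (snd v * k) *\<^sub>R y) \<bullet> y = snd v" unfolding kh by simp
  then show "hyp_frame x (fst v - (snd v / (1 + snd x)) *\<^sub>R fst x) = v"
    unfolding fr by (simp add: y_def k_def)
qed

text \<open>
  Since \<open>hyp_frame x\<close> is a linear isometry onto the tangent space at \<open>x\<close>, Euclidean orthonormal
  bases carry over; the preimage of \<open>v\<close> is completed to such a basis.
\<close>

lemma adapted_orthonormal_frame:
  fixes x v :: "'a::euclidean_space \<times> real"
  assumes x: "x \<in> hyp_space" and v: "mink v v = 1" "mink x v = 0"
  obtains E :: "nat \<Rightarrow> 'a \<times> real" and i0 where "i0 < DIM('a)" "E i0 = v"
    "\<And>i. i < DIM('a) \<Longrightarrow> mink x (E i) = 0"
    "\<And>i j. i < DIM('a) \<Longrightarrow> j < DIM('a) \<Longrightarrow> mink (E i) (E j) = (if i = j then 1 else 0)"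
proof -
  define b where "b = fst v - (snd v / (1 + snd x)) *\<^sub>R fst x"
  have b: "hyp_frame x b = v" unfolding b_def by (rule hyp_frame(3)[OF x v(2)])
  have "b \<bullet> b = 1" using hyp_frame(1)[OF x, of b b] v by (simp add: b)
  then have "norm b = 1" by (simp add: norm_eq_1)
  then obtain S where S: "b \<in> S" "pairwise orthogonal S" "\<And>y. y \<in> S \<Longrightarrow> norm y = 1"
    "independent S" "card S = DIM('a)"
    using vector_in_orthonormal_basis by metis
  have "finite S" using S(4) by (rule independent_imp_finite)
  then obtain f where f: "bij_betw f {..<DIM('a)} S"
    using S(5) ex_bij_betw_nat_finite[of S] by (auto simp: atLeast0LessThan)
  obtain i0 where i0: "i0 < DIM('a)" "f i0 = b"
    using S(1) f by (auto simp: bij_betw_def)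
  show thesis
  proof (rule that[of i0 "\<lambda>i. hyp_frame x (f i)"])
    show "mink (hyp_frame x (f i)) (hyp_frame x (f j)) = (if i = j then 1 else 0)"
      if "i < DIM('a)" "j < DIM('a)" for i j
    proof -
      have fS: "f i \<in> S" "f j \<in> S" and "i \<noteq> j \<Longrightarrow> f i \<noteq> f j"
        using f that by (auto simp: bij_betw_def inj_on_def)
      then have "i \<noteq> j \<Longrightarrow> f i \<bullet> f j = 0" "f i \<bullet> f i = 1"
        using S(2,3) by (auto simp: pairwise_def orthogonal_def norm_eq_1)
      then show ?thesis using hyp_frame(1)[OF x] by auto
    qed
  qed (use i0 b hyp_frame(2)[OF x] in auto)
qed

text \<open>
  The reflection in the Lorentz-orthogonal complement of \<open>z = e - (w, 0)\<close> exchanges \<open>e\<close> and \<open>(w, 0)\<close>.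
  Taking \<open>w\<close> opposite to the horizontal part of \<open>e\<close> makes \<open>z\<close> spacelike, so that the reflection maps
  the upper sheet of the hyperboloid to itself. In the coordinates that it provides, the signed
  distance depends on a single linear coordinate \<open>y \<bullet> w\<close>.
\<close>

lemma lorentz_reflection_to_horizontal:
  fixes e :: "'a::euclidean_space \<times> real"
  assumes e: "mink e e = 1"
  obtains w :: 'a and R :: "'a \<times> real \<Rightarrow> 'a \<times> real" where "norm w = 1" "linear R"
    "\<And>x. R (R x) = x" "\<And>x. mink (R x) e = fst x \<bullet> w" "\<And>x. x \<in> hyp_space \<Longrightarrow> R x \<in> hyp_space"
proof -
  have vv: "fst e \<bullet> fst e = 1 + (snd e)\<^sup>2" using e by (simp add: mink_def power2_eq_square)
  have v0: "0 < norm (fst e)" using vv by (metis add_pos_nonneg inner_eq_zero_iff less_irrefl zero_le_power2 zero_less_norm_iff zero_less_one)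
  define w where "w = - (1 / norm (fst e)) *\<^sub>R fst e"
  have w: "norm w = 1" using v0 by (simp add: w_def)
  have ew: "fst e \<bullet> w = - norm (fst e)"
    using v0 by (simp add: w_def dot_square_norm power2_eq_square)
  define z where "z = e - (w, 0)"
  have ww: "mink (w, 0) (w, 0) = 1" using w by (simp add: mink_def norm_eq_1)
  have we: "mink e (w, 0) = - norm (fst e)" "mink (w, 0) e = - norm (fst e)"
    using ew by (simp_all add: mink_def inner_commute)
  have zz: "mink z z = 2 * (1 + norm (fst e))"
    using ww we e by (simp add: z_def mink_simps)
  have zz0: "0 < mink z z" by (simp add: zz add_pos_nonneg)
  define R where "R x = x - (2 * mink x z / mink z z) *\<^sub>R z" for x
  have Rm: "mink (R x) (R y) = mink x y" for x y
    using zz0 mink_commute[of z y] by (simp add: R_def mink_simps)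
  have RR: "R (R x) = x" for x
  proof -
    have "mink (R x) z = - mink x z" using zz0 by (simp add: R_def mink_simps)
    then show ?thesis unfolding R_def[of "R x"] by (simp add: R_def[of x])
  qed
  have Re: "R (w, 0) = e"
  proof -
    have "mink (w, 0) z = - (1 + norm (fst e))" using we ww by (simp add: z_def mink_simps)
    then have "2 * mink (w, 0) z = - mink z z" using zz by simp
    then have "R (w, 0) = (w, 0) + z" using zz0 by (simp add: R_def)
    then show ?thesis unfolding z_def by simp
  qed
  show thesis
  proof (rule that[OF w])
    show "linear R"
      by (rule linearI) (simp_all add: R_def mink_simps algebra_simps add_divide_distrib)
    show "R (R x) = x" for x by (rule RR)
    show "mink (R x) e = fst x \<bullet> w" for x
      using Rm[of x "(w, 0)"] by (simp add: Re mink_def)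
    fix x assume x: "x \<in> (hyp_space :: ('a \<times> real) set)"
    show "R x \<in> hyp_space"
    proof -
      have 1: "mink (R x) (R x) = -1" using Rm x by (simp add: hyp_space_def)
      have le: "mink x (R x) \<le> -1"
        using hyp_space_self[OF x] zz0 by (simp add: R_def mink_simps)
      have "snd (R x) \<noteq> 0"
      proof
        assume "snd (R x) = 0"
        then show False using 1 inner_ge_zero[of "fst (R x)"] by (simp add: mink_def)
      qed
      moreover have "\<not> snd (R x) < 0"
      proof
        assume "snd (R x) < 0"
        then have "- R x \<in> hyp_space" using 1 by (simp add: hyp_space_def mink_simps)
        from mink_hyp_space_le[OF x this] show False using le by (simp add: mink_simps)
      qed
      ultimately show ?thesis using 1 by (simp add: hyp_space_def)
    qed
  qed
qed

text \<open>
  A derivative within \<open>S\<close> need not be unique, but on tangent vectors it is the velocity of the image of a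
  curve in \<open>S\<close>. Thus the shape operator can be computed with any extension of the normal.
\<close>

lemma frechet_derivative_within_tangent:
  assumes N: "(N has_derivative D) (at p within S)" and X: "X \<in> tangent_space S p"
  shows "frechet_derivative N (at p within S) X = D X"
proof -
  obtain \<gamma> \<epsilon> where \<gamma>: "0 < \<epsilon>" "\<gamma> ` {-\<epsilon><..<\<epsilon>} \<subseteq> S" "\<gamma> 0 = p" "(\<gamma> has_vector_derivative X) (at (0::real))"
    using X by (auto simp: tangent_space_def)
  have along: "((\<lambda>t. N (\<gamma> t)) has_vector_derivative D' X) (at 0)" if "(N has_derivative D') (at p within S)" for D'
  proof -
    have d: "(\<gamma> has_derivative (\<lambda>t. t *\<^sub>R X)) (at 0 within {-\<epsilon><..<\<epsilon>})"
      using \<gamma>(4) by (auto simp: has_vector_derivative_def intro: has_derivative_at_withinI)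
    have "(N has_derivative D') (at (\<gamma> 0) within \<gamma> ` {-\<epsilon><..<\<epsilon>})"
      using that \<gamma>(2,3) by (auto intro: has_derivative_subset)
    from diff_chain_within[OF d this]
    have "((N \<circ> \<gamma>) has_derivative D' \<circ> (\<lambda>t. t *\<^sub>R X)) (at 0 within {-\<epsilon><..<\<epsilon>})" .
    then have "((\<lambda>t. N (\<gamma> t)) has_derivative (\<lambda>t. t *\<^sub>R D' X)) (at 0)"
      using at_within_open[of 0 "{-\<epsilon><..<\<epsilon>}"] \<gamma>(1) linear_scale[OF has_derivative_linear[OF that]]
      by (simp add: o_def)
    then show ?thesis by (simp add: has_vector_derivative_def)
  qed
  have "(N has_derivative frechet_derivative N (at p within S)) (at p within S)"
    using N by (metis frechet_derivative_works differentiableI)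
  from vector_derivative_unique_at[OF along[OF this] along[OF N]] show ?thesis .
qed


section \<open>Graphs over the signed distance\<close>

text \<open>
  In finite dimension, a derivative depends continuously on the base point as an operator as soon as
  all its values do; this spares the construction of operator-valued derivatives.
\<close>

lemma C1_onI:
  fixes f :: "'p::euclidean_space \<Rightarrow> 'q::real_normed_vector"
  assumes D: "\<And>x. x \<in> U \<Longrightarrow> (f has_derivative D x) (at x)"
    and cont: "\<And>h. continuous_on U (\<lambda>x. D x h)"
  shows "C1_on f U"
  unfolding C1_on_def
proof (intro exI[of _ "\<lambda>x. Blinfun (D x)"] conjI ballI)
  have ap: "blinfun_apply (Blinfun (D x)) = D x" if "x \<in> U" for x
    by (rule bounded_linear_Blinfun_apply[OF has_derivative_bounded_linear[OF D[OF that]]])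
  show "(f has_derivative blinfun_apply (Blinfun (D x))) (at x)" if "x \<in> U" for x
    using D[OF that] by (simp add: ap[OF that])
  show "continuous_on U (\<lambda>x. Blinfun (D x))"
  proof (rule continuous_on_blinfun_componentwise)
    show "continuous_on U (\<lambda>x. blinfun_apply (Blinfun (D x)) i)" for i
      using cont[of i] by (simp add: ap cong: continuous_on_cong)
  qed
qed

text \<open>
  The graph of \<open>\<phi>\<close>, as a function of the signed distance, between the equidistant hypersurfaces at
  distances \<open>s1\<close> and \<open>s2\<close>. The angle from the vertical field to the unit normal is \<open>\<theta>\<close>, that is
  \<open>\<phi>' = tan \<theta>\<close>. The equation for \<open>\<theta>\<close> fails at most at the distance \<open>l\<close>: this is an interior point
  in odd dimension, where it yields the singular set, and the end point \<open>s1\<close> in even dimension, so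
  that the graph is then of class \<open>C\<^sup>2\<close> everywhere.
\<close>

locale grim_reaper =
  fixes e :: "'a::euclidean_space \<times> real" and s1 s2 l :: real and \<phi> \<theta> :: "real \<Rightarrow> real"
  assumes e: "mink e e = 1" and s12: "0 \<le> s1" "s1 < s2"
    and angle_cont: "continuous_on {s1<..<s2} \<theta>"
    and angle_range: "\<And>s. s \<in> {s1<..<s2} \<Longrightarrow> - (pi / 2) < \<theta> s \<and> \<theta> s < pi / 2"
    and height_deriv: "\<And>s. s \<in> {s1<..<s2} \<Longrightarrow> (\<phi> has_real_derivative tan (\<theta> s)) (at s)"
    and angle_nonzero: "\<And>s. s \<in> {s1<..<s2} - {l} \<Longrightarrow> \<theta> s \<noteq> 0"
    and angle_deriv: "\<And>s. s \<in> {s1<..<s2} - {l} \<Longrightarrow>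
      (\<theta> has_real_derivative 1 / (sin (\<theta> s) * tanh s) ^ (DIM('a) - 1)) (at s)"
    and angle_singular: "l \<in> {s1<..<s2} \<Longrightarrow> \<not> \<theta> differentiable (at l)"
begin

definition reaper :: "(('a \<times> real) \<times> real) set" where
  "reaper = (\<lambda>x. (x, \<phi> (signed_dist e x))) ` {x \<in> hyp_space. signed_dist e x \<in> {s1<..<s2}}"

text \<open>
  The derivative of the height in the direction \<open>v\<close>.
\<close>

definition slope :: "'a \<times> real \<Rightarrow> 'a \<times> real \<Rightarrow> real" where
  "slope x v = tan (\<theta> (signed_dist e x)) * (mink v e / cosh (signed_dist e x))"

subsection \<open>Regularity\<close>

lemma reaper_iff: "(x, t) \<in> reaper \<longleftrightarrow> x \<in> hyp_space \<and> signed_dist e x \<in> {s1<..<s2} \<and> t = \<phi> (signed_dist e x)"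
  by (auto simp: reaper_def)

lemma reaperE:
  assumes "p \<in> reaper"
  obtains x where "p = (x, \<phi> (signed_dist e x))" "x \<in> hyp_space" "signed_dist e x \<in> {s1<..<s2}"
  using assms by (auto simp: reaper_def)

lemma cos_angle_pos: "s \<in> {s1<..<s2} \<Longrightarrow> 0 < cos (\<theta> s)"
  using angle_range by (intro cos_gt_zero_pi) auto

lemma open_signed_dist_vimage: "open {z :: ('a \<times> real) \<times> real. signed_dist e (fst z) \<in> A}" if "open A"
proof -
  have "open ((\<lambda>z :: ('a \<times> real) \<times> real. signed_dist e (fst z)) -` A)"
    by (rule open_vimage[OF that]) (intro continuous_intros)
  then show ?thesis by (simp add: vimage_def)
qed

lemma height_has_derivative:
  assumes f: "(f has_derivative f') (at z)" and z: "signed_dist e (f z) \<in> {s1<..<s2}"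
  shows "((\<lambda>z. \<phi> (signed_dist e (f z))) has_derivative (\<lambda>h. slope (f z) (f' h))) (at z)"
  using has_derivative_compose[OF signed_dist_derivative[OF f] height_deriv[OF z, unfolded has_field_derivative_def]]
  by (simp add: slope_def)

lemma angle_continuous:
  assumes "continuous_on A f" "\<And>z. z \<in> A \<Longrightarrow> signed_dist e (f z) \<in> {s1<..<s2}"
  shows "continuous_on A (\<lambda>z. \<theta> (signed_dist e (f z)))"
  by (rule continuous_on_compose2[OF angle_cont]) (use assms in \<open>auto intro!: continuous_intros\<close>)

lemma slope_continuous:
  assumes "continuous_on A f" "\<And>z. z \<in> A \<Longrightarrow> signed_dist e (f z) \<in> {s1<..<s2}" "continuous_on A g"
  shows "continuous_on A (\<lambda>z. slope (f z) (g z))"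
proof -
  have "continuous_on A (\<lambda>z. tan (\<theta> (signed_dist e (f z))))"
    by (rule continuous_on_compose2[OF continuous_on_tan[of "{t. cos t \<noteq> 0}"] angle_continuous[OF assms(1,2)]])
      (use assms(2) cos_angle_pos in \<open>force simp: less_imp_neq[symmetric]\<close>)+
  then show ?thesis
    unfolding slope_def using assms by (intro continuous_intros) auto
qed

definition height_defect :: "('a \<times> real) \<times> real \<Rightarrow> real" where
  "height_defect z = snd z - \<phi> (signed_dist e (fst z))"

lemma height_defect_has_derivative:
  assumes "signed_dist e (fst z) \<in> {s1<..<s2}"
  shows "(height_defect has_derivative (\<lambda>h. snd h - slope (fst z) (fst h))) (at z)"
  unfolding height_defect_def
  by (rule derivative_eq_intros height_has_derivative assms refl)+

lemma C1_height_defect: "C1_on height_defect {z. signed_dist e (fst z) \<in> {s1<..<s2}}"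
  by (rule C1_onI[OF height_defect_has_derivative])
    (auto intro!: continuous_intros slope_continuous)

lemma hypersurface_at_height_defect:
  assumes p: "p \<in> reaper" and A: "open A" "A \<subseteq> {s1<..<s2}" "signed_dist e (fst p) \<in> A"
    and R: "R height_defect {z. signed_dist e (fst z) \<in> A}"
  shows "hypersurface_at R reaper p"
  unfolding hypersurface_at_def
proof (intro exI conjI)
  let ?U = "{z :: ('a \<times> real) \<times> real. signed_dist e (fst z) \<in> A}"
  show "open ?U" by (rule open_signed_dist_vimage[OF A(1)])
  show "p \<in> ?U" "R height_defect ?U" using A(3) R by auto
  show "reaper \<inter> ?U = {q \<in> hyp_prod \<inter> ?U. height_defect q = 0}"
    using A(2) by (auto simp: height_defect_def hyp_prod_def reaper_iff)
  have "(0, 1) \<in> tangent_prod p" by (simp add: tangent_prod_def)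
  moreover have "frechet_derivative height_defect (at p) (0, 1) \<noteq> 0"
    using frechet_derivative_at[OF height_defect_has_derivative[of p], symmetric] A(2,3) by (auto simp: slope_def)
  ultimately show "\<exists>v\<in>tangent_prod p. frechet_derivative height_defect (at p) v \<noteq> 0" by blast
qed

text \<open>
  The derivative of \<open>height_defect\<close> is a constant operator minus the multiple \<open>tan \<theta> / cosh s\<close> of another one,
  and this coefficient is continuously differentiable wherever the equation for \<open>\<theta>\<close> holds.
\<close>

lemma C2_height_defect: "C2_on height_defect {z. signed_dist e (fst z) \<in> {s1<..<s2} - {l}}"
proof -
  define M T where "M = Blinfun (\<lambda>h :: ('a \<times> real) \<times> real. mink (fst h) e)"
    and "T = Blinfun (\<lambda>h :: ('a \<times> real) \<times> real. snd h)"
  have M: "blinfun_apply M = (\<lambda>h. mink (fst h) e)"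
    unfolding M_def
    by (rule bounded_linear_Blinfun_apply[OF bounded_linear_compose[OF bounded_linear_mink bounded_linear_fst]])
  have T: "blinfun_apply T = (\<lambda>h. snd h)"
    unfolding T_def by (rule bounded_linear_Blinfun_apply[OF bounded_linear_snd])
  define k k' where "k s = tan (\<theta> s) / cosh s"
    and "k' s = (1 / (sin (\<theta> s) * tanh s) ^ (DIM('a) - 1) / (cos (\<theta> s))\<^sup>2 * cosh s - tan (\<theta> s) * sinh s) / (cosh s)\<^sup>2" for s
  have k: "(k has_real_derivative k' s) (at s)" if "s \<in> {s1<..<s2} - {l}" for s
  proof -
    have c: "cos (\<theta> s) \<noteq> 0" using cos_angle_pos[of s] that by auto
    show ?thesis
      unfolding k_def k'_def
      by (rule derivative_eq_intros DERIV_chain2[OF DERIV_tan] angle_deriv that c refl)+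
        (auto simp: field_simps power2_eq_square)
  qed
  show ?thesis
    unfolding C2_on_def
  proof (intro exI[of _ "\<lambda>z :: ('a \<times> real) \<times> real. T - k (signed_dist e (fst z)) *\<^sub>R M"] conjI ballI)
    fix z assume z: "z \<in> {z :: ('a \<times> real) \<times> real. signed_dist e (fst z) \<in> {s1<..<s2} - {l}}"
    have "blinfun_apply (T - k (signed_dist e (fst z)) *\<^sub>R M) = (\<lambda>h. snd h - slope (fst z) (fst h))"
      by (simp add: fun_eq_iff blinfun.diff_left blinfun.scaleR_left M T slope_def k_def)
    then show "(height_defect has_derivative blinfun_apply (T - k (signed_dist e (fst z)) *\<^sub>R M)) (at z)"
      using height_defect_has_derivative z by simp
  next
    let ?D = "\<lambda>(z :: ('a \<times> real) \<times> real) (h :: ('a \<times> real) \<times> real). - (k' (signed_dist e (fst z)) * (mink (fst h) e / cosh (signed_dist e (fst z)))) *\<^sub>R M"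
    show "C1_on (\<lambda>z :: ('a \<times> real) \<times> real. T - k (signed_dist e (fst z)) *\<^sub>R M) {z. signed_dist e (fst z) \<in> {s1<..<s2} - {l}}"
    proof (rule C1_onI[where D = ?D])
      fix z assume z: "z \<in> {z :: ('a \<times> real) \<times> real. signed_dist e (fst z) \<in> {s1<..<s2} - {l}}"
      then have s: "signed_dist e (fst z) \<in> {s1<..<s2} - {l}" by simp
      have "((\<lambda>z. signed_dist e (fst z)) has_derivative (\<lambda>h. mink (fst h) e / cosh (signed_dist e (fst z)))) (at z)"
        by (rule signed_dist_derivative) (auto intro!: derivative_eq_intros)
      from has_derivative_compose[OF this k[OF s, unfolded has_field_derivative_def]]
      have kd: "((\<lambda>z. k (signed_dist e (fst z))) has_derivative
          (\<lambda>h. k' (signed_dist e (fst z)) * (mink (fst h) e / cosh (signed_dist e (fst z))))) (at z)" .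
      show "((\<lambda>z. T - k (signed_dist e (fst z)) *\<^sub>R M) has_derivative ?D z) (at z)"
        by (rule has_derivative_eq_rhs[OF has_derivative_diff[OF has_derivative_const
              has_derivative_scaleR_left[OF kd]]]) (simp add: fun_eq_iff)
    next
      fix h
      have "sin (\<theta> s) \<noteq> 0" "cos (\<theta> s) \<noteq> 0" "tanh s \<noteq> 0" if "s \<in> {s1<..<s2} - {l}" for s
      proof -
        have "\<bar>\<theta> s\<bar> < pi" using angle_range[of s] that by auto
        then show "sin (\<theta> s) \<noteq> 0" "cos (\<theta> s) \<noteq> 0" "tanh s \<noteq> 0"
          using that angle_nonzero[OF that] cos_angle_pos[of s] s12 by (auto simp: sin_zero_pi_iff)
      qed
      moreover have "continuous_on ({s1<..<s2} - {l}) \<theta>"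
        using angle_cont by (rule continuous_on_subset) auto
      ultimately have "continuous_on ({s1<..<s2} - {l}) k'"
        unfolding k'_def tan_def by (intro continuous_intros) simp_all
      then have "continuous_on {z :: ('a \<times> real) \<times> real. signed_dist e (fst z) \<in> {s1<..<s2} - {l}} (\<lambda>z. k' (signed_dist e (fst z)))"
        by (rule continuous_on_compose2) (auto intro!: continuous_intros)
      moreover have "cosh s \<noteq> 0" for s :: real by simp
      ultimately show "continuous_on {z. signed_dist e (fst z) \<in> {s1<..<s2} - {l}} (\<lambda>z. ?D z h)"
        by (intro continuous_on_scaleR continuous_on_minus continuous_on_mult continuous_on_divide
            continuous_on_const continuous_on_cosh continuous_on_signed_dist continuous_on_fst
            continuous_on_id) auto
    qed
  qed
qed

lemma signed_dist_reaper: "p \<in> reaper \<Longrightarrow> signed_dist e (fst p) \<in> {s1<..<s2}"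
  by (auto elim: reaperE)

lemma hypersurface_at_C1:
  assumes "p \<in> reaper"
  shows "hypersurface_at C1_on reaper p"
  by (rule hypersurface_at_height_defect[where R = C1_on, OF assms open_greaterThanLessThan order_refl
        signed_dist_reaper[OF assms] C1_height_defect])

lemma hypersurface_at_C2:
  assumes "p \<in> reaper" "signed_dist e (fst p) \<noteq> l"
  shows "hypersurface_at C2_on reaper p"
  by (rule hypersurface_at_height_defect[where R = C2_on, OF assms(1) _ _ _ C2_height_defect])
    (use signed_dist_reaper[OF assms(1)] assms(2) in auto)

lemma C2_singular_set_reaper: "C2_singular_set reaper \<subseteq> {p \<in> reaper. signed_dist e (fst p) = l}"
  using hypersurface_at_C2 by (auto simp: C2_singular_set_def)

subsection \<open>Tangent spaces\<close>

text \<open>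
  The curve is the vertical lift of a straight horizontal segment, first to the hyperboloid and then
  to the graph.
\<close>

lemma tangent_curve:
  assumes x: "x \<in> hyp_space" "signed_dist e x \<in> {s1<..<s2}" and w: "mink x w = 0"
  shows "(w, slope x w) \<in> tangent_space reaper (x, \<phi> (signed_dist e x))"
proof -
  \<comment> \<open>on the hyperboloid, the time component is determined by the horizontal one\<close>
  define c where "c t = (fst x + t *\<^sub>R fst w, sqrt (1 + (norm (fst x + t *\<^sub>R fst w))\<^sup>2))" for t :: real
  have c0: "c 0 = x" using hyp_space_eq_lift[OF x(1)] by (simp add: c_def)
  have cH: "c t \<in> hyp_space" for t unfolding c_def by (rule hyp_space_lift)
  have pos: "0 < 1 + (norm y)\<^sup>2" for y :: 'a by (simp add: add_pos_nonneg)
  have sx: "sqrt (1 + (norm (fst x))\<^sup>2) = snd x" using hyp_space_eq_lift[OF x(1)] by (metis snd_conv)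
  have xw: "fst x \<bullet> fst w = snd x * snd w" using w by (simp add: mink_def)
  have cd: "(c has_vector_derivative w) (at 0)"
  proof -
    have q: "((\<lambda>t::real. 1 + (fst x + t *\<^sub>R fst w) \<bullet> (fst x + t *\<^sub>R fst w)) has_real_derivative 2 * (fst x \<bullet> fst w)) (at 0)"
      unfolding has_field_derivative_def
      by (rule derivative_eq_intros refl)+ (auto simp: inner_commute algebra_simps)
    have "(sqrt has_real_derivative inverse (sqrt (1 + fst x \<bullet> fst x)) / 2)
        (at (1 + (fst x + 0 *\<^sub>R fst w) \<bullet> (fst x + 0 *\<^sub>R fst w)))"
      using DERIV_real_sqrt[of "1 + fst x \<bullet> fst x"] pos[of "fst x"] by (simp add: dot_square_norm)
    from DERIV_chain2[OF this q]
    have "((\<lambda>t. sqrt (1 + (fst x + t *\<^sub>R fst w) \<bullet> (fst x + t *\<^sub>R fst w))) has_real_derivative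
        inverse (sqrt (1 + fst x \<bullet> fst x)) / 2 * (2 * (fst x \<bullet> fst w))) (at 0)" .
    also have "inverse (sqrt (1 + fst x \<bullet> fst x)) / 2 * (2 * (fst x \<bullet> fst w)) = snd w"
      using hyp_space_norm(2)[OF x(1)] by (simp add: dot_square_norm sx xw)
    finally have "((\<lambda>t. sqrt (1 + (norm (fst x + t *\<^sub>R fst w))\<^sup>2)) has_vector_derivative snd w) (at 0)"
      by (simp add: dot_square_norm has_real_derivative_iff_has_vector_derivative)
    moreover have "((\<lambda>t. fst x + t *\<^sub>R fst w) has_vector_derivative fst w) (at 0)"
      by (auto intro!: derivative_eq_intros simp: has_vector_derivative_def)
    ultimately have "(c has_vector_derivative (fst w, snd w)) (at 0)"
      unfolding c_def by (intro has_vector_derivative_Pair)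
    then show ?thesis by simp
  qed
  have "isCont c 0" using cd by (rule has_vector_derivative_continuous)
  moreover have "isCont (signed_dist e) (c 0)"
    using continuous_on_signed_dist[OF continuous_on_id, of UNIV e]
    by (simp add: continuous_on_eq_continuous_at del: split_paired_All)
  ultimately have "isCont (\<lambda>t. signed_dist e (c t)) 0" by (rule isCont_o2)
  then have "((\<lambda>t. signed_dist e (c t)) \<longlongrightarrow> signed_dist e x) (at 0)"
    by (simp add: isCont_def c0)
  from topological_tendstoD[OF this open_greaterThanLessThan x(2)]
  have "\<forall>\<^sub>F t in at 0. signed_dist e (c t) \<in> {s1<..<s2}" .
  then obtain d where d: "0 < d" "\<And>t. t \<noteq> 0 \<Longrightarrow> \<bar>t\<bar> < d \<Longrightarrow> signed_dist e (c t) \<in> {s1<..<s2}"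
    unfolding eventually_at by (auto simp: dist_real_def)
  have d': "signed_dist e (c t) \<in> {s1<..<s2}" if "\<bar>t\<bar> < d" for t
    using d(2)[OF _ that] x(2) c0 by (cases "t = 0") auto
  define \<gamma> where "\<gamma> t = (c t, \<phi> (signed_dist e (c t)))" for t
  have "((\<lambda>t. \<phi> (signed_dist e (c t))) has_vector_derivative slope x w) (at 0)"
    using height_has_derivative[OF cd[unfolded has_vector_derivative_def]] x(2)
    by (simp add: c0 has_vector_derivative_def slope_def mink_simps mult.assoc mult.left_commute)
  with cd have "(\<gamma> has_vector_derivative (w, slope x w)) (at 0)"
    unfolding \<gamma>_def by (intro has_vector_derivative_Pair)
  moreover have "\<gamma> ` {-d<..<d} \<subseteq> reaper" using d' cH by (auto simp: \<gamma>_def reaper_iff abs_less_iff)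
  ultimately show ?thesis
    using d(1) c0 by (auto simp: tangent_space_def \<gamma>_def intro!: exI[of _ \<gamma>] exI[of _ d])
qed

lemma tangent_space_reaperD:
  assumes X: "X \<in> tangent_space reaper (x, t)"
  shows "mink x (fst X) = 0" "snd X = slope x (fst X)"
proof -
  obtain \<gamma> d where g: "0 < d" "\<gamma> ` {-d<..<d} \<subseteq> reaper" "\<gamma> 0 = (x, t)" "(\<gamma> has_vector_derivative X) (at (0::real))"
    using X by (auto simp: tangent_space_def)
  have S: "\<gamma> r \<in> reaper" if "r \<in> {-d<..<d}" for r using g(2) that by auto
  have xs: "x \<in> hyp_space" "signed_dist e x \<in> {s1<..<s2}" using S[of 0] g(1,3) by (auto simp: reaper_iff)
  have D: "(\<gamma> has_derivative (\<lambda>r. r *\<^sub>R X)) (at 0)" using g(4) by (simp add: has_vector_derivative_def)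
  have d1: "((\<lambda>r. fst (\<gamma> r)) has_derivative (\<lambda>r. r *\<^sub>R fst X)) (at 0)"
    and d2: "((\<lambda>r. snd (\<gamma> r)) has_derivative (\<lambda>r. r *\<^sub>R snd X)) (at 0)"
    using has_derivative_fst[OF D] has_derivative_snd[OF D] by simp_all
  have "((\<lambda>r. mink (fst (\<gamma> r)) (fst (\<gamma> r))) has_real_derivative 2 * mink x (fst X)) (at 0)"
    using has_vector_derivative_mink_self[of "\<lambda>r. fst (\<gamma> r)" "fst X" 0] d1 g(3) by (simp add: has_vector_derivative_def)
  moreover have "((\<lambda>r. mink (fst (\<gamma> r)) (fst (\<gamma> r))) has_real_derivative 0) (at 0)"
  proof (rule has_field_derivative_transform_within_open[OF DERIV_const[of "-1"]])
    show "open {-d<..<d}" "0 \<in> {-d<..<d}" using g(1) by auto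
    fix r assume "r \<in> {-d<..<d}"
    from S[OF this] show "- 1 = mink (fst (\<gamma> r)) (fst (\<gamma> r))" by (auto elim!: reaperE simp: hyp_space_self)
  qed
  ultimately show "mink x (fst X) = 0" using DERIV_unique by fastforce
  have "((\<lambda>r. \<phi> (signed_dist e (fst (\<gamma> r)))) has_derivative (\<lambda>r. slope x (r *\<^sub>R fst X))) (at 0)"
    using height_has_derivative[OF d1] xs(2) g(3) by simp
  then have "((\<lambda>r. snd (\<gamma> r)) has_derivative (\<lambda>r. slope x (r *\<^sub>R fst X))) (at 0)"
  proof (rule has_derivative_transform_within_open)
    show "open {-d<..<d}" "0 \<in> {-d<..<d}" using g(1) by auto
    fix r assume "r \<in> {-d<..<d}"
    from S[OF this] show "\<phi> (signed_dist e (fst (\<gamma> r))) = snd (\<gamma> r)" by (auto elim!: reaperE)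
  qed
  from has_derivative_unique[OF d2 this] have "1 *\<^sub>R snd X = slope x (1 *\<^sub>R fst X)" by metis
  then show "snd X = slope x (fst X)" by simp
qed

subsection \<open>The upward unit normal\<close>

definition normal :: "('a \<times> real) \<times> real \<Rightarrow> ('a \<times> real) \<times> real" where
  "normal z = (- sin (\<theta> (signed_dist e (fst z))) *\<^sub>R level_normal e (fst z), cos (\<theta> (signed_dist e (fst z))))"

lemma unit_normal_reaper: "unit_normal reaper normal"
  unfolding unit_normal_def
proof (intro conjI ballI)
  show "continuous_on reaper normal"
    unfolding normal_def level_normal_def by (intro continuous_intros angle_continuous) (auto simp: reaper_iff)
  fix p assume "p \<in> reaper"
  then obtain x where p: "p = (x, \<phi> (signed_dist e x))" and x: "x \<in> hyp_space" "signed_dist e x \<in> {s1<..<s2}"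
    by (rule reaperE)
  define t where "t = \<theta> (signed_dist e x)"
  have N: "normal p = (- sin t *\<^sub>R level_normal e x, cos t)" by (simp add: normal_def p t_def)
  note ln = level_normal_unit[OF e x(1)]
  show "normal p \<in> tangent_prod p" by (simp add: tangent_prod_def N[unfolded p] p mink_simps ln)
  show "pmetric (normal p) (normal p) = 1"
    by (simp add: N pmetric_def mink_simps ln flip: power2_eq_square)
  fix X assume "X \<in> tangent_space reaper p"
  note X = tangent_space_reaperD[OF this[unfolded p]]
  have "mink (level_normal e x) (fst X) = mink (fst X) e / cosh (signed_dist e x)"
    using X(1) mink_commute[of e "fst X"] by (simp add: level_normal_def mink_simps)
  moreover have "cos t \<noteq> 0" using cos_angle_pos[OF x(2)] by (simp add: t_def)
  ultimately show "pmetric (normal p) X = 0"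
    by (simp add: N pmetric_def mink_simps X(2) slope_def tan_def flip: t_def)
qed

subsection \<open>Curvature\<close>

lemma normal_has_derivative:
  assumes s: "signed_dist e x = s" "s \<in> {s1<..<s2} - {l}"
  defines "d \<equiv> 1 / (sin (\<theta> s) * tanh s) ^ (DIM('a) - 1)"
  shows "(normal has_derivative (\<lambda>h.
      (- ((cos (\<theta> s) * d * cosh s - sin (\<theta> s) * sinh s) / (cosh s)\<^sup>2 * (mink (fst h) e / cosh s)) *\<^sub>R (e + mink x e *\<^sub>R x)
       - (sin (\<theta> s) / cosh s) *\<^sub>R (mink (fst h) e *\<^sub>R x + mink x e *\<^sub>R fst h),
       - (sin (\<theta> s) * d * (mink (fst h) e / cosh s))))) (at (x, t))"
proof -
  define q where "q r = sin (\<theta> r) / cosh r" for r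
  have \<theta>': "(\<theta> has_real_derivative d) (at s)" unfolding d_def by (rule angle_deriv[OF s(2)])
  have q': "(q has_real_derivative (cos (\<theta> s) * d * cosh s - sin (\<theta> s) * sinh s) / (cosh s)\<^sup>2) (at (signed_dist e (fst (x, t))))"
    unfolding q_def
    by (rule derivative_eq_intros \<theta>' refl | simp add: s)+ (simp add: power2_eq_square)
  have c': "((\<lambda>r. cos (\<theta> r)) has_real_derivative - sin (\<theta> s) * d) (at (signed_dist e (fst (x, t))))"
    by (rule derivative_eq_intros \<theta>' refl | simp add: s)+
  have fst': "(fst has_derivative (\<lambda>h. fst h)) (at (x, t))" by (auto intro!: derivative_eq_intros)
  note sd = signed_dist_derivative[OF fst', of e]
  note qd = has_derivative_compose[OF sd q'[unfolded has_field_derivative_def]]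
  note cd = has_derivative_compose[OF sd c'[unfolded has_field_derivative_def]]
  have vd: "((\<lambda>z. e + mink (fst z) e *\<^sub>R fst z) has_derivative (\<lambda>h. mink x e *\<^sub>R fst h + mink (fst h) e *\<^sub>R x)) (at (x, t))"
    by (rule derivative_eq_intros fst' refl)+ simp
  have "((\<lambda>z. - (q (signed_dist e (fst z)) *\<^sub>R (e + mink (fst z) e *\<^sub>R fst z))) has_derivative
    (\<lambda>h. - ((cos (\<theta> s) * d * cosh s - sin (\<theta> s) * sinh s) / (cosh s)\<^sup>2 * (mink (fst h) e / cosh s)) *\<^sub>R (e + mink x e *\<^sub>R x)
       - (sin (\<theta> s) / cosh s) *\<^sub>R (mink (fst h) e *\<^sub>R x + mink x e *\<^sub>R fst h))) (at (x, t))"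
    by (rule has_derivative_eq_rhs[OF has_derivative_minus[OF has_derivative_scaleR[OF qd vd]]])
      (simp add: fun_eq_iff s q_def algebra_simps)
  from has_derivative_Pair[OF this cd] show ?thesis
    by (simp add: normal_def[abs_def] level_normal_def q_def s mult.assoc)
qed

text \<open>
  The \<open>n - 1\<close> directions tangent to the equidistant hypersurface are principal, with curvature
  \<open>sin \<theta> * tanh s\<close>: the equidistant hypersurface itself is umbilical with curvature \<open>tanh s\<close>. The profile
  direction is principal with curvature \<open>cos \<theta> * d\<theta>/ds\<close>. By the equation for \<open>\<theta>\<close> the product is
  \<open>cos \<theta>\<close>, which is the angle function.
\<close>

lemma gauss_curvature_reaper:
  assumes p: "p \<in> reaper" and pl: "signed_dist e (fst p) \<noteq> l"
  shows "has_gauss_curvature reaper normal p (angle_function normal p)"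
proof -
  obtain x where px: "p = (x, \<phi> (signed_dist e x))" and x: "x \<in> hyp_space" "signed_dist e x \<in> {s1<..<s2}"
    using p by (rule reaperE)
  define s where "s = signed_dist e x"
  have s: "signed_dist e x = s" "s \<in> {s1<..<s2} - {l}" using x pl by (auto simp: s_def px)
  define d a v where "d = 1 / (sin (\<theta> s) * tanh s) ^ (DIM('a) - 1)" and "a = mink x e" and "v = level_normal e x"
  have a: "a = sinh s" by (simp add: a_def s_def)
  have c: "cosh s \<noteq> 0" by simp
  have cs: "cosh s * cosh s = 1 + a * a" using cosh_square_eq[of s] by (simp add: a power2_eq_square)
  have v: "mink v v = 1" "mink x v = 0" "mink v x = 0" "mink v e = cosh s"
    using level_normal_unit[OF e x(1)] mink_commute[of x v] by (simp_all add: v_def s)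
  have eax: "e + a *\<^sub>R x = cosh s *\<^sub>R v" by (simp add: v_def level_normal_def a_def s)
  have xx: "mink x x = -1" by (rule hyp_space_self[OF x(1)])
  define D where "D = (\<lambda>h :: ('a \<times> real) \<times> real.
      (- ((cos (\<theta> s) * d * cosh s - sin (\<theta> s) * sinh s) / (cosh s)\<^sup>2 * (mink (fst h) e / cosh s)) *\<^sub>R (e + a *\<^sub>R x)
       - (sin (\<theta> s) / cosh s) *\<^sub>R (mink (fst h) e *\<^sub>R x + a *\<^sub>R fst h),
       - (sin (\<theta> s) * d * (mink (fst h) e / cosh s))))"
  have DN: "(normal has_derivative D) (at p within reaper)"
    unfolding D_def d_def a_def px by (rule has_derivative_at_withinI[OF normal_has_derivative[OF s]])
  have shape: "shape_operator reaper normal p X = - tangent_proj p (D X)" if "X \<in> tangent_space reaper p" for X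
    unfolding shape_operator_def cov_deriv_def frechet_derivative_within_tangent[OF DN that] ..
  obtain F :: "nat \<Rightarrow> 'a \<times> real" and i0 where F: "i0 < DIM('a)" "F i0 = v"
    "\<And>i. i < DIM('a) \<Longrightarrow> mink x (F i) = 0"
    "\<And>i j. i < DIM('a) \<Longrightarrow> j < DIM('a) \<Longrightarrow> mink (F i) (F j) = (if i = j then 1 else 0)"
    using adapted_orthonormal_frame[OF x(1) v(1,2)] by metis
  define E where "E i = (if i = i0 then (cos (\<theta> s) *\<^sub>R v, sin (\<theta> s)) else (F i, 0))" for i
  define k where "k i = (if i = i0 then cos (\<theta> s) * d else sin (\<theta> s) * tanh s)" for i
  have Fe: "mink (F i) e = 0" if "i < DIM('a)" "i \<noteq> i0" for i
  proof -
    have "0 = mink (F i) (cosh s *\<^sub>R v)" using F(4)[OF that(1) F(1)] that(2) by (simp add: F(2) mink_scaleR_right)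
    also have "\<dots> = mink (F i) e"
      unfolding eax[symmetric] using F(3)[OF that(1)] by (simp add: mink_simps mink_commute[of "F i" x])
    finally show ?thesis by simp
  qed
  have Fv: "mink (F i) v = 0" "mink v (F i) = 0" if "i < DIM('a)" "i \<noteq> i0" for i
    using F(4)[OF that(1) F(1)] that(2) by (simp_all add: F(2) mink_commute[of v])
  have ct: "cos (\<theta> s) \<noteq> 0" using cos_angle_pos[of s] s by auto
  have tan: "E i \<in> tangent_space reaper p" if "i < DIM('a)" for i
  proof -
    have "mink x (fst (E i)) = 0" using F(3)[OF that] v by (simp add: E_def mink_simps)
    from tangent_curve[OF x this] have "(fst (E i), slope x (fst (E i))) \<in> tangent_space reaper p"
      by (simp add: px)
    moreover have "slope x (fst (E i)) = snd (E i)"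
      using Fe[OF that] ct by (simp add: E_def slope_def s mink_simps v tan_def)
    ultimately show ?thesis by simp
  qed
  have orth: "pmetric (E i) (E j) = (if i = j then 1 else 0)" if "i < DIM('a)" "j < DIM('a)" for i j
    using F(4)[OF that] Fv[OF that(1)] Fv[OF that(2)] v(1)
    by (auto simp: E_def pmetric_def mink_simps simp flip: power2_eq_square)
  have eig: "shape_operator reaper normal p (E i) = k i *\<^sub>R E i" if i: "i < DIM('a)" for i
  proof (cases "i = i0")
    case False
    have "D (E i) = (- (sin (\<theta> s) * tanh s) *\<^sub>R F i, 0)"
      using False Fe[OF i False] by (simp add: D_def E_def a tanh_def)
    moreover have "mink (F i) x = 0" using F(3)[OF i] mink_commute[of x] by metis
    ultimately show ?thesis
      unfolding shape[OF tan[OF i]] using False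
      by (simp add: tangent_proj_def px mink_simps E_def k_def)
  next
    case True
    have "D (E i) = (- (cos (\<theta> s) * (cos (\<theta> s) * d)) *\<^sub>R v - (sin (\<theta> s) * cos (\<theta> s)) *\<^sub>R x,
        - (sin (\<theta> s) * (cos (\<theta> s) * d)))"
    proof -
      have 1: "(cos (\<theta> s) * d * cosh s - sin (\<theta> s) * sinh s) / (cosh s)\<^sup>2 * (cos (\<theta> s) * cosh s / cosh s) * cosh s
        = cos (\<theta> s) * (cos (\<theta> s) * d) - sin (\<theta> s) / cosh s * a * cos (\<theta> s)"
        using c by (simp add: a field_simps power2_eq_square)
      have 2: "sin (\<theta> s) / cosh s * (cos (\<theta> s) * cosh s) = sin (\<theta> s) * cos (\<theta> s)" using c by simp
      have "fst (D (E i)) = - ((cos (\<theta> s) * d * cosh s - sin (\<theta> s) * sinh s) / (cosh s)\<^sup>2 * (cos (\<theta> s) * cosh s / cosh s) * cosh s) *\<^sub>R v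
          - (sin (\<theta> s) / cosh s * (cos (\<theta> s) * cosh s)) *\<^sub>R x - (sin (\<theta> s) / cosh s * a * cos (\<theta> s)) *\<^sub>R v"
        unfolding D_def fst_conv eax by (simp add: True E_def mink_simps v scaleR_add_right)
      also have "\<dots> = - (cos (\<theta> s) * (cos (\<theta> s) * d)) *\<^sub>R v - (sin (\<theta> s) * cos (\<theta> s)) *\<^sub>R x"
        unfolding 1 2 by (simp add: algebra_simps)
      finally have "fst (D (E i)) = - (cos (\<theta> s) * (cos (\<theta> s) * d)) *\<^sub>R v - (sin (\<theta> s) * cos (\<theta> s)) *\<^sub>R x" .
      moreover have "snd (D (E i)) = - (sin (\<theta> s) * (cos (\<theta> s) * d))"
        using c by (simp add: D_def True E_def mink_simps v)
      ultimately show ?thesis by (simp add: prod_eq_iff)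
    qed
    then show ?thesis
      unfolding shape[OF tan[OF i]] using True
      by (simp add: tangent_proj_def px mink_simps E_def k_def v xx algebra_simps)
  qed
  have nd: "normal differentiable (at p within reaper)" using DN by (auto simp: differentiable_def)
  have "(\<Prod>i<DIM('a). k i) = k i0 * (\<Prod>i\<in>{..<DIM('a)} - {i0}. k i)"
    using F(1) by (intro prod.remove) auto
  also have "(\<Prod>i\<in>{..<DIM('a)} - {i0}. k i) = (\<Prod>i\<in>{..<DIM('a)} - {i0}. sin (\<theta> s) * tanh s)"
    by (intro prod.cong) (auto simp: k_def)
  also have "\<dots> = (sin (\<theta> s) * tanh s) ^ (DIM('a) - 1)" using F(1) by (simp add: card_Diff_singleton)
  also have "k i0 * \<dots> = cos (\<theta> s)"
  proof -
    have "\<bar>\<theta> s\<bar> < pi" using angle_range[of s] s by auto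
    then have "sin (\<theta> s) * tanh s \<noteq> 0" using angle_nonzero[OF s(2)] s s12 by (auto simp: sin_zero_pi_iff)
    then show ?thesis by (simp add: k_def d_def)
  qed
  also have "cos (\<theta> s) = angle_function normal p"
    by (simp add: angle_function_def pmetric_def vertical_field_def normal_def px s)
  finally have "angle_function normal p = (\<Prod>i<DIM('a). k i)" by simp
  with tan orth eig nd show ?thesis
    unfolding has_gauss_curvature_def principal_curvatures_def by blast
qed

subsection \<open>Charts\<close>

text \<open>
  Composing the graph over the horizontal factor with the reflection of
  \<open>lorentz_reflection_to_horizontal\<close> gives one chart for the whole surface. Its domain is a slab and the
  equidistant hypersurfaces are its affine hyperplanes; hence the surface is homeomorphic to Euclidean
  space and each level set is negligible.
\<close>

lemma global_chart:
  obtains w :: 'a and \<psi> \<eta> where "norm w = 1" "homeomorphism {y. y \<bullet> w \<in> {sinh s1<..<sinh s2}} reaper \<psi> \<eta>"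
    "C1_on \<psi> {y. y \<bullet> w \<in> {sinh s1<..<sinh s2}}"
    "\<And>y. y \<bullet> w \<in> {sinh s1<..<sinh s2} \<Longrightarrow> inj (frechet_derivative \<psi> (at y))"
    "\<And>y. signed_dist e (fst (\<psi> y)) = arsinh (y \<bullet> w)"
proof -
  obtain w and R :: "'a \<times> real \<Rightarrow> 'a \<times> real" where w: "norm w = 1" and R: "linear R"
    "\<And>x. R (R x) = x" "\<And>x. mink (R x) e = fst x \<bullet> w" "\<And>x. x \<in> hyp_space \<Longrightarrow> R x \<in> hyp_space"
    using lorentz_reflection_to_horizontal[OF e] by metis
  have bl: "bounded_linear R" using R(1) by (simp add: linear_conv_bounded_linear)
  define U where "U = {y :: 'a. y \<bullet> w \<in> {sinh s1<..<sinh s2}}"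
  define f where "f y = R (y, sqrt (1 + (norm y)\<^sup>2))" for y :: 'a
  define \<psi> where "\<psi> y = (f y, \<phi> (signed_dist e (f y)))" for y :: 'a
  define \<eta> where "\<eta> q = fst (R (fst q))" for q :: "('a \<times> real) \<times> real"
  have fH: "f y \<in> hyp_space" for y unfolding f_def by (intro R(4) hyp_space_lift)
  have fs: "signed_dist e (f y) = arsinh (y \<bullet> w)" for y by (simp add: signed_dist_def f_def R(3))
  have ar: "arsinh r \<in> {s1<..<s2} \<longleftrightarrow> r \<in> {sinh s1<..<sinh s2}" for r :: real
    using arsinh_less_iff_real[of "sinh s1" r] arsinh_less_iff_real[of r "sinh s2"] by (simp add: arsinh_sinh_real)
  have fU: "signed_dist e (f y) \<in> {s1<..<s2}" if "y \<in> U" for y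
    using that unfolding fs ar U_def by simp
  have pos: "1 + y \<bullet> y > 0" for y :: 'a by (simp add: add_pos_nonneg)
  define f' where "f' y h = R (h, (y \<bullet> h) / sqrt (1 + (norm y)\<^sup>2))" for y h :: 'a
  have fd: "(f has_derivative f' y) (at y)" for y
  proof -
    have "((\<lambda>y. 1 + y \<bullet> y) has_derivative (\<lambda>h. 2 * (y \<bullet> h))) (at y)"
      by (rule derivative_eq_intros refl)+ (simp add: inner_commute fun_eq_iff)
    from has_derivative_real_sqrt[OF pos this]
    have "((\<lambda>y. sqrt (1 + (norm y)\<^sup>2)) has_derivative (\<lambda>h. (y \<bullet> h) / sqrt (1 + (norm y)\<^sup>2))) (at y)"
      by (simp add: dot_square_norm field_simps)
    from bounded_linear.has_derivative[OF bl has_derivative_Pair[OF has_derivative_ident this]]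
    show ?thesis by (simp add: f_def[abs_def] f'_def[abs_def])
  qed
  have \<psi>d: "(\<psi> has_derivative (\<lambda>h. (f' y h, slope (f y) (f' y h)))) (at y)" if "y \<in> U" for y
    unfolding \<psi>_def by (intro has_derivative_Pair fd height_has_derivative fU that)
  have fc: "continuous_on A f" for A
    using fd has_derivative_continuous by (blast intro: continuous_at_imp_continuous_on)
  show thesis
  proof (rule that[OF w, of \<psi> \<eta>])
    show "C1_on \<psi> {y. y \<bullet> w \<in> {sinh s1<..<sinh s2}}"
      unfolding U_def[symmetric]
    proof (rule C1_onI[OF \<psi>d])
      fix h
      have "continuous_on U (\<lambda>y. (h, (y \<bullet> h) / sqrt (1 + (norm y)\<^sup>2)))"
        using pos by (intro continuous_intros) (auto simp: dot_square_norm add_nonneg_eq_0_iff)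
      from continuous_on_compose2[OF linear_continuous_on[OF bl, of UNIV] this]
      have "continuous_on U (\<lambda>y. f' y h)" by (simp add: f'_def)
      then show "continuous_on U (\<lambda>y. (f' y h, slope (f y) (f' y h)))"
        using fU by (intro continuous_on_Pair slope_continuous fc)
    qed
    show "inj (frechet_derivative \<psi> (at y))" if "y \<bullet> w \<in> {sinh s1<..<sinh s2}" for y
    proof -
      have "y \<in> U" using that by (simp add: U_def)
      have "h = h'" if "f' y h = f' y h'" for h h'
        using arg_cong[OF that, of R] by (simp add: f'_def R(2))
      then show ?thesis
        unfolding frechet_derivative_at[OF \<psi>d[OF \<open>y \<in> U\<close>], symmetric] by (auto intro!: injI)
    qed
    show "signed_dist e (fst (\<psi> y)) = arsinh (y \<bullet> w)" for y by (simp add: \<psi>_def fs)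
    have \<eta>\<psi>: "\<eta> (\<psi> y) = y" for y by (simp add: \<eta>_def \<psi>_def f_def R(2))
    have \<psi>\<eta>: "\<psi> (\<eta> p) = p \<and> \<eta> p \<in> U" if p: "p \<in> reaper" for p
    proof -
      obtain x where px: "p = (x, \<phi> (signed_dist e x))" and x: "x \<in> hyp_space" "signed_dist e x \<in> {s1<..<s2}"
        using p by (rule reaperE)
      have "f (\<eta> p) = x" using hyp_space_eq_lift[OF R(4)[OF x(1)]] by (simp add: f_def \<eta>_def px R(2))
      moreover from this have "\<eta> p \<in> U" using x(2) fs[of "\<eta> p"] ar[of "\<eta> p \<bullet> w"] by (simp add: U_def)
      ultimately show ?thesis by (simp add: \<psi>_def px)
    qed
    show "homeomorphism {y. y \<bullet> w \<in> {sinh s1<..<sinh s2}} reaper \<psi> \<eta>"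
      unfolding U_def[symmetric]
    proof (rule homeomorphismI)
      show "continuous_on U \<psi>" using \<psi>d has_derivative_continuous by (blast intro: continuous_at_imp_continuous_on)
      show "continuous_on reaper \<eta>"
        unfolding \<eta>_def by (intro continuous_intros continuous_on_compose2[OF linear_continuous_on[OF bl, of UNIV]]) auto
      show "\<psi> ` U \<subseteq> reaper" using fH fU by (auto simp: \<psi>_def reaper_iff)
    qed (use \<eta>\<psi> \<psi>\<eta> in auto)
  qed
qed

lemma hypersurface_reaper: "hypersurface reaper"
  unfolding hypersurface_def
proof (intro conjI ballI)
  define s where "s = (s1 + s2) / 2"
  have "s \<in> {s1<..<s2}" using s12 by (simp add: s_def)
  moreover obtain x where "x \<in> equidistant e s" using equidistant_nonempty[OF e] by blast
  ultimately have "(x, \<phi> s) \<in> reaper" by (auto simp: reaper_iff equidistant_signed_dist[OF e])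
  then show "reaper \<noteq> {}" by blast
  show "reaper \<subseteq> hyp_prod" by (auto simp: reaper_iff hyp_prod_def)
  show "hypersurface_at C1_on reaper p" if "p \<in> reaper" for p using that by (rule hypersurface_at_C1)
  show "null_in reaper (C2_singular_set reaper)"
    unfolding null_in_def
  proof
    fix p assume p: "p \<in> reaper"
    obtain w :: 'a and \<psi> \<eta> where ch: "norm w = 1" "homeomorphism {y. y \<bullet> w \<in> {sinh s1<..<sinh s2}} reaper \<psi> \<eta>"
      "C1_on \<psi> {y. y \<bullet> w \<in> {sinh s1<..<sinh s2}}"
      "\<And>y. y \<bullet> w \<in> {sinh s1<..<sinh s2} \<Longrightarrow> inj (frechet_derivative \<psi> (at y))"
      "\<And>y. signed_dist e (fst (\<psi> y)) = arsinh (y \<bullet> w)"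
      using global_chart by metis
    let ?U = "{y :: 'a. y \<bullet> w \<in> {sinh s1<..<sinh s2}}"
    have im: "\<psi> ` ?U = reaper" using ch(2) by (rule homeomorphism_image1)
    have "open ?U"
    proof -
      have "open ((\<lambda>y. y \<bullet> w) -` {sinh s1<..<sinh s2})"
        by (intro open_vimage open_greaterThanLessThan continuous_intros)
      then show ?thesis by (simp add: vimage_def)
    qed
    moreover have "negligible {u \<in> ?U. \<psi> u \<in> C2_singular_set reaper}"
    proof (rule negligible_subset)
      show "negligible {y. w \<bullet> y = sinh l}" using ch(1) by (intro negligible_hyperplane) auto
      show "{u \<in> ?U. \<psi> u \<in> C2_singular_set reaper} \<subseteq> {y. w \<bullet> y = sinh l}"
      proof clarify
        fix u assume "\<psi> u \<in> C2_singular_set reaper"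
        then have "arsinh (u \<bullet> w) = l" using C2_singular_set_reaper ch(5)[of u] by auto
        then show "w \<bullet> u = sinh l" by (metis inner_commute sinh_arsinh_real)
      qed
    qed
    ultimately show "\<exists>(U :: 'a set) \<psi> \<phi>. open U \<and> C1_on \<psi> U \<and> (\<forall>u\<in>U. inj (frechet_derivative \<psi> (at u))) \<and>
        homeomorphism U (\<psi> ` U) \<psi> \<phi> \<and> openin (top_of_set reaper) (\<psi> ` U) \<and> p \<in> \<psi> ` U \<and>
        negligible {u \<in> U. \<psi> u \<in> C2_singular_set reaper}"
      using ch im p by (intro exI[of _ ?U] exI[of _ \<psi>] exI[of _ \<eta>]) auto
  qed
qed

text \<open>
  Stretching the bounded coordinate of the slab to the whole line makes it Euclidean space.
\<close>

lemma reaper_homeomorphic_UNIV: "reaper homeomorphic (UNIV :: 'a set)"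
proof -
  obtain w :: 'a and \<psi> \<eta> where w: "norm w = 1" and ch: "homeomorphism {y. y \<bullet> w \<in> {sinh s1<..<sinh s2}} reaper \<psi> \<eta>"
    using global_chart by metis
  have ww: "w \<bullet> w = 1" using w by (simp add: norm_eq_1)
  let ?I = "{sinh s1<..<sinh s2}"
  have "?I homeomorphic (UNIV :: real set)" using s12 by (intro homeomorphic_open_interval_UNIV) auto
  then obtain f g where fg: "homeomorphism ?I (UNIV :: real set) f g" by (auto simp: homeomorphic_def)
  define F G where "F y = y + (f (y \<bullet> w) - y \<bullet> w) *\<^sub>R w" and "G y = y + (g (y \<bullet> w) - y \<bullet> w) *\<^sub>R w" for y
  have Fw: "F y \<bullet> w = f (y \<bullet> w)" "G y \<bullet> w = g (y \<bullet> w)" for y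
    by (simp_all add: F_def G_def inner_add_left ww)
  have "homeomorphism {y. y \<bullet> w \<in> ?I} UNIV F G"
  proof (rule homeomorphismI)
    have "continuous_on {y. y \<bullet> w \<in> ?I} (\<lambda>y. f (y \<bullet> w))"
      by (rule continuous_on_compose2[OF homeomorphism_cont1[OF fg]]) (auto intro!: continuous_intros)
    then show "continuous_on {y. y \<bullet> w \<in> ?I} F"
      unfolding F_def by (intro continuous_intros)
    have "continuous_on UNIV (\<lambda>y. g (y \<bullet> w))"
      by (rule continuous_on_compose2[OF homeomorphism_cont2[OF fg]]) (auto intro!: continuous_intros)
    then show "continuous_on UNIV G"
      unfolding G_def by (intro continuous_intros)
    have gI: "g r \<in> ?I" for r using homeomorphism_image2[OF fg] by blast
    show "G ` UNIV \<subseteq> {y. y \<bullet> w \<in> ?I}" using gI Fw by auto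
    show "G (F y) = y" if "y \<in> {y. y \<bullet> w \<in> ?I}" for y
      unfolding G_def[of "F y"] Fw using homeomorphism_apply1[OF fg, of "y \<bullet> w"] that by (simp add: F_def algebra_simps)
    show "F (G y) = y" for y
      unfolding F_def[of "G y"] Fw using homeomorphism_apply2[OF fg, of "y \<bullet> w"] by (simp add: G_def algebra_simps)
  qed auto
  then have "{y. y \<bullet> w \<in> ?I} homeomorphic (UNIV :: 'a set)" by (auto simp: homeomorphic_def)
  moreover have "reaper homeomorphic {y. y \<bullet> w \<in> ?I}"
    using ch homeomorphic_def homeomorphic_sym by blast
  ultimately show ?thesis using homeomorphic_trans by blast
qed

subsection \<open>The singular set\<close>

lemma deriv_along_tangent_zero:
  assumes F: "(F has_derivative F') (at p)" and U: "open U" "p \<in> U"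
    and S: "reaper \<inter> U = {q \<in> hyp_prod \<inter> U. F q = 0}" and X: "X \<in> tangent_space reaper p"
  shows "F' X = (0 :: real)"
proof -
  obtain \<gamma> d where g: "0 < d" "\<gamma> ` {-d<..<d} \<subseteq> reaper" "\<gamma> 0 = p" "(\<gamma> has_vector_derivative X) (at (0::real))"
    using X by (auto simp: tangent_space_def)
  have "isCont \<gamma> 0" using g(4) by (rule has_vector_derivative_continuous)
  then have "(\<gamma> \<longlongrightarrow> p) (at 0)" by (simp add: isCont_def g(3))
  then have "\<forall>\<^sub>F r in at 0. \<gamma> r \<in> U" using U by (rule topological_tendstoD)
  moreover have "\<forall>\<^sub>F r in at 0. r \<in> {-d<..<d}"
    using g(1) by (intro eventually_at_in_open') auto
  ultimately have ev: "\<forall>\<^sub>F r in at 0. F (\<gamma> r) = 0"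
  proof eventually_elim
    case (elim r)
    then have "\<gamma> r \<in> reaper \<inter> U" using g(2) by auto
    then show ?case unfolding S by simp
  qed
  have p0: "F (\<gamma> 0) = 0"
  proof -
    have "\<gamma> 0 \<in> reaper \<inter> U" using g U by auto
    then show ?thesis unfolding S by simp
  qed
  have F0: "(F has_derivative F') (at (\<gamma> 0))" using F g(3) by simp
  have 1: "((\<lambda>r. F (\<gamma> r)) has_derivative (\<lambda>r. F' (r *\<^sub>R X))) (at 0)"
    using has_derivative_compose[OF g(4)[unfolded has_vector_derivative_def] F0] .
  have "((\<lambda>r. 0) has_derivative (\<lambda>r. F' (r *\<^sub>R X))) (at 0)"
    by (rule has_derivative_transform_eventually[OF 1 ev p0]) simp
  from has_derivative_unique[OF this has_derivative_const] have "F' (1 *\<^sub>R X) = 0" by metis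
  then show ?thesis by simp
qed

text \<open>
  If the surface were a \<open>C\<^sup>2\<close> level set of \<open>F\<close> near \<open>p\<close>, then \<open>F\<close> would have nonzero vertical derivative at
  \<open>p\<close>, as its derivative vanishes on the tangent space. Differentiating \<open>F = 0\<close> along the profile curve
  \<open>\<gamma>\<close> writes \<open>tan \<theta>\<close> as a quotient of functions built from the derivative of \<open>F\<close>, hence
  differentiable at \<open>l\<close>; so \<open>\<theta>\<close> would be differentiable at \<open>l\<close>.
\<close>

lemma not_C2_at_singular:
  assumes p: "p \<in> reaper" and pl: "signed_dist e (fst p) = l"
  shows "\<not> hypersurface_at C2_on reaper p"
proof
  assume "hypersurface_at C2_on reaper p"
  then obtain U and F :: "('a \<times> real) \<times> real \<Rightarrow> real" and v where U: "open U" "p \<in> U" and C2: "C2_on F U"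
    and S: "reaper \<inter> U = {q \<in> hyp_prod \<inter> U. F q = 0}"
    and v: "v \<in> tangent_prod p" "frechet_derivative F (at p) v \<noteq> 0"
    unfolding hypersurface_at_def by blast
  obtain x where px: "p = (x, \<phi> (signed_dist e x))" and x: "x \<in> hyp_space" "signed_dist e x \<in> {s1<..<s2}"
    using p by (rule reaperE)
  have xl: "signed_dist e x = l" using pl px by simp
  have l: "l \<in> {s1<..<s2}" using x(2) xl by simp
  obtain F' where F': "\<And>z. z \<in> U \<Longrightarrow> (F has_derivative blinfun_apply (F' z)) (at z)" and "C1_on F' U"
    using C2 by (auto simp: C2_on_def)
  then obtain F'' where F'': "(F' has_derivative F'') (at p)" using U(2) unfolding C1_on_def by blast
  have Fv: "F' p v \<noteq> 0" using v(2) frechet_derivative_at[OF F'[OF U(2)]] by simp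
  \<comment> \<open>tangent vectors and the vertical direction span, and the former are in the kernel of \<open>F' p\<close>\<close>
  have vert: "F' p (0, 1) \<noteq> 0"
  proof
    assume 0: "F' p (0, 1) = 0"
    have "mink x (fst v) = 0" using v(1) by (simp add: tangent_prod_def px)
    from tangent_curve[OF x this]
    have "F' p (fst v, slope x (fst v)) = 0"
      using deriv_along_tangent_zero[OF F'[OF U(2)] U S] by (simp add: px)
    moreover have "v = (fst v, slope x (fst v)) + (snd v - slope x (fst v)) *\<^sub>R (0, 1)" by (simp add: prod_eq_iff)
    then have "F' p v = F' p (fst v, slope x (fst v)) + (snd v - slope x (fst v)) * F' p (0, 1)"
      by (metis blinfun.add_right blinfun.scaleR_right real_scaleR_def)
    ultimately show False using 0 Fv by simp
  qed
  define \<nu> where "\<nu> = level_normal e x"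
  define g where "g r = cosh (r - l) *\<^sub>R x + sinh (r - l) *\<^sub>R \<nu>" for r
  define g' where "g' r = sinh (r - l) *\<^sub>R x + cosh (r - l) *\<^sub>R \<nu>" for r
  define \<gamma> where "\<gamma> r = (g r, \<phi> r)" for r
  have gH: "g r \<in> hyp_space" "signed_dist e (g r) = r" for r
    using normal_flow(1,2)[OF e x(1), of r] by (simp_all add: normal_flow_def[OF e] g_def \<nu>_def xl)
  have hyp: "((\<lambda>r. cosh (r - l) *\<^sub>R a + sinh (r - l) *\<^sub>R b) has_vector_derivative
      sinh (r - l) *\<^sub>R a + cosh (r - l) *\<^sub>R b) (at r)" for a b :: "'a \<times> real" and r
  proof -
    have "((\<lambda>r. cosh (r - l)) has_real_derivative sinh (r - l)) (at r)"
      "((\<lambda>r. sinh (r - l)) has_real_derivative cosh (r - l)) (at r)"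
      by (auto intro!: derivative_eq_intros)
    then show ?thesis
      using has_vector_derivative_add[OF has_vector_derivative_scaleR[OF _ has_vector_derivative_const]
          has_vector_derivative_scaleR[OF _ has_vector_derivative_const]] by fastforce
  qed
  have gd: "(g has_vector_derivative g' r) (at r)" for r
    unfolding g_def g'_def by (rule hyp)
  have \<gamma>d: "(\<gamma> has_vector_derivative (g' r, tan (\<theta> r))) (at r)" if "r \<in> {s1<..<s2}" for r
    unfolding \<gamma>_def using gd height_deriv[OF that]
    by (intro has_vector_derivative_Pair) (auto simp: has_real_derivative_iff_has_vector_derivative)
  have \<gamma>l: "\<gamma> l = p" by (simp add: \<gamma>_def g_def px xl)
  have "isCont \<gamma> l" using \<gamma>d[OF l] by (rule has_vector_derivative_continuous)
  then have "(\<gamma> \<longlongrightarrow> p) (at l)" by (simp add: isCont_def \<gamma>l)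
  then have "\<forall>\<^sub>F r in at l. \<gamma> r \<in> U" using U by (rule topological_tendstoD)
  then obtain d0 where d0: "0 < d0" "\<And>r. r \<noteq> l \<Longrightarrow> dist r l < d0 \<Longrightarrow> \<gamma> r \<in> U"
    unfolding eventually_at by auto
  define V where "V = ball l d0 \<inter> {s1<..<s2}"
  have V: "open V" "l \<in> V" using d0(1) l by (auto simp: V_def)
  have VU: "\<gamma> r \<in> U" "r \<in> {s1<..<s2}" if "r \<in> V" for r
    using that d0(2)[of r] U(2) \<gamma>l by (cases "r = l"; auto simp: V_def dist_commute)+
  have \<gamma>_reaper: "\<gamma> r \<in> reaper" if "r \<in> V" for r
    using gH VU(2)[OF that] by (simp add: \<gamma>_def reaper_iff)
  have zero: "F' (\<gamma> r) (g' r, 0) + tan (\<theta> r) * F' (\<gamma> r) (0, 1) = 0" if r: "r \<in> V" for r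
  proof -
    obtain d where d: "0 < d" "ball r d \<subseteq> V" using V(1) r open_contains_ball by blast
    have "(g' r, tan (\<theta> r)) \<in> tangent_space reaper (\<gamma> r)"
      unfolding tangent_space_def
    proof (intro CollectI exI[of _ "\<lambda>t. \<gamma> (r + t)"] exI[of _ d] conjI)
      show "(\<lambda>t. \<gamma> (r + t)) ` {-d<..<d} \<subseteq> reaper"
        using d(2) \<gamma>_reaper by (auto simp: dist_real_def subset_iff)
      show "((\<lambda>t. \<gamma> (r + t)) has_vector_derivative (g' r, tan (\<theta> r))) (at 0)"
      proof -
        have 1: "((\<lambda>t. r + t) has_vector_derivative 1) (at 0)"
          by (auto intro!: derivative_eq_intros)
        have "(\<gamma> has_vector_derivative (g' r, tan (\<theta> r))) (at (r + 0))"
          using \<gamma>d[OF VU(2)[OF r]] by simp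
        from vector_diff_chain_at[OF 1 this] show ?thesis by (simp add: o_def)
      qed
    qed (use d in auto)
    from deriv_along_tangent_zero[OF F'[OF VU(1)[OF r]] U(1) VU(1)[OF r] S this]
    have "F' (\<gamma> r) (g' r, tan (\<theta> r)) = 0" .
    moreover have "(g' r, tan (\<theta> r)) = (g' r, 0) + tan (\<theta> r) *\<^sub>R (0, 1)" by simp
    then have "F' (\<gamma> r) (g' r, tan (\<theta> r)) = F' (\<gamma> r) (g' r, 0) + tan (\<theta> r) * F' (\<gamma> r) (0, 1)"
      by (metis blinfun.add_right blinfun.scaleR_right real_scaleR_def)
    ultimately show ?thesis by simp
  qed
  have F\<gamma>: "(\<lambda>r. F' (\<gamma> r)) differentiable (at l)"
    using has_derivative_compose[OF \<gamma>d[OF l, unfolded has_vector_derivative_def], of F' F''] F''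
    by (auto simp: \<gamma>l differentiable_def)
  have "(g' has_vector_derivative (cosh (l - l) *\<^sub>R x + sinh (l - l) *\<^sub>R \<nu>)) (at l)"
    using hyp[of \<nu> x l] unfolding g'_def by (simp only: add.commute)
  then have "((\<lambda>r. (g' r, 0 :: real)) has_vector_derivative (cosh (l - l) *\<^sub>R x + sinh (l - l) *\<^sub>R \<nu>, 0)) (at l)"
    by (intro has_vector_derivative_Pair) auto
  then have g'0: "(\<lambda>r. (g' r, 0 :: real)) differentiable (at l)"
    by (auto simp: has_vector_derivative_def differentiable_def)
  \<comment> \<open>\<open>A\<close> and \<open>B\<close> involve only first derivatives of \<open>F\<close>, and \<open>zero\<close> reads \<open>tan \<theta> = - A / B\<close>\<close>
  define A B where "A r = F' (\<gamma> r) (g' r, 0)" and "B r = F' (\<gamma> r) (0, 1)" for r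
  have "(\<lambda>r. blinfun_apply (F' (\<gamma> r)) (h r)) differentiable (at l)" if "h differentiable (at l)" for h
    using bounded_bilinear.FDERIV[OF bounded_bilinear_blinfun_apply] F\<gamma> that
    unfolding differentiable_def by blast
  from this[OF g'0] this[OF differentiable_const]
  have A: "A differentiable (at l)" and B: "B differentiable (at l)"
    unfolding A_def B_def by auto
  have Bl: "B l \<noteq> 0" using vert by (simp add: B_def \<gamma>l)
  have "B \<midarrow>l\<rightarrow> B l" using differentiable_imp_continuous_within[OF B] by (simp add: isCont_def)
  then have "\<forall>\<^sub>F r in at l. B r \<noteq> 0" using Bl by (rule tendsto_imp_eventually_ne)
  moreover have "\<forall>\<^sub>F r in at l. r \<in> V" using V by (intro eventually_at_in_open')
  ultimately have ev: "\<forall>\<^sub>F r in at l. arctan (- A r / B r) = \<theta> r"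
  proof eventually_elim
    case (elim r)
    then have "- A r / B r = tan (\<theta> r)" using zero[of r] by (simp add: A_def B_def field_simps add_eq_0_iff)
    then show ?case using angle_range[OF VU(2)[OF elim(2)]] by (simp add: arctan_tan)
  qed
  have evl: "arctan (- A l / B l) = \<theta> l"
  proof -
    have "- A l / B l = tan (\<theta> l)" using zero[OF V(2)] Bl by (simp add: A_def B_def field_simps add_eq_0_iff)
    then show ?thesis using angle_range[OF l] by (simp add: arctan_tan)
  qed
  obtain A' B' where "(A has_real_derivative A') (at l)" "(B has_real_derivative B') (at l)"
    using A B by (auto simp: real_differentiable_def)
  then have "((\<lambda>r. - A r / B r) has_real_derivative (- A' * B l - - A l * B') / (B l * B l)) (at l)"
    using Bl by (intro DERIV_divide DERIV_minus)
  from DERIV_chain2[OF DERIV_arctan this]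
  have "\<exists>D. ((\<lambda>r. arctan (- A r / B r)) has_derivative D) (at l)"
    by (auto simp: has_field_derivative_def)
  then have "\<exists>D. (\<theta> has_derivative D) (at l)"
    using has_derivative_transform_eventually[OF _ ev evl] by blast
  then show False using angle_singular[OF l] by (simp add: differentiable_def)
qed

lemma C2_singular_set_eq: "C2_singular_set reaper = {p \<in> reaper. signed_dist e (fst p) = l}"
  using C2_singular_set_reaper not_C2_at_singular by (auto simp: C2_singular_set_def)

subsection \<open>Translators, invariance and heights\<close>

theorem n_translator_reaper: "n_translator reaper"
  unfolding n_translator_def
proof (intro conjI exI[of _ normal] ballI)
  show "hypersurface reaper" by (rule hypersurface_reaper)
  show "unit_normal reaper normal" by (rule unit_normal_reaper)
  show "has_gauss_curvature reaper normal p (angle_function normal p)" if "p \<in> reaper - C2_singular_set reaper" for p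
    using that gauss_curvature_reaper[of p] by (auto simp: C2_singular_set_eq)
qed

lemma reaper_UN: "reaper = (\<Union>s\<in>{s1<..<s2}. equidistant e s \<times> {\<phi> s})"
  by (auto simp: reaper_iff equidistant_signed_dist[OF e])

lemma hyperbolic_reaper: "hyperbolic_hypersurface e reaper"
  unfolding hyperbolic_hypersurface_def
proof (intro allI impI)
  fix \<tau> :: "'a \<times> real \<Rightarrow> 'a \<times> real"
  assume "hyperbolic_translation \<tau> \<and> (\<forall>s. \<tau> ` equidistant e s = equidistant e s)"
  then have \<tau>: "\<tau> ` equidistant e s = equidistant e s" for s by blast
  have "map_prod \<tau> id ` (equidistant e s \<times> {\<phi> s}) = equidistant e s \<times> {\<phi> s}" for s
    by (simp add: map_prod_surj_on \<tau>)
  then show "map_prod \<tau> id ` reaper = reaper" unfolding reaper_UN image_UN by simp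
qed

lemma vertical_graph_reaper: "vertical_graph (region_between e s1 s2) reaper"
  unfolding vertical_graph_def
proof
  show "reaper = (\<lambda>x. (x, (\<phi> \<circ> signed_dist e) x)) ` region_between e s1 s2"
    by (auto simp: reaper_def region_between_signed_dist[OF e])
qed

lemma heights_reaper: "snd ` reaper = \<phi> ` {s1<..<s2}"
  unfolding reaper_UN using equidistant_nonempty[OF e] by (auto simp: image_UN image_iff)

lemma height_continuous: "continuous_on {s1<..<s2} \<phi>"
  using height_deriv by (intro DERIV_continuous_on) (auto intro: has_field_derivative_at_within)

lemma lowest_points_reaper:
  assumes "m \<in> {s1<..<s2}" "\<And>s. s \<in> {s1<..<s2} \<Longrightarrow> s \<noteq> m \<Longrightarrow> \<phi> m < \<phi> s"
  shows "lowest_points reaper = equidistant e m \<times> {\<phi> m}"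
proof -
  have "p \<in> lowest_points reaper \<longleftrightarrow> p \<in> reaper \<and> (\<forall>s\<in>{s1<..<s2}. snd p \<le> \<phi> s)" for p
  proof -
    have "(\<forall>q\<in>reaper. snd p \<le> snd q) \<longleftrightarrow> (\<forall>t\<in>snd ` reaper. snd p \<le> t)" by simp
    then show ?thesis unfolding lowest_points_def heights_reaper by simp
  qed
  note low = this
  have min: "(\<forall>s\<in>{s1<..<s2}. \<phi> r \<le> \<phi> s) \<longleftrightarrow> r = m" if "r \<in> {s1<..<s2}" for r
  proof
    assume a: "\<forall>s\<in>{s1<..<s2}. \<phi> r \<le> \<phi> s"
    show "r = m"
    proof (rule ccontr)
      assume "r \<noteq> m"
      then have "\<phi> m < \<phi> r" using assms(2)[OF that] by simp
      then show False using a assms(1) by force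
    qed
  next
    assume r: "r = m"
    show "\<forall>s\<in>{s1<..<s2}. \<phi> r \<le> \<phi> s"
    proof
      fix s assume "s \<in> {s1<..<s2}"
      then show "\<phi> r \<le> \<phi> s" using assms(2)[of s] r by (cases "s = m") auto
    qed
  qed
  show ?thesis
  proof (intro set_eqI iffI)
    fix p assume p: "p \<in> lowest_points reaper"
    then have "p \<in> reaper" by (simp add: low)
    then obtain r where r: "r \<in> {s1<..<s2}" "p \<in> equidistant e r \<times> {\<phi> r}"
      unfolding reaper_UN UN_iff by (elim bexE)
    then have "r = m" using p low min by force
    then show "p \<in> equidistant e m \<times> {\<phi> m}" using r by simp
  next
    fix p assume p: "p \<in> equidistant e m \<times> {\<phi> m}"
    then have "p \<in> reaper" unfolding reaper_UN UN_iff using assms(1) by (intro bexI)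
    then show "p \<in> lowest_points reaper" using p low min[OF assms(1)] by force
  qed
qed

subsection \<open>Asymptotic behaviour\<close>

text \<open>
  Vertical asymptoticity is a property of the height as a function of the signed distance, as soon as
  the distance to \<open>F\<close> is a function of the signed distance.
\<close>

lemma vertically_asymptoticI:
  assumes F: "\<And>x. x \<in> hyp_space \<Longrightarrow> hdist_set x F = d (signed_dist e x)" "F \<subseteq> hyp_space"
    and 1: "\<And>r. 0 < r \<Longrightarrow> \<exists>K. \<forall>s\<in>{s1<..<s2}. K < \<phi> s \<longrightarrow> d s < r"
    and 2: "\<And>r. 0 < r \<Longrightarrow> \<exists>K. \<forall>t>K. \<forall>y\<in>F. \<exists>s\<in>{s1<..<s2}. \<phi> s = t \<and> \<bar>s - signed_dist e y\<bar> < r"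
    and 3: "\<And>K. \<exists>r>0. \<forall>s\<in>{s1<..<s2}. d s < r \<longrightarrow> K < \<phi> s"
  shows "vertically_asymptotic reaper F"
  unfolding vertically_asymptotic_def
proof (intro conjI allI impI)
  fix r :: real assume r: "0 < r"
  from 1[OF r] obtain K where "\<forall>s\<in>{s1<..<s2}. K < \<phi> s \<longrightarrow> d s < r" by blast
  then show "\<exists>K. \<forall>(x, t)\<in>reaper. K < t \<longrightarrow> hdist_set x F < r"
    by (intro exI[of _ K]) (auto elim!: reaperE simp: F(1))
  from 2[OF r] obtain K where K: "\<And>t y. K < t \<Longrightarrow> y \<in> F \<Longrightarrow> \<exists>s\<in>{s1<..<s2}. \<phi> s = t \<and> \<bar>s - signed_dist e y\<bar> < r"
    by blast
  show "\<exists>K. \<forall>t>K. \<forall>y\<in>F. \<exists>x. (x, t) \<in> reaper \<and> hdist x y < r"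
  proof (intro exI[of _ K] allI impI ballI)
    fix t y assume "K < t" and y: "y \<in> F"
    from K[OF this] obtain s where s: "s \<in> {s1<..<s2}" "\<phi> s = t" "\<bar>s - signed_dist e y\<bar> < r" by blast
    have yH: "y \<in> hyp_space" using y F(2) by blast
    show "\<exists>x. (x, t) \<in> reaper \<and> hdist x y < r"
      using s normal_flow(1,2,4)[OF e yH, of s] by (intro exI[of _ "normal_flow e y s"]) (auto simp: reaper_iff)
  qed
next
  fix K
  from 3 obtain r where "0 < r" "\<forall>s\<in>{s1<..<s2}. d s < r \<longrightarrow> K < \<phi> s" by blast
  then show "\<exists>r>0. \<forall>(x, t)\<in>reaper. hdist_set x F < r \<longrightarrow> K < t"
    by (intro exI[of _ r]) (auto elim!: reaperE simp: F(1))
qed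

lemma vertically_asymptotic_both_ends:
  assumes left: "filterlim \<phi> at_top (at_right s1)" and right: "filterlim \<phi> at_top (at_left s2)"
  shows "vertically_asymptotic reaper (equidistant e s1 \<union> equidistant e s2)"
proof (rule vertically_asymptoticI)
  show "hdist_set x (equidistant e s1 \<union> equidistant e s2) = min \<bar>signed_dist e x - s1\<bar> \<bar>signed_dist e x - s2\<bar>"
    if "x \<in> hyp_space" for x by (rule hdist_set_equidistant_Un[OF e that])
  show "equidistant e s1 \<union> equidistant e s2 \<subseteq> hyp_space" by (auto simp: equidistant_signed_dist[OF e])
next
  fix r :: real assume r: "0 < r"
  have "compact (\<phi> ` {s1 + r..s2 - r})"
    by (intro compact_continuous_image continuous_on_subset[OF height_continuous]) (use r in auto)
  then obtain K where K: "\<And>s. s \<in> {s1 + r..s2 - r} \<Longrightarrow> \<phi> s \<le> K"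
    by (meson bdd_above.unfold bounded_imp_bdd_above compact_imp_bounded imageI)
  have "min \<bar>s - s1\<bar> \<bar>s - s2\<bar> < r" if "s \<in> {s1<..<s2}" "K < \<phi> s" for s
    using K[of s] that by (cases "s1 + r \<le> s"; cases "s \<le> s2 - r") (auto simp: min_def)
  then show "\<exists>K. \<forall>s\<in>{s1<..<s2}. K < \<phi> s \<longrightarrow> min \<bar>s - s1\<bar> \<bar>s - s2\<bar> < r" by blast
  obtain K1 where K1: "\<And>t. K1 < t \<Longrightarrow> \<exists>s\<in>{s1<..<s2}. \<phi> s = t \<and> \<bar>s - s1\<bar> < r"
    using level_near_right_blowup[OF s12(2) height_continuous left r] by metis
  obtain K2 where K2: "\<And>t. K2 < t \<Longrightarrow> \<exists>s\<in>{s1<..<s2}. \<phi> s = t \<and> \<bar>s - s2\<bar> < r"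
    using level_near_left_blowup[OF s12(2) height_continuous right r] by metis
  show "\<exists>K. \<forall>t>K. \<forall>y\<in>equidistant e s1 \<union> equidistant e s2. \<exists>s\<in>{s1<..<s2}. \<phi> s = t \<and> \<bar>s - signed_dist e y\<bar> < r"
    by (rule exI[of _ "max K1 K2"]) (use K1 K2 in \<open>auto simp: equidistant_signed_dist[OF e]\<close>)
next
  fix K :: real
  obtain d1 where d1: "0 < d1" "\<And>s. s1 < s \<Longrightarrow> s < s1 + d1 \<Longrightarrow> K < \<phi> s"
    using filterlim_at_top_at_right_bound[OF left] by metis
  obtain d2 where d2: "0 < d2" "\<And>s. s2 - d2 < s \<Longrightarrow> s < s2 \<Longrightarrow> K < \<phi> s"
    using filterlim_at_top_at_left_bound[OF right] by metis
  have "K < \<phi> s" if s: "s1 < s" "s < s2" "min \<bar>s - s1\<bar> \<bar>s - s2\<bar> < min d1 d2" for s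
    using d1(2)[of s] d2(2)[of s] s by (auto simp: min_def abs_if split: if_splits)
  then show "\<exists>r>0. \<forall>s\<in>{s1<..<s2}. min \<bar>s - s1\<bar> \<bar>s - s2\<bar> < r \<longrightarrow> K < \<phi> s"
    using d1(1) d2(1) by (intro exI[of _ "min d1 d2"]) auto
qed

lemma vertically_asymptotic_upper_end:
  assumes cont: "continuous_on {s1..<s2} \<phi>" and right: "filterlim \<phi> at_top (at_left s2)"
  shows "vertically_asymptotic reaper (equidistant e s2)"
proof (rule vertically_asymptoticI)
  show "hdist_set x (equidistant e s2) = \<bar>signed_dist e x - s2\<bar>" if "x \<in> hyp_space" for x
    by (rule hdist_set_equidistant(1)[OF e that])
  show "equidistant e s2 \<subseteq> hyp_space" by (auto simp: equidistant_signed_dist[OF e])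
next
  fix r :: real assume r: "0 < r"
  have "compact (\<phi> ` {s1..s2 - r})"
    by (intro compact_continuous_image continuous_on_subset[OF cont]) (use r in auto)
  then obtain K where K: "\<And>s. s \<in> {s1..s2 - r} \<Longrightarrow> \<phi> s \<le> K"
    by (meson bdd_above.unfold bounded_imp_bdd_above compact_imp_bounded imageI)
  have "\<bar>s - s2\<bar> < r" if "s \<in> {s1<..<s2}" "K < \<phi> s" for s
    using K[of s] that by (cases "s \<le> s2 - r") auto
  then show "\<exists>K. \<forall>s\<in>{s1<..<s2}. K < \<phi> s \<longrightarrow> \<bar>s - s2\<bar> < r" by blast
  obtain K2 where K2: "\<And>t. K2 < t \<Longrightarrow> \<exists>s\<in>{s1<..<s2}. \<phi> s = t \<and> \<bar>s - s2\<bar> < r"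
    using level_near_left_blowup[OF s12(2) height_continuous right r] by metis
  then show "\<exists>K. \<forall>t>K. \<forall>y\<in>equidistant e s2. \<exists>s\<in>{s1<..<s2}. \<phi> s = t \<and> \<bar>s - signed_dist e y\<bar> < r"
    by (intro exI[of _ K2]) (auto simp: equidistant_signed_dist[OF e])
next
  fix K :: real
  obtain d2 where d2: "0 < d2" "\<And>s. s2 - d2 < s \<Longrightarrow> s < s2 \<Longrightarrow> K < \<phi> s"
    using filterlim_at_top_at_left_bound[OF right] by metis
  then show "\<exists>r>0. \<forall>s\<in>{s1<..<s2}. \<bar>s - s2\<bar> < r \<longrightarrow> K < \<phi> s"
    by (intro exI[of _ d2]) (auto simp: abs_if)
qed

lemma heights_unbounded:
  assumes right: "filterlim \<phi> at_top (at_left s2)"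
  shows "\<not> bdd_above (snd ` reaper)"
proof
  assume "bdd_above (snd ` reaper)"
  then obtain K where K: "\<And>s. s \<in> {s1<..<s2} \<Longrightarrow> \<phi> s \<le> K" unfolding heights_reaper bdd_above_def by blast
  obtain K2 where K2: "\<And>t. K2 < t \<Longrightarrow> \<exists>s\<in>{s1<..<s2}. \<phi> s = t \<and> \<bar>s - s2\<bar> < 1"
    using level_near_left_blowup[OF s12(2) height_continuous right zero_less_one] by metis
  show False using K2[of "max K K2 + 1"] K by force
qed

subsection \<open>The lower boundary\<close>

lemma boundary_in_closure:
  assumes cont: "continuous_on {s1..<s2} \<phi>"
  shows "equidistant e s1 \<times> {\<phi> s1} \<subseteq> closure reaper"
proof clarify
  fix a b assume "(a, b) \<in> equidistant e s1"
  then obtain x where x: "x = (a, b)" "x \<in> hyp_space" "signed_dist e x = s1"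
    by (auto simp: equidistant_signed_dist[OF e])
  have "((\<lambda>s. normal_flow e x s) \<longlongrightarrow> normal_flow e x s1) (at_right s1)"
    unfolding normal_flow_def[OF e] by (intro tendsto_intros)
  then have 1: "((\<lambda>s. normal_flow e x s) \<longlongrightarrow> x) (at_right s1)"
    using normal_flow(5)[OF e x(2)] x(3) by simp
  obtain c where c: "s1 < c" "c < s2" using s12 dense by blast
  have "continuous_on {s1..c} \<phi>" using cont by (rule continuous_on_subset) (use c in auto)
  then have "(\<phi> \<longlongrightarrow> \<phi> s1) (at s1 within {s1..c})" using c by (simp add: continuous_on_def)
  then have 2: "(\<phi> \<longlongrightarrow> \<phi> s1) (at_right s1)" using c by (simp add: at_within_Icc_at_right)
  have "(x, \<phi> s1) \<in> closure reaper"
  proof (rule Lim_in_closed_set[OF closed_closure _ _ tendsto_Pair[OF 1 2]])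
    show "\<forall>\<^sub>F s in at_right s1. (normal_flow e x s, \<phi> s) \<in> closure reaper"
      unfolding eventually_at_right_field
    proof (intro exI[of _ s2] conjI allI impI)
      fix s assume "s1 < s" "s < s2"
      then have "(normal_flow e x s, \<phi> s) \<in> reaper" using normal_flow(1,2)[OF e x(2)] by (simp add: reaper_iff)
      then show "(normal_flow e x s, \<phi> s) \<in> closure reaper" using closure_subset by blast
    qed (fact s12)
  qed simp
  then show "((a, b), \<phi> s1) \<in> closure reaper" by (simp add: x)
qed

text \<open>
  For each \<open>c\<close> the closure lies in the closed set of points that are at signed distance at most \<open>c\<close> or
  at height at least \<open>\<phi> c\<close>. A lowest point of the closure is below \<open>\<phi> c\<close>, so it is at signed
  distance at most \<open>c\<close>, for every \<open>c\<close> between \<open>s1\<close> and \<open>s2\<close>.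
\<close>

lemma lowest_points_closure:
  assumes cont: "continuous_on {s1..<s2} \<phi>"
    and mono: "\<And>s r. s1 \<le> s \<Longrightarrow> s < r \<Longrightarrow> r < s2 \<Longrightarrow> \<phi> s < \<phi> r"
  shows "lowest_points (closure reaper) = equidistant e s1 \<times> {\<phi> s1}"
proof -
  have above: "x \<in> hyp_space \<and> s1 \<le> signed_dist e x \<and> \<phi> s1 \<le> t \<and> (signed_dist e x \<le> c \<or> \<phi> c \<le> t)"
    if xt: "(x, t) \<in> closure reaper" and c: "s1 < c" "c < s2" for x t c
  proof -
    define T where "T = {z :: ('a \<times> real) \<times> real. fst z \<in> hyp_space \<and> s1 \<le> signed_dist e (fst z) \<and> \<phi> s1 \<le> snd z
      \<and> (signed_dist e (fst z) \<le> c \<or> \<phi> c \<le> snd z)}"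
    have "closed (fst -` hyp_space :: (('a \<times> real) \<times> real) set)"
      by (intro closed_vimage closed_hyp_space continuous_intros)
    then have "closed T"
      unfolding T_def vimage_def
      by (intro closed_Collect_conj closed_Collect_disj closed_Collect_le continuous_intros)
    moreover have "reaper \<subseteq> T"
    proof
      fix p assume "p \<in> reaper"
      then obtain x where "p = (x, \<phi> (signed_dist e x))" "x \<in> hyp_space" "signed_dist e x \<in> {s1<..<s2}"
        by (rule reaperE)
      then show "p \<in> T" using mono[of s1 "signed_dist e x"] mono[of c "signed_dist e x"] c
        by (cases "c < signed_dist e x") (auto simp: T_def)
    qed
    ultimately have "closure reaper \<subseteq> T" by (rule closure_minimal[rotated])
    then show ?thesis using xt by (auto simp: T_def)
  qed
  note sub = boundary_in_closure[OF cont]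
  obtain c where c: "s1 < c" "c < s2" using s12 dense by blast
  show ?thesis
  proof (intro set_eqI iffI)
    fix p assume p: "p \<in> lowest_points (closure reaper)"
    obtain x t where xt: "p = (x, t)" by (cases p)
    obtain y where "(y, \<phi> s1) \<in> closure reaper" using sub equidistant_nonempty[OF e, of s1] by blast
    then have t: "t \<le> \<phi> s1" and pc: "(x, t) \<in> closure reaper" using p by (auto simp: lowest_points_def xt)
    have "signed_dist e x \<le> c" if "s1 < c" "c < s2" for c
      using above[OF pc that] mono[of s1 c] t that by auto
    then have "signed_dist e x \<le> s1" using s12 by (meson dense_le_bounded dense_ge_bounded)
    then show "p \<in> equidistant e s1 \<times> {\<phi> s1}"
      using above[OF pc c] t by (auto simp: xt equidistant_signed_dist[OF e])
  next
    fix p assume "p \<in> equidistant e s1 \<times> {\<phi> s1}"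
    then have "p \<in> closure reaper" "snd p = \<phi> s1" using sub by auto
    moreover have "\<phi> s1 \<le> snd q" if "q \<in> closure reaper" for q using above[of "fst q" "snd q"] that c by auto
    ultimately show "p \<in> lowest_points (closure reaper)" by (simp add: lowest_points_def)
  qed
qed

text \<open>
  The formula for the normal extends continuously to the boundary, where \<open>\<theta> = 0\<close> makes it vertical.
\<close>

lemma tangent_along_boundary:
  assumes cont: "continuous_on {s1..<s2} \<phi>" and \<theta>: "continuous_on {s1..<s2} \<theta>" "\<theta> s1 = 0"
  shows "tangent_to_slice_along reaper (equidistant e s1) (\<phi> s1)"
  unfolding tangent_to_slice_along_def
proof (intro conjI exI[of _ normal] ballI boundary_in_closure[OF cont] unit_normal_reaper)
  fix q assume q: "q \<in> equidistant e s1 \<times> {\<phi> s1}"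
  define T where "T = {z :: ('a \<times> real) \<times> real. signed_dist e (fst z) \<in> {s1..<s2}}"
  have "continuous_on T (\<lambda>z. \<theta> (signed_dist e (fst z)))"
    by (rule continuous_on_compose2[OF \<theta>(1)]) (auto simp: T_def intro!: continuous_intros)
  then have "continuous_on T normal"
    unfolding normal_def level_normal_def by (intro continuous_intros) auto
  moreover have sq: "signed_dist e (fst q) = s1" using q by (auto simp: equidistant_signed_dist[OF e])
  then have "q \<in> T" using s12 by (simp add: T_def)
  ultimately have "(normal \<longlongrightarrow> normal q) (at q within T)" by (simp add: continuous_on_def)
  moreover have "reaper \<subseteq> T" by (auto simp: T_def reaper_iff)
  moreover have "normal q = vertical_field" by (simp add: normal_def vertical_field_def sq \<theta>(2) zero_prod_def)
  ultimately show "(normal \<longlongrightarrow> vertical_field) (at q within reaper)" by (metis tendsto_within_subset)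
qed

end


section \<open>Existence of the grim reapers\<close>

lemma tan_neg:
  fixes t :: real
  assumes "- (pi / 2) < t" "t < 0"
  shows "tan t < 0"
  using tan_gt_zero[of "- t"] assms by simp

text \<open>
  For odd dimension the exponent of the equation for \<open>\<theta>\<close> is even, so the angle can run from
  \<open>- (pi / 2)\<close> to \<open>pi / 2\<close>; the height decreases up to \<open>l\<close> and increases after it.
\<close>

lemma odd_reaper_exists:
  fixes e :: "'a::euclidean_space \<times> real"
  assumes e: "mink e e = 1" and n: "odd DIM('a)" "2 \<le> DIM('a)" and l: "0 < l"
  shows "\<exists>S. hyperbolic_hypersurface e S \<and> n_translator S \<and> S homeomorphic (UNIV :: 'a set) \<and>
    bdd_below (snd ` S) \<and> \<not> bdd_above (snd ` S) \<and>
    (\<exists>s1 s2. s1 < s2 \<and> vertical_graph (region_between e s1 s2) S \<and>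
       vertically_asymptotic S (equidistant e s1 \<union> equidistant e s2)) \<and>
    (\<exists>m. lowest_points S = equidistant e l \<times> {m} \<and> C2_singular_set S = equidistant e l \<times> {m})"
proof -
  have m: "0 < DIM('a) - 1" "even (DIM('a) - 1)" using n by auto
  obtain s1 s2 and \<theta> :: "real \<Rightarrow> real" where
    s: "0 < s1" "s1 < l" "l < s2"
    and cont: "continuous_on {s1..s2} \<theta>" and ends: "\<theta> s1 = - (pi / 2)" "\<theta> s2 = pi / 2" "\<theta> l = 0"
    and mono: "\<And>x y. s1 \<le> x \<Longrightarrow> x < y \<Longrightarrow> y \<le> s2 \<Longrightarrow> \<theta> x < \<theta> y"
    and ode: "\<And>s. s1 < s \<Longrightarrow> s < s2 \<Longrightarrow> s \<noteq> l \<Longrightarrow>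
       (\<theta> has_real_derivative 1 / (sin (\<theta> s) * tanh s) ^ (DIM('a) - 1)) (at s)"
    and sing: "\<not> \<theta> differentiable (at l)"
    and right: "\<And>\<phi>. (\<And>s. s1 < s \<Longrightarrow> s < s2 \<Longrightarrow> (\<phi> has_real_derivative tan (\<theta> s)) (at s)) \<Longrightarrow>
       filterlim \<phi> at_top (at_left s2)"
    and left: "\<And>\<phi>. (\<And>s. s1 < s \<Longrightarrow> s < s2 \<Longrightarrow> (\<phi> has_real_derivative tan (\<theta> s)) (at s)) \<Longrightarrow>
       filterlim \<phi> at_top (at_right s1)"
  proof (rule grim_reaper_angle[OF m(1) l, of "- (pi / 2)"])
    show "- (pi / 2) = 0 \<or> even (DIM('a) - 1) \<and> - (pi / 2) = - (pi / 2)" using m(2) by simp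
  qed (use pi_neq_zero in \<open>simp; blast\<close>)
  have range: "- (pi / 2) < \<theta> s \<and> \<theta> s < pi / 2" if "s \<in> {s1<..<s2}" for s
    using mono[of s1 s] mono[of s s2] ends that by auto
  have "\<exists>\<phi>. \<forall>x::real. ereal s1 < ereal x \<longrightarrow> ereal x < ereal s2 \<longrightarrow> (\<phi> has_vector_derivative tan (\<theta> x)) (at x)"
  proof (rule einterval_antiderivative)
    fix x assume "ereal s1 < ereal x" "ereal x < ereal s2"
    then have x: "s1 < x" "x < s2" by auto
    have "isCont \<theta> x" using continuous_on_interior[OF cont] x by simp
    moreover have "cos (\<theta> x) \<noteq> 0" using cos_gt_zero_pi[of "\<theta> x"] range[of x] x by auto
    ultimately show "isCont (\<lambda>x. tan (\<theta> x)) x" by (rule isCont_tan')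
  qed (use s in simp)
  then obtain \<phi> where \<phi>: "\<And>s. s1 < s \<Longrightarrow> s < s2 \<Longrightarrow> (\<phi> has_real_derivative tan (\<theta> s)) (at s)"
    by (auto simp: has_real_derivative_iff_has_vector_derivative)
  interpret grim_reaper e s1 s2 l \<phi> \<theta>
  proof
    show "continuous_on {s1<..<s2} \<theta>" using cont by (rule continuous_on_subset) auto
    show "\<theta> r \<noteq> 0" if "r \<in> {s1<..<s2} - {l}" for r
      using mono[of r l] mono[of l r] ends s that by (cases "r < l") auto
  qed (use e s range \<phi> ode sing in auto)
  have low: "\<phi> l < \<phi> r" if r: "r \<in> {s1<..<s2}" "r \<noteq> l" for r
  proof (cases "l < r")
    case True
    show ?thesis
    proof (rule DERIV_pos_imp_increasing_open[OF True])
      fix x assume x: "l < x" "x < r"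
      have "0 < \<theta> x" "\<theta> x < pi / 2" using mono[of l x] range[of x] ends s r x by auto
      then show "\<exists>y. DERIV \<phi> x :> y \<and> 0 < y" using \<phi>[of x] s r x tan_gt_zero by force
    next
      show "continuous_on {l..r} \<phi>" by (rule continuous_on_subset[OF height_continuous]) (use s r in auto)
    qed
  next
    case False
    then have rl: "r < l" using r by simp
    show ?thesis
    proof (rule DERIV_neg_imp_decreasing_open[OF rl])
      fix x assume x: "r < x" "x < l"
      have "\<theta> x < 0" "- (pi / 2) < \<theta> x" using mono[of x l] range[of x] ends s r x by auto
      then show "\<exists>y. DERIV \<phi> x :> y \<and> y < 0" using \<phi>[of x] s r x tan_neg by force
    next
      show "continuous_on {r..l} \<phi>" by (rule continuous_on_subset[OF height_continuous]) (use s r in auto)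
    qed
  qed
  have lin: "l \<in> {s1<..<s2}" using s by simp
  show ?thesis
  proof (intro exI conjI)
    show "hyperbolic_hypersurface e reaper" by (rule hyperbolic_reaper)
    show "n_translator reaper" by (rule n_translator_reaper)
    show "reaper homeomorphic (UNIV :: 'a set)" by (rule reaper_homeomorphic_UNIV)
    have "\<phi> l \<le> \<phi> r" if "r \<in> {s1<..<s2}" for r using low[OF that] by (cases "r = l") auto
    then show "bdd_below (snd ` reaper)" unfolding heights_reaper by (rule bdd_belowI2)
    show "\<not> bdd_above (snd ` reaper)" by (rule heights_unbounded[OF right[OF \<phi>]])
    show "s1 < s2" by (rule s12)
    show "vertical_graph (region_between e s1 s2) reaper" by (rule vertical_graph_reaper)
    show "vertically_asymptotic reaper (equidistant e s1 \<union> equidistant e s2)"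
      by (rule vertically_asymptotic_both_ends[OF left[OF \<phi>] right[OF \<phi>]])
    show "lowest_points reaper = equidistant e l \<times> {\<phi> l}" by (rule lowest_points_reaper[OF lin low])
    show "C2_singular_set reaper = equidistant e l \<times> {\<phi> l}"
      unfolding C2_singular_set_eq using lin by (auto simp: reaper_iff equidistant_signed_dist[OF e])
  qed
qed

text \<open>
  The angle starts from \<open>0\<close> at the boundary. In odd dimension, this construction yields the half of a
  grim reaper that lies beyond its lowest equidistant hypersurface.
\<close>

lemma even_reaper_exists:
  fixes e :: "'a::euclidean_space \<times> real"
  assumes e: "mink e e = 1" and n: "2 \<le> DIM('a)" and l: "0 < l"
  shows "\<exists>S. hyperbolic_hypersurface e S \<and> n_translator S \<and>
    bdd_below (snd ` S) \<and> \<not> bdd_above (snd ` S) \<and>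
    (\<exists>s2. l < s2 \<and> vertical_graph (region_between e l s2) S \<and>
       lowest_points (closure S) = equidistant e l \<times> {0} \<and>
       tangent_to_slice_along S (equidistant e l) 0 \<and>
       vertically_asymptotic S (equidistant e s2))"
proof -
  have m: "0 < DIM('a) - 1" using n by auto
  obtain s2 and \<theta> :: "real \<Rightarrow> real" where
    s: "l < s2"
    and cont: "continuous_on {l..s2} \<theta>" and ends: "\<theta> l = 0" "\<theta> s2 = pi / 2"
    and mono: "\<And>x y. l \<le> x \<Longrightarrow> x < y \<Longrightarrow> y \<le> s2 \<Longrightarrow> \<theta> x < \<theta> y"
    and ode: "\<And>s. l < s \<Longrightarrow> s < s2 \<Longrightarrow>
       (\<theta> has_real_derivative 1 / (sin (\<theta> s) * tanh s) ^ (DIM('a) - 1)) (at s)"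
    and right: "\<And>\<phi>. (\<And>s. l < s \<Longrightarrow> s < s2 \<Longrightarrow> (\<phi> has_real_derivative tan (\<theta> s)) (at s)) \<Longrightarrow>
       filterlim \<phi> at_top (at_left s2)"
  proof (rule grim_reaper_angle[OF m l, of 0])
  qed (simp; blast)+
  have range: "0 < \<theta> s \<and> \<theta> s < pi / 2" if "s \<in> {l<..<s2}" for s
    using mono[of l s] mono[of s s2] ends that by auto
  \<comment> \<open>\<open>\<theta>\<close> is extended by \<open>0\<close> to the left of \<open>l\<close>, so that the primitive is continuous at \<open>l\<close>\<close>
  have "\<exists>\<phi>. \<forall>x::real. ereal (l - 1) < ereal x \<longrightarrow> ereal x < ereal s2 \<longrightarrow>
      (\<phi> has_vector_derivative tan (\<theta> (max l x))) (at x)"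
  proof (rule einterval_antiderivative)
    fix x assume "ereal (l - 1) < ereal x" "ereal x < ereal s2"
    then have x: "x < s2" by auto
    have "continuous_on {..<s2} (\<lambda>x. \<theta> (max l x))"
      by (rule continuous_on_compose2[OF cont]) (use s in \<open>auto intro!: continuous_intros\<close>)
    then have "isCont (\<lambda>x. \<theta> (max l x)) x" using x by (simp add: continuous_on_eq_continuous_at)
    moreover have "cos (\<theta> (max l x)) \<noteq> 0"
      using cos_gt_zero_pi[of "\<theta> x"] range[of x] x ends by (cases "l < x") (auto simp: max_def)
    ultimately show "isCont (\<lambda>x. tan (\<theta> (max l x))) x" by (rule isCont_tan')
  qed (use s in simp)
  then obtain \<phi>0 where \<phi>0: "\<And>s. l - 1 < s \<Longrightarrow> s < s2 \<Longrightarrow> (\<phi>0 has_real_derivative tan (\<theta> (max l s))) (at s)"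
    by (auto simp: has_real_derivative_iff_has_vector_derivative)
  define \<phi> where "\<phi> r = \<phi>0 r - \<phi>0 l" for r
  have \<phi>': "(\<phi> has_real_derivative tan (\<theta> (max l r))) (at r)" if "l \<le> r" "r < s2" for r
    unfolding \<phi>_def using \<phi>0[of r] that by (auto intro!: derivative_eq_intros)
  have \<phi>: "(\<phi> has_real_derivative tan (\<theta> r)) (at r)" if "l < r" "r < s2" for r
    using \<phi>'[of r] that by (simp add: max_def)
  have \<phi>l: "\<phi> l = 0" by (simp add: \<phi>_def)
  have \<phi>cont: "continuous_on {l..<s2} \<phi>"
    using \<phi>' by (intro DERIV_continuous_on) (auto intro: has_field_derivative_at_within)
  have \<theta>cont: "continuous_on {l..<s2} \<theta>" using cont by (rule continuous_on_subset) auto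
  interpret grim_reaper e l s2 l \<phi> \<theta>
  proof
    show "continuous_on {l<..<s2} \<theta>" using cont by (rule continuous_on_subset) auto
    show "- (pi / 2) < \<theta> r \<and> \<theta> r < pi / 2" if "r \<in> {l<..<s2}" for r
      using range[OF that] pi_gt_zero by linarith
    show "\<theta> r \<noteq> 0" if "r \<in> {l<..<s2} - {l}" for r using range[of r] that by auto
  qed (use e s l \<phi> ode in auto)
  have incr: "\<phi> x < \<phi> y" if xy: "l \<le> x" "x < y" "y < s2" for x y
  proof (rule DERIV_pos_imp_increasing_open[OF xy(2)])
    fix r assume r: "x < r" "r < y"
    then show "\<exists>D. DERIV \<phi> r :> D \<and> 0 < D" using \<phi>[of r] range[of r] xy tan_gt_zero by force
  next
    show "continuous_on {x..y} \<phi>" by (rule continuous_on_subset[OF \<phi>cont]) (use xy in auto)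
  qed
  show ?thesis
  proof (intro exI conjI)
    show "hyperbolic_hypersurface e reaper" by (rule hyperbolic_reaper)
    show "n_translator reaper" by (rule n_translator_reaper)
    have "0 \<le> \<phi> r" if "r \<in> {l<..<s2}" for r using incr[of l r] \<phi>l that by auto
    then show "bdd_below (snd ` reaper)" unfolding heights_reaper by (rule bdd_belowI2)
    show "\<not> bdd_above (snd ` reaper)" by (rule heights_unbounded[OF right[OF \<phi>]])
    show "l < s2" by (rule s)
    show "vertical_graph (region_between e l s2) reaper" by (rule vertical_graph_reaper)
    show "lowest_points (closure reaper) = equidistant e l \<times> {0}"
      using lowest_points_closure[OF \<phi>cont incr] by (simp add: \<phi>l)
    show "tangent_to_slice_along reaper (equidistant e l) 0"
      using tangent_along_boundary[OF \<phi>cont \<theta>cont ends(1)] by (simp add: \<phi>l)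
    show "vertically_asymptotic reaper (equidistant e s2)"
      by (rule vertically_asymptotic_upper_end[OF \<phi>cont right[OF \<phi>]])
  qed
qed


section \<open>The one-parameter families\<close>

lemma lowest_points_translate:
  "lowest_points (map_prod id (\<lambda>t. t + h) ` S) = map_prod id (\<lambda>t. t + h) ` lowest_points S"
  (is "lowest_points (?f ` S) = _")
proof (intro set_eqI iffI)
  fix p assume p: "p \<in> lowest_points (?f ` S)"
  then obtain q where q: "q \<in> S" "p = ?f q" by (auto simp: lowest_points_def)
  have "snd q \<le> snd r" if "r \<in> S" for r
  proof -
    have "snd p \<le> snd (?f r)" using p that unfolding lowest_points_def by blast
    then show ?thesis by (simp add: q)
  qed
  then show "p \<in> ?f ` lowest_points S" using q by (simp add: lowest_points_def)
qed (auto simp: lowest_points_def)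

lemma equidistant_inj:
  assumes e: "mink e e = 1" and "equidistant e s = equidistant e s'"
  shows "s = s'"
proof -
  obtain x where "x \<in> equidistant e s" using equidistant_nonempty[OF e] by blast
  then show ?thesis using assms(2) by (metis equidistant_signed_dist[OF e])
qed

lemma signed_dist_image_region:
  assumes e: "mink e e = 1"
  shows "signed_dist e ` region_between e a b = {a<..<b}"
proof -
  have "r \<in> signed_dist e ` region_between e a b" if r: "r \<in> {a<..<b}" for r
  proof -
    obtain x where "x \<in> equidistant e r" using equidistant_nonempty[OF e] by blast
    then show ?thesis
      using r by (auto simp: region_between_signed_dist[OF e] equidistant_signed_dist[OF e])
  qed
  then show ?thesis by (auto simp: region_between_signed_dist[OF e])
qed

lemma fst_vertical_graph: "vertical_graph \<Omega> S \<Longrightarrow> fst ` S = \<Omega>"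
  by (auto simp: vertical_graph_def image_image)

lemma fst_translate: "fst ` map_prod id (\<lambda>t. t + h) ` S = fst ` S"
  by (simp add: image_image)

theorem theorem7:
  fixes e :: "(real ^ 'n) \<times> real"
  assumes "2 \<le> CARD('n)"
    and "mink e e = 1"
  shows
    "(odd CARD('n) \<longrightarrow>
       (\<exists>S :: real \<Rightarrow> (((real ^ 'n) \<times> real) \<times> real) set.
          one_parameter_family S \<and>
          (\<forall>l>0. hyperbolic_hypersurface e (S l) \<and> n_translator (S l) \<and>
             S l homeomorphic (UNIV :: (real ^ 'n) set) \<and>
             bdd_below (snd ` S l) \<and> \<not> bdd_above (snd ` S l) \<and>
             (\<exists>s1 s2. s1 < s2 \<and>
                vertical_graph (region_between e s1 s2) (S l) \<and>
                vertically_asymptotic (S l) (equidistant e s1 \<union> equidistant e s2)) \<and>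
             (\<exists>s m. lowest_points (S l) = equidistant e s \<times> {m} \<and>
                C2_singular_set (S l) = equidistant e s \<times> {m})))) \<and>
     (even CARD('n) \<longrightarrow>
       (\<exists>S :: real \<Rightarrow> (((real ^ 'n) \<times> real) \<times> real) set.
          one_parameter_family S \<and>
          (\<forall>l>0. hyperbolic_hypersurface e (S l) \<and> n_translator (S l) \<and>
             bdd_below (snd ` S l) \<and> \<not> bdd_above (snd ` S l) \<and>
             (\<exists>s1 s2. s1 < s2 \<and>
                vertical_graph (region_between e s1 s2) (S l) \<and>
                lowest_points (closure (S l)) = equidistant e s1 \<times> {0} \<and>
                tangent_to_slice_along (S l) (equidistant e s1) 0 \<and>
                vertically_asymptotic (S l) (equidistant e s2)))))"
proof (intro conjI impI)
  note e = assms(2)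
  have n: "2 \<le> DIM(real ^ 'n)" using assms(1) by simp
  {
    assume "odd CARD('n)"
    then have odd: "odd DIM(real ^ 'n)" by simp
    obtain S :: "real \<Rightarrow> (((real ^ 'n) \<times> real) \<times> real) set" where S: "\<And>l. 0 < l \<Longrightarrow>
      hyperbolic_hypersurface e (S l) \<and> n_translator (S l) \<and> S l homeomorphic (UNIV :: (real ^ 'n) set) \<and>
      bdd_below (snd ` S l) \<and> \<not> bdd_above (snd ` S l) \<and>
      (\<exists>s1 s2. s1 < s2 \<and> vertical_graph (region_between e s1 s2) (S l) \<and>
         vertically_asymptotic (S l) (equidistant e s1 \<union> equidistant e s2)) \<and>
      (\<exists>m. lowest_points (S l) = equidistant e l \<times> {m} \<and> C2_singular_set (S l) = equidistant e l \<times> {m})"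
      using odd_reaper_exists[OF e odd n] by metis
    have "one_parameter_family S"
      unfolding one_parameter_family_def
    proof (intro allI impI notI)
      fix l m h :: real assume l: "0 < l" and m: "0 < m" and "l \<noteq> m"
        and eq: "S m = map_prod id (\<lambda>t. t + h) ` S l"
      \<comment> \<open>the lowest equidistant hypersurface is at distance \<open>r\<close>, whatever the height\<close>
      have "fst ` lowest_points (S r) = equidistant e r" if "0 < r" for r
        using S[OF that] by auto
      moreover have "fst ` lowest_points (S m) = fst ` lowest_points (S l)"
        unfolding eq lowest_points_translate fst_translate ..
      ultimately show False using equidistant_inj[OF e] l m \<open>l \<noteq> m\<close> by metis
    qed
    then show "\<exists>S :: real \<Rightarrow> (((real ^ 'n) \<times> real) \<times> real) set.
          one_parameter_family S \<and>
          (\<forall>l>0. hyperbolic_hypersurface e (S l) \<and> n_translator (S l) \<and>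
             S l homeomorphic (UNIV :: (real ^ 'n) set) \<and>
             bdd_below (snd ` S l) \<and> \<not> bdd_above (snd ` S l) \<and>
             (\<exists>s1 s2. s1 < s2 \<and>
                vertical_graph (region_between e s1 s2) (S l) \<and>
                vertically_asymptotic (S l) (equidistant e s1 \<union> equidistant e s2)) \<and>
             (\<exists>s m. lowest_points (S l) = equidistant e s \<times> {m} \<and>
                C2_singular_set (S l) = equidistant e s \<times> {m}))"
    proof (intro exI[of _ S] conjI allI impI)
      fix l :: real assume "0 < l"
      note Sl = S[OF this]
      show "hyperbolic_hypersurface e (S l)" "n_translator (S l)" using Sl by simp_all
      show "S l homeomorphic (UNIV :: (real ^ 'n) set)" using Sl by simp
      show "bdd_below (snd ` S l)" "\<not> bdd_above (snd ` S l)" using Sl by simp_all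
      show "\<exists>s1 s2. s1 < s2 \<and> vertical_graph (region_between e s1 s2) (S l) \<and>
          vertically_asymptotic (S l) (equidistant e s1 \<union> equidistant e s2)" using Sl by simp
      show "\<exists>s m. lowest_points (S l) = equidistant e s \<times> {m} \<and>
          C2_singular_set (S l) = equidistant e s \<times> {m}" by (rule exI[of _ l]) (use Sl in simp)
    qed
  next
    obtain S :: "real \<Rightarrow> (((real ^ 'n) \<times> real) \<times> real) set" where S: "\<And>l. 0 < l \<Longrightarrow>
      hyperbolic_hypersurface e (S l) \<and> n_translator (S l) \<and>
      bdd_below (snd ` S l) \<and> \<not> bdd_above (snd ` S l) \<and>
      (\<exists>s2. l < s2 \<and> vertical_graph (region_between e l s2) (S l) \<and>
         lowest_points (closure (S l)) = equidistant e l \<times> {0} \<and>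
         tangent_to_slice_along (S l) (equidistant e l) 0 \<and>
         vertically_asymptotic (S l) (equidistant e s2))"
      using even_reaper_exists[OF e n] by metis
    have "one_parameter_family S"
      unfolding one_parameter_family_def
    proof (intro allI impI notI)
      fix l m h :: real assume l: "0 < l" and m: "0 < m" and "l \<noteq> m"
        and eq: "S m = map_prod id (\<lambda>t. t + h) ` S l"
      \<comment> \<open>the region below the graph starts at distance \<open>r\<close>, whatever the height\<close>
      have "\<exists>u>r. signed_dist e ` fst ` S r = {r<..<u}" if "0 < r" for r
        using S[OF that] fst_vertical_graph signed_dist_image_region[OF e] by metis
      moreover have "fst ` S m = fst ` S l" unfolding eq fst_translate ..
      ultimately obtain u v where "l < u" "m < v" "{m<..<v} = {l<..<u}" using l m by metis
      then show False using \<open>l \<noteq> m\<close> by (simp add: greaterThanLessThan_eq_iff)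
    qed
    then show "\<exists>S :: real \<Rightarrow> (((real ^ 'n) \<times> real) \<times> real) set.
          one_parameter_family S \<and>
          (\<forall>l>0. hyperbolic_hypersurface e (S l) \<and> n_translator (S l) \<and>
             bdd_below (snd ` S l) \<and> \<not> bdd_above (snd ` S l) \<and>
             (\<exists>s1 s2. s1 < s2 \<and>
                vertical_graph (region_between e s1 s2) (S l) \<and>
                lowest_points (closure (S l)) = equidistant e s1 \<times> {0} \<and>
                tangent_to_slice_along (S l) (equidistant e s1) 0 \<and>
                vertically_asymptotic (S l) (equidistant e s2)))"
    proof (intro exI[of _ S] conjI allI impI)
      fix l :: real assume "0 < l"
      note Sl = S[OF this]
      show "hyperbolic_hypersurface e (S l)" "n_translator (S l)" using Sl by simp_all
      show "bdd_below (snd ` S l)" "\<not> bdd_above (snd ` S l)" using Sl by simp_all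
      show "\<exists>s1 s2. s1 < s2 \<and>
                vertical_graph (region_between e s1 s2) (S l) \<and>
                lowest_points (closure (S l)) = equidistant e s1 \<times> {0} \<and>
                tangent_to_slice_along (S l) (equidistant e s1) 0 \<and>
                vertically_asymptotic (S l) (equidistant e s2)" by (rule exI[of _ l]) (use Sl in simp)
    qed
  }
qed

end
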